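(* Consider the two-dimensional risk model with constant interest rate $$U_i(t)=e^{rt}u_i+\frac{c_i}{r}(e^{rt}-1)-\delta_i\sum_{k=1}^{N(t)}e^{r(t-\theta_k)}\sigma_k,\qquad i=1,2,$$ with the assumptions listed in the context, in particular $c_1/\delta_1>c_2/\delta_2$. Let $\tau(u_1,u_2)=\inf\{t\ge 0:\min\{U_1(t),U_2(t)\}<0\}$ and, for $s>0$, $\Psi_{\min}(u_1,u_2,s)=E[e^{-s\tau(u_1,u_2)}]$. Then for $\frac{u_1}{\delta_1}\le\frac{u_2}{\delta_2}$ and $s>0$, the function $\Psi_{\min}(\cdot,\cdot,s)$ satisfies the integral-differential equation $$\Big(u_1+\frac{c_1}{r}\Big)\frac{\partial\Psi_{\min}}{\partial u_1}+\Big(u_2+\frac{c_2}{r}\Big)\frac{\partial\Psi_{\min}}{\partial u_2}-\frac{\lambda+s}{r}\Psi_{\min}+\frac{\lambda}{r}\int_0^\infty\Psi_{\min}(u_1-\delta_1 z,u_2-\delta_2 z,s)f(z)\,dz=0$$ with the boundary condition $$\Psi_{\min}\Big(u_1,\frac{\delta_2}{\delta_1}u_1,s\Big)=E\Big[e^{-s\tau_2(\frac{\delta_2}{\delta_1}u_1)}\Big],$$ where $\tau_2(v)=\inf\{t\ge0: U_2(t)<0\}$ denotes the ruin time of the one-dimensional risk process $U_2$ started from initial reserve $U_2(0)=v$. Furthermore, $\Psi_{\min}$ is the unique solution of this integral-differential equation with this boundary condition.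
   Context: Model: $r>0$ is a constant interest rate; $u_1,u_2$ are initial reserves; $c_1,c_2>0$ are premium rates; $0<\delta_1,\delta_2<1$ with $\delta_1+\delta_2=1$; $N(t)$ is a Poisson process with intensity $\lambda>0$; $\{\sigma_k\}_{k\ge1}$ are i.i.d. nonnegative claim sizes, independent of $N$, with distribution function $F$ and probability density $f$; $\theta_k$ is the arrival time of the $k$-th claim of $N$. Equivalently $U_i(t)=e^{rt}u_i+c_i\int_0^te^{r(t-v)}dv-\delta_i\int_0^te^{r(t-v)}dS_v$ with $S_t=\sum_{k=1}^{N(t)}\sigma_k$. It is assumed that $c_1/\delta_1>c_2/\delta_2$. The function $\Psi_{\min}(u_1,u_2,s)$ is defined for all real $(u_1,u_2)$; in particular if $\min\{u_1,u_2\}<0$ then $\tau(u_1,u_2)=0$ and $\Psi_{\min}(u_1,u_2,s)=1$.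
   Formalization: The equation is proved for u1 ≥ 0 (for u1 < 0 it fails, since there Ψ_min = 1 and the left side is −s/r), with one-sided derivatives at the region's edge; uniqueness is among differentiable solutions bounded on the region and equal to 1 when min{u1,u2} < 0, since unbounded ones exist. *)

theory Defs
  imports "HOL-Probability.Probability"
begin

text \<open>Compound Poisson model with constant interest.  The Poisson process is built from
 i.i.d. exponential inter-arrival times E 0, E 1, ...; the k-th claim (k = 0,1,...) arrives at
 arrival E k = E 0 + ... + E k and has size sigma k.  N(t) = card {k. arrival E k \<le> t}.\<close>

definition arrival :: "(nat \<Rightarrow> 'a \<Rightarrow> real) \<Rightarrow> nat \<Rightarrow> 'a \<Rightarrow> real" where
  "arrival E k \<omega> = (\<Sum>j\<le>k. E j \<omega>)"

definition surplus ::
  "real \<Rightarrow> real \<Rightarrow> real \<Rightarrow> real \<Rightarrow> (nat \<Rightarrow> 'a \<Rightarrow> real) \<Rightarrow> (nat \<Rightarrow> 'a \<Rightarrow> real) \<Rightarrow> real \<Rightarrow> 'a \<Rightarrow> real" where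
  "surplus r c \<delta> u E \<sigma> t \<omega> =
     exp (r * t) * u + c / r * (exp (r * t) - 1)
     - \<delta> * (\<Sum>k | arrival E k \<omega> \<le> t. exp (r * (t - arrival E k \<omega>)) * \<sigma> k \<omega>)"

text \<open>tau(u1,u2) = inf {t >= 0. min(U1 t, U2 t) < 0}, with inf {} = \<infinity>.\<close>
definition ruin_time_min ::
  "real \<Rightarrow> real \<Rightarrow> real \<Rightarrow> real \<Rightarrow> real \<Rightarrow> (nat \<Rightarrow> 'a \<Rightarrow> real) \<Rightarrow> (nat \<Rightarrow> 'a \<Rightarrow> real)
    \<Rightarrow> real \<Rightarrow> real \<Rightarrow> 'a \<Rightarrow> ereal" where
  "ruin_time_min r c1 c2 \<delta>1 \<delta>2 E \<sigma> u1 u2 \<omega> =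
     Inf {ereal t | t. 0 \<le> t \<and>
        min (surplus r c1 \<delta>1 u1 E \<sigma> t \<omega>) (surplus r c2 \<delta>2 u2 E \<sigma> t \<omega>) < 0}"

definition ruin_time_1d ::
  "real \<Rightarrow> real \<Rightarrow> real \<Rightarrow> (nat \<Rightarrow> 'a \<Rightarrow> real) \<Rightarrow> (nat \<Rightarrow> 'a \<Rightarrow> real) \<Rightarrow> real \<Rightarrow> 'a \<Rightarrow> ereal" where
  "ruin_time_1d r c \<delta> E \<sigma> v \<omega> = Inf {ereal t | t. 0 \<le> t \<and> surplus r c \<delta> v E \<sigma> t \<omega> < 0}"

definition laplace_ruin :: "'a measure \<Rightarrow> real \<Rightarrow> ('a \<Rightarrow> ereal) \<Rightarrow> real" where
  "laplace_ruin M s T = (\<integral>\<omega>. (if T \<omega> = \<infinity> then 0 else exp (- s * real_of_ereal (T \<omega>))) \<partial>M)"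

definition Psi_min ::
  "'a measure \<Rightarrow> real \<Rightarrow> real \<Rightarrow> real \<Rightarrow> real \<Rightarrow> real \<Rightarrow> (nat \<Rightarrow> 'a \<Rightarrow> real) \<Rightarrow> (nat \<Rightarrow> 'a \<Rightarrow> real)
    \<Rightarrow> real \<Rightarrow> real \<Rightarrow> real \<Rightarrow> real" where
  "Psi_min M r c1 c2 \<delta>1 \<delta>2 E \<sigma> s u1 u2 = laplace_ruin M s (ruin_time_min r c1 c2 \<delta>1 \<delta>2 E \<sigma> u1 u2)"

end

theory Submission
  imports Defs
begin

text \<open>Dividing the reserves by \<delta>1, \<delta>2 and shifting them turns the drift into the linear flow
  (y, d) \<mapsto> e^(rt) (y, d), where y belongs to the first line and d is the excess of the second over the
  first; a claim z maps (y, d) to (y - z, d). Conditioning on the first claim gives a renewal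
  equation, which averages along the flow and hence makes the Laplace transform V
  differentiable along the flow for an arbitrary claim density. Across the flow one uses that d is
  untouched by claims. For d < 0 the time until the diagonal is reached is a transversal
  coordinate; difference quotients in it satisfy a linear equation of the same kind, and a maximum
  principle reduces their uniform convergence to the diagonal, where the one-dimensional problem of
  the second line takes over. For d > 0 the second line is irrelevant. At d = 0 the hitting time
  of the diagonal becomes infinite, and V has derivative 0 in d: a change of d by e affects
  the ruin time only after a time of order ln (1 / e), so that discounting with s / 2 leaves a bound of
  order e^(1 + s / (2r)).
  Uniqueness holds because along the flow the difference of two solutions with the same values on
  the diagonal shrinks by the factor \<lambda> / (\<lambda> + s).\<close>

section \<open>Integrals against the claim and waiting-time densities\<close>

text \<open>The claim law is only assumed to have a density, and V jumps to 1 where ruin sets in, so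
  the integral over claims need not be differentiable in the starting point. Two devices avoid
  differentiating it. The claim integral is only ever required to be continuous, which holds because
  the jump is met by a null set of claim sizes; and limits of difference quotients are obtained from
  a Cauchy criterion, because away from the diagonal no formula for the derivative is known in
  advance. Total differentiability does not come from continuous partial derivatives either: points
  are slid along flow rays to one fixed abscissa, where a single one-dimensional derivative is
  enough. On the axis d = 0 the obvious estimate, discounting at the full rate over the time to the
  diagonal, has order e^(s / r), which is too weak when s <= r. Spending half of the rate on
  discounting and the other half on a Lipschitz bound raises the exponent above 1 for every s >
  0.\<close>

lemma borel_measurable_binary:
  fixes F :: "real \<Rightarrow> real \<Rightarrow> real"
  assumes "(\<lambda>p. F (fst p) (snd p)) \<in> borel_measurable (borel \<Otimes>\<^sub>M borel)"
    and "g \<in> borel_measurable N" "h \<in> borel_measurable N"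
  shows "(\<lambda>x. F (g x) (h x)) \<in> borel_measurable N"
proof -
  have "(\<lambda>x. (g x, h x)) \<in> measurable N (borel \<Otimes>\<^sub>M borel)" using assms by measurable
  from measurable_compose[OF this assms(1)] show ?thesis by simp
qed

locale claim_density =
  fixes f :: "real \<Rightarrow> real"
  assumes f_meas [measurable]: "f \<in> borel_measurable borel"
    and f_nonneg: "\<And>x. 0 \<le> f x"
    and f_neg: "\<And>x. x < 0 \<Longrightarrow> f x = 0"
    and f_int: "integrable lborel f"
    and f_one: "(\<integral>x. f x \<partial>lborel) = 1"
begin

definition avg :: "(real \<Rightarrow> real) \<Rightarrow> real" where
  "avg h = (\<integral>z. h z * f z \<partial>lborel)"

lemma avg_integrable:
  assumes [measurable]: "h \<in> borel_measurable borel" and B: "\<And>z. 0 \<le> z \<Longrightarrow> \<bar>h z\<bar> \<le> B"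
  shows "integrable lborel (\<lambda>z. h z * f z)"
proof (rule Bochner_Integration.integrable_bound[where f = "\<lambda>z. B * f z"])
  show "integrable lborel (\<lambda>z. B * f z)" using f_int by simp
  have "\<bar>h z\<bar> * f z \<le> \<bar>B\<bar> * f z" for z
  proof (cases "z < 0")
    case False
    have "\<bar>h z\<bar> \<le> \<bar>B\<bar>" using B[of z] False by linarith
    then show ?thesis using f_nonneg[of z] by (intro mult_right_mono) auto
  qed (simp add: f_neg)
  then show "AE z in lborel. norm (h z * f z) \<le> norm (B * f z)"
    using f_nonneg by (simp add: abs_mult)
qed simp

lemma avg_abs_le:
  assumes [measurable]: "h \<in> borel_measurable borel" and B: "\<And>z. 0 \<le> z \<Longrightarrow> \<bar>h z\<bar> \<le> B"
  shows "\<bar>avg h\<bar> \<le> B"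
proof -
  have le: "\<bar>h z * f z\<bar> \<le> B * f z" for z
  proof (cases "z < 0")
    case False
    then show ?thesis using B[of z] f_nonneg[of z] by (simp add: abs_mult mult_right_mono)
  qed (simp add: f_neg)
  have "\<bar>avg h\<bar> \<le> (\<integral>z. \<bar>h z * f z\<bar> \<partial>lborel)"
    unfolding avg_def by (rule integral_abs_bound)
  also have "\<dots> \<le> (\<integral>z. B * f z \<partial>lborel)"
    using avg_integrable[OF assms(1) B] f_int le by (intro integral_mono) auto
  also have "\<dots> = B" using f_one by simp
  finally show ?thesis .
qed

lemma avg_diff:
  assumes "h \<in> borel_measurable borel" "\<And>z. 0 \<le> z \<Longrightarrow> \<bar>h z\<bar> \<le> B"
    and "k \<in> borel_measurable borel" "\<And>z. 0 \<le> z \<Longrightarrow> \<bar>k z\<bar> \<le> B'"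
  shows "avg h - avg k = avg (\<lambda>z. h z - k z)"
  unfolding avg_def
  using avg_integrable[OF assms(1,2)] avg_integrable[OF assms(3,4)]
  by (subst Bochner_Integration.integral_diff[symmetric]) (auto simp: algebra_simps)

lemma avg_const [simp]: "avg (\<lambda>z. c) = c"
  unfolding avg_def using f_one by simp

lemma avg_mono:
  assumes "h \<in> borel_measurable borel" "\<And>z. 0 \<le> z \<Longrightarrow> \<bar>h z\<bar> \<le> B"
    and "k \<in> borel_measurable borel" "\<And>z. 0 \<le> z \<Longrightarrow> \<bar>k z\<bar> \<le> B'"
    and le: "\<And>z. 0 \<le> z \<Longrightarrow> h z \<le> k z"
  shows "avg h \<le> avg k"
  unfolding avg_def
proof (rule integral_mono[OF avg_integrable[OF assms(1,2)] avg_integrable[OF assms(3,4)]])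
  show "h z * f z \<le> k z * f z" for z
    using le[of z] f_nonneg[of z] f_neg[of z] by (cases "z < 0") (auto intro: mult_right_mono)
qed

lemma avg_cmult: "avg (\<lambda>z. c * h z) = c * avg h"
  unfolding avg_def by (simp add: mult.assoc)

lemma avg_cong: "(\<And>z. 0 \<le> z \<Longrightarrow> h z = k z) \<Longrightarrow> avg h = avg k"
  unfolding avg_def by (rule Bochner_Integration.integral_cong[OF refl]) (metis f_neg mult_zero_right not_less)

lemma avg_tendsto:
  assumes [measurable]: "\<And>n. h n \<in> borel_measurable borel" "k \<in> borel_measurable borel"
    and B: "\<And>n z. 0 \<le> z \<Longrightarrow> \<bar>h n z\<bar> \<le> B"
    and lim: "AE z in lborel. 0 \<le> z \<longrightarrow> (\<lambda>n. h n z) \<longlonglongrightarrow> k z"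
  shows "(\<lambda>n. avg (h n)) \<longlonglongrightarrow> avg k"
  unfolding avg_def
proof (rule integral_dominated_convergence[where w = "\<lambda>z. B * f z"])
  show "integrable lborel (\<lambda>z. B * f z)" using f_int by simp
  show "AE z in lborel. (\<lambda>n. h n z * f z) \<longlonglongrightarrow> k z * f z"
    using lim
  proof eventually_elim
    case (elim z)
    then show ?case by (cases "z < 0") (auto simp: f_neg intro: tendsto_intros)
  qed
  show "AE z in lborel. norm (h n z * f z) \<le> B * f z" for n
  proof (rule AE_I2)
    fix z
    show "norm (h n z * f z) \<le> B * f z"
      using B[of z n] f_nonneg[of z] f_neg[of z]
      by (cases "z < 0") (auto simp: abs_mult intro: mult_right_mono)
  qed
qed simp_all

text \<open>Uniform absolute continuity of the claim law, in place of boundedness of f: cutting f at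
  a high level n loses mass below \<eta> / 2, and what is left charges an interval with at most n
  times its length. Independence of the position of the interval is what
  \<open>edge_oscillation\<close> relies on.\<close>

lemma avg_interval_small:
  assumes "\<eta> > 0"
  shows "\<exists>\<delta>>0. \<forall>a b. b - a \<le> \<delta> \<longrightarrow> avg (indicator {a..b}) \<le> \<eta>"
proof -
  define fn where "fn n z = min (f z) (real n)" for n z
  have "(\<lambda>n. \<integral>z. f z - fn n z \<partial>lborel) \<longlonglongrightarrow> (\<integral>z. 0 \<partial>(lborel::real measure))"
  proof (rule integral_dominated_convergence[where w = f])
    show "AE z in lborel. (\<lambda>n. f z - fn n z) \<longlonglongrightarrow> 0"
    proof (rule AE_I2, rule tendsto_eventually)
      fix z
      obtain N :: nat where "f z \<le> N" using real_arch_simple by blast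
      then show "\<forall>\<^sub>F n in sequentially. f z - fn n z = 0"
        unfolding fn_def by (intro eventually_sequentiallyI[of N]) auto
    qed
    show "AE z in lborel. norm (f z - fn n z) \<le> f z" for n
      using f_nonneg by (auto simp: fn_def)
  qed (auto simp: fn_def f_int)
  then have "\<forall>\<^sub>F n in sequentially. (\<integral>z. f z - fn n z \<partial>lborel) < \<eta> / 2"
    using assms by (intro order_tendstoD(2)) auto
  then obtain n where n: "(\<integral>z. f z - fn n z \<partial>lborel) < \<eta> / 2"
    by (auto simp: eventually_sequentially)
  define \<delta> where "\<delta> = \<eta> / (2 * (real n + 1))"
  have "\<delta> > 0" using assms by (simp add: \<delta>_def)
  have int_fn: "integrable lborel (fn n)"
    by (rule Bochner_Integration.integrable_bound[OF f_int]) (auto simp: fn_def[abs_def] f_nonneg)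
  have "avg (indicator {a..b}) \<le> \<eta>" if "b - a \<le> \<delta>" for a b
  proof (cases "a \<le> b")
    case True
    have "avg (indicator {a..b}) \<le> (\<integral>z. (f z - fn n z) + real n * indicator {a..b} z \<partial>lborel)"
      unfolding avg_def
    proof (rule integral_mono)
      show "integrable lborel (\<lambda>z. indicator {a..b} z * f z)"
        by (rule avg_integrable[where B = 1]) (auto simp: indicator_def)
      show "integrable lborel (\<lambda>z. f z - fn n z + real n * indicator {a..b} z)"
        using f_int int_fn True by (intro Bochner_Integration.integrable_add Bochner_Integration.integrable_diff integrable_mult_right integrable_real_indicator) auto
      show "indicator {a..b} z * f z \<le> f z - fn n z + real n * indicator {a..b} z" for z
        using f_nonneg[of z] by (auto simp: indicator_def fn_def)
    qed
    also have "\<dots> = (\<integral>z. (f z - fn n z) \<partial>lborel) + real n * (b - a)"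
      using f_int int_fn True
      by (subst Bochner_Integration.integral_add) (auto intro!: integrable_real_indicator integrable_mult_right)
    also have "\<dots> \<le> \<eta> / 2 + (real n + 1) * \<delta>"
      using n that True \<open>\<delta> > 0\<close> by (intro add_mono mult_mono) auto
    also have "\<dots> = \<eta>" unfolding \<delta>_def by (simp add: field_simps)
    finally show ?thesis .
  next
    case False
    then show ?thesis using assms by (simp add: avg_def)
  qed
  with \<open>\<delta> > 0\<close> show ?thesis by blast
qed

end

text \<open>Flow times between points of one ray are logarithms of ratios; this turns them into
  distances.\<close>

lemma ln_ratio_le:
  fixes m y y' :: real
  assumes "0 < m" "m \<le> y" "m \<le> y'" shows "\<bar>ln (y' / y)\<bar> \<le> \<bar>y' - y\<bar> / m"
proof -
  have *: "ln (y' / y) \<le> \<bar>y' - y\<bar> / m" if "0 < m" "m \<le> y" "m \<le> y'" for y y' :: real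
  proof -
    have "ln (y' / y) \<le> y' / y - 1" using that by (intro ln_le_minus_one) auto
    also have "\<dots> = (y' - y) / y" using that by (simp add: field_simps)
    also have "\<dots> \<le> \<bar>y' - y\<bar> / m" using that by (intro frac_le) auto
    finally show ?thesis .
  qed
  have "ln (y' / y) = - ln (y / y')" using assms by (simp add: ln_div)
  then show ?thesis using *[OF assms] *[OF assms(1,3,2)] by (simp add: abs_le_iff abs_minus_commute)
qed

section \<open>Discounted exponential waiting times\<close>

text \<open>For b = lam + s and S in the half-line this is the expectation of exp(-s \<tau>) g
  \<tau> over the event that an exponential waiting time \<tau> of rate lam falls in S. Discount and
  density share one exponent; the total mass lam / b < 1 is the contraction constant of the later
  iterations.\<close>

definition tint :: "real \<Rightarrow> real \<Rightarrow> real set \<Rightarrow> (real \<Rightarrow> real) \<Rightarrow> real" where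
  "tint lam b S g = (\<integral>t. indicator S t * (lam * exp (- b * t) * g t) \<partial>lborel)"

lemma exp_integral_Icc:
  assumes "b > 0" "0 \<le> h"
  shows "integrable lborel (\<lambda>t. indicator {0..h} t * (lam * exp (- b * t)) :: real)"
    and "(\<integral>t. indicator {0..h} t * (lam * exp (- b * t)) \<partial>lborel) = lam / b * (1 - exp (- b * h))"
proof -
  have "has_bochner_integral lborel (\<lambda>t. (lam * exp (- b * t)) * indicator {0..h} t)
     ((- lam / b * exp (- b * h)) - (- lam / b * exp (- b * 0)))"
  proof (rule has_bochner_integral_FTC_Icc_real)
    show "DERIV (\<lambda>t. - lam / b * exp (- b * t)) x :> lam * exp (- b * x)" for x
      using assms by (auto intro!: derivative_eq_intros simp: field_simps)
  qed (use assms in auto)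
  then have "has_bochner_integral lborel (\<lambda>t. indicator {0..h} t * (lam * exp (- b * t)))
     (lam / b * (1 - exp (- b * h)))"
    by (simp add: mult.commute algebra_simps)
  then show "integrable lborel (\<lambda>t. indicator {0..h} t * (lam * exp (- b * t)) :: real)"
    and "(\<integral>t. indicator {0..h} t * (lam * exp (- b * t)) \<partial>lborel) = lam / b * (1 - exp (- b * h))"
    by (simp_all add: has_bochner_integral_iff)
qed

lemma exp_integral_Ici:
  assumes "b > 0"
  shows "integrable lborel (\<lambda>t. indicator {0..} t * (lam * exp (- b * t)) :: real)"
    and "(\<integral>t. indicator {0..} t * (lam * exp (- b * t)) \<partial>lborel) = lam / b"
proof -
  interpret E: prob_space "density lborel (exponential_density b)"
    by (rule prob_space_exponential_density[OF assms])
  have nn: "(\<integral>\<^sup>+ t. ennreal (exponential_density b t) \<partial>lborel) = 1"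
    using E.emeasure_space_1 by (simp add: emeasure_density)
  have int: "integrable lborel (exponential_density b)"
    using nn assms by (intro integrableI_nonneg) (auto simp: exponential_density_nonneg)
  have one: "(\<integral>t. exponential_density b t \<partial>lborel) = 1"
    using nn assms by (subst integral_eq_nn_integral) (auto simp: exponential_density_nonneg)
  have eq: "(\<lambda>t. indicator {0..} t * (lam * exp (- b * t))) = (\<lambda>t. lam / b * exponential_density b t)"
    using assms by (auto simp: exponential_density_def indicator_def fun_eq_iff mult.commute)
  show "integrable lborel (\<lambda>t. indicator {0..} t * (lam * exp (- b * t)) :: real)"
    unfolding eq using int by simp
  show "(\<integral>t. indicator {0..} t * (lam * exp (- b * t)) \<partial>lborel) = lam / b"
    unfolding eq using one by simp
qed

context
  fixes lam b :: real
  assumes lam: "lam > 0" and b: "b > 0"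
begin

lemma tint_integrable:
  assumes [measurable]: "g \<in> borel_measurable borel" "S \<in> sets borel" and S: "S \<subseteq> {0..}"
    and B: "\<And>t. t \<in> S \<Longrightarrow> \<bar>g t\<bar> \<le> B"
  shows "integrable lborel (\<lambda>t. indicator S t * (lam * exp (- b * t) * g t))"
proof (rule Bochner_Integration.integrable_bound[where f = "\<lambda>t. B * (indicator {0..} t * (lam * exp (- b * t)))"])
  show "integrable lborel (\<lambda>t. B * (indicator {0..} t * (lam * exp (- b * t))))"
    by (intro integrable_mult_right exp_integral_Ici b)
  show "AE t in lborel. norm (indicator S t * (lam * exp (- b * t) * g t))
      \<le> norm (B * (indicator {0..} t * (lam * exp (- b * t))))"
  proof (rule AE_I2)
    fix t
    show "norm (indicator S t * (lam * exp (- b * t) * g t))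
      \<le> norm (B * (indicator {0..} t * (lam * exp (- b * t))))"
    proof (cases "t \<in> S")
      case True
      then have "\<bar>g t\<bar> \<le> \<bar>B\<bar>" "t \<ge> 0" using B[of t] S by auto
      then show ?thesis using True lam by (simp add: abs_mult mult.commute mult_right_mono)
    qed simp
  qed
qed simp

lemma tint_abs_le_aux:
  assumes [measurable]: "g \<in> borel_measurable borel" "S \<in> sets borel" and S: "S \<subseteq> {0..}"
    and B: "\<And>t. t \<in> S \<Longrightarrow> \<bar>g t\<bar> \<le> B"
  shows "\<bar>tint lam b S g\<bar> \<le> B * (\<integral>t. indicator S t * (lam * exp (- b * t)) \<partial>lborel)"
proof -
  have "\<bar>tint lam b S g\<bar> \<le> (\<integral>t. \<bar>indicator S t * (lam * exp (- b * t) * g t)\<bar> \<partial>lborel)"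
    unfolding tint_def by (rule integral_abs_bound)
  also have "\<dots> \<le> (\<integral>t. B * (indicator S t * (lam * exp (- b * t))) \<partial>lborel)"
  proof (rule integral_mono)
    show "integrable lborel (\<lambda>t. \<bar>indicator S t * (lam * exp (- b * t) * g t)\<bar>)"
      using tint_integrable[OF assms(1-3) B] by auto
    have "integrable lborel (\<lambda>t. indicator S t * (lam * exp (- b * t) * 1))"
      by (rule tint_integrable) (use S in auto)
    then show "integrable lborel (\<lambda>t. B * (indicator S t * (lam * exp (- b * t))))" by simp
    show "\<bar>indicator S t * (lam * exp (- b * t) * g t)\<bar> \<le> B * (indicator S t * (lam * exp (- b * t)))" for t
      using B[of t] lam by (cases "t \<in> S") (auto simp: abs_mult mult.commute mult_right_mono)
  qed
  finally show ?thesis by simp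
qed

lemma tint_abs_le_Ici:
  assumes "g \<in> borel_measurable borel" "\<And>t. 0 \<le> t \<Longrightarrow> \<bar>g t\<bar> \<le> B"
  shows "\<bar>tint lam b {0..} g\<bar> \<le> lam / b * B"
  using tint_abs_le_aux[of g "{0..}" B] assms exp_integral_Ici(2)[OF b, of lam] by (simp add: mult.commute)

lemma tint_abs_le_Icc:
  assumes "g \<in> borel_measurable borel" "\<And>t. 0 \<le> t \<Longrightarrow> t \<le> h \<Longrightarrow> \<bar>g t\<bar> \<le> B" "0 \<le> h"
  shows "\<bar>tint lam b {0..h} g\<bar> \<le> lam / b * (1 - exp (- b * h)) * B"
  using tint_abs_le_aux[of g "{0..h}" B] assms exp_integral_Icc(2)[OF b, of h lam] by (simp add: mult.commute)

lemma tint_diff: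
  assumes "S \<in> sets borel" "S \<subseteq> {0..}"
    and "g \<in> borel_measurable borel" "\<And>t. t \<in> S \<Longrightarrow> \<bar>g t\<bar> \<le> B"
    and "k \<in> borel_measurable borel" "\<And>t. t \<in> S \<Longrightarrow> \<bar>k t\<bar> \<le> B'"
  shows "tint lam b S g - tint lam b S k = tint lam b S (\<lambda>t. g t - k t)"
  unfolding tint_def
  using tint_integrable[OF assms(3,1,2,4)] tint_integrable[OF assms(5,1,2,6)]
  by (subst Bochner_Integration.integral_diff[symmetric]) (auto simp: algebra_simps)

lemma tint_mono:
  assumes "S \<in> sets borel" "S \<subseteq> {0..}"
    and "g \<in> borel_measurable borel" "\<And>t. t \<in> S \<Longrightarrow> \<bar>g t\<bar> \<le> B"
    and "k \<in> borel_measurable borel" "\<And>t. t \<in> S \<Longrightarrow> \<bar>k t\<bar> \<le> B'"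
    and le: "\<And>t. t \<in> S \<Longrightarrow> g t \<le> k t"
  shows "tint lam b S g \<le> tint lam b S k"
  unfolding tint_def
  by (rule integral_mono[OF tint_integrable[OF assms(3,1,2,4)] tint_integrable[OF assms(5,1,2,6)]])
    (use le lam in \<open>auto simp: indicator_def\<close>)

lemma tint_cong: "(\<And>t. t \<in> S \<Longrightarrow> g t = k t) \<Longrightarrow> tint lam b S g = tint lam b S k"
  unfolding tint_def by (rule Bochner_Integration.integral_cong) (auto simp: indicator_def)

lemma tint_const: "0 \<le> h \<Longrightarrow> tint lam b {0..h} (\<lambda>t. c) = lam / b * (1 - exp (- b * h)) * c"
  using exp_integral_Icc(2)[OF b, of h lam] by (simp add: tint_def mult.assoc[symmetric])

text \<open>Memorylessness of the exponential law: translating the part beyond h reproduces the same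
  kind of integral up to the factor \<open>exp (- b * h)\<close>.\<close>

lemma tint_split:
  assumes [measurable]: "g \<in> borel_measurable borel" and B: "\<And>t. 0 \<le> t \<Longrightarrow> \<bar>g t\<bar> \<le> B" and h: "0 \<le> h"
  shows "tint lam b {0..} g = tint lam b {0..h} g + exp (- b * h) * tint lam b {0..} (\<lambda>t. g (t + h))"
proof -
  have int: "integrable lborel (\<lambda>t. indicator S t * (lam * exp (- b * t) * g t))"
    if "S \<in> sets borel" "S \<subseteq> {0..}" for S
    by (rule tint_integrable[where B = B]) (use that B in auto)
  have "tint lam b {0..} g
     = (\<integral>t. indicator {0..h} t * (lam * exp (- b * t) * g t) + indicator {h<..} t * (lam * exp (- b * t) * g t) \<partial>lborel)"
    unfolding tint_def using h by (intro Bochner_Integration.integral_cong) (auto simp: indicator_def)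
  also have "\<dots> = tint lam b {0..h} g + (\<integral>t. indicator {h<..} t * (lam * exp (- b * t) * g t) \<partial>lborel)"
    unfolding tint_def by (rule Bochner_Integration.integral_add; rule int; use h in auto)
  also have "(\<integral>t. indicator {h<..} t * (lam * exp (- b * t) * g t) \<partial>lborel)
     = (\<integral>t. indicator {h<..} (h + 1 * t) * (lam * exp (- b * (h + 1 * t)) * g (h + 1 * t)) \<partial>lborel)"
    by (subst lborel_integral_real_affine[where c = 1 and t = h]) simp_all
  also have "\<dots> = (\<integral>t. exp (- b * h) * (indicator {0..} t * (lam * exp (- b * t) * g (t + h))) \<partial>lborel)"
  proof (rule integral_cong_AE)
    \<comment> \<open>The translated half-line is open at 0 while \<open>{0..}\<close> is closed;
      they differ in a null set.\<close>
    have "AE t in lborel. t \<noteq> (0::real)" by (rule AE_lborel_singleton)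
    then show "AE t in lborel. indicator {h<..} (h + 1 * t) * (lam * exp (- b * (h + 1 * t)) * g (h + 1 * t))
       = exp (- b * h) * (indicator {0..} t * (lam * exp (- b * t) * g (t + h)))"
    proof eventually_elim
      case (elim t)
      have "exp (- b * (h + t)) = exp (- b * h) * exp (- b * t)"
        by (simp add: exp_add[symmetric] algebra_simps)
      then show ?case using elim by (auto simp: indicator_def add.commute)
    qed
  qed simp_all
  also have "\<dots> = exp (- b * h) * tint lam b {0..} (\<lambda>t. g (t + h))"
    unfolding tint_def by simp
  finally show ?thesis .
qed

text \<open>Only the oscillation of g enters: this is how solutions become differentiable along the flow
  although the claim density need not be continuous.\<close>
lemma flow_expansion:
  assumes [measurable]: "g \<in> borel_measurable borel" and g1: "\<And>t. 0 \<le> t \<Longrightarrow> t \<le> h \<Longrightarrow> \<bar>g t\<bar> \<le> 1"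
    and flow: "N0 = tint lam b {0..h} g + exp (- b * h) * N1" and h: "0 \<le> h"
    and e1: "\<bar>N1 - Nc\<bar> \<le> \<eta>" and e2: "\<And>t. 0 \<le> t \<Longrightarrow> t \<le> h \<Longrightarrow> \<bar>g t - gc\<bar> \<le> \<eta>"
    and Nc: "\<bar>Nc\<bar> \<le> 1" and gc: "\<bar>gc\<bar> \<le> 1"
  shows "\<bar>N1 - N0 - h * (b * Nc - lam * gc)\<bar> \<le> h * ((b + lam) * (\<eta> + b * h))"
proof -
  have e: "1 - exp (- b * h) \<le> b * h" "0 \<le> 1 - exp (- b * h)"
    using exp_ge_add_one_self[of "- b * h"] b h by auto
  \<comment> \<open>Second-order remainder of the exponential: with x = b h, only the estimate
    exp(-x) <= 1 - x + x^2 takes work.\<close>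
  have e': "\<bar>1 - exp (- b * h) - b * h\<bar> \<le> b * h * (b * h)"
  proof -
    define x where "x = b * h"
    have "x \<ge> 0" using b h by (simp add: x_def)
    have "exp x * (1 + x\<^sup>2 - x) \<ge> 1"
    proof -
      \<comment> \<open>The product equals 1 + x^3.\<close>
      have "1 \<le> (1 + x) * (1 + x\<^sup>2 - x)" using \<open>x \<ge> 0\<close> by (simp add: algebra_simps power2_eq_square)
      also have "\<dots> \<le> exp x * (1 + x\<^sup>2 - x)"
      proof (rule mult_right_mono)
        have "x * (1 - x) \<le> 1" 
          using zero_le_power2[of "x - 1/2"] by (simp add: power2_eq_square algebra_simps)
        then show "0 \<le> 1 + x\<^sup>2 - x" by (simp add: algebra_simps power2_eq_square)
      qed (rule exp_ge_add_one_self)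
      finally show ?thesis .
    qed
    then have "exp (-x) \<le> 1 + x\<^sup>2 - x" by (simp add: exp_minus field_simps)
    then show ?thesis using e unfolding x_def by (simp add: power2_eq_square abs_le_iff)
  qed
  define D where "D = 1 - exp (- b * h)"
  have t: "\<bar>tint lam b {0..h} g - lam / b * (1 - exp (- b * h)) * gc\<bar> \<le> lam / b * (1 - exp (- b * h)) * \<eta>"
  proof -
    have "tint lam b {0..h} g - tint lam b {0..h} (\<lambda>t. gc) = tint lam b {0..h} (\<lambda>t. g t - gc)"
      by (rule tint_diff[where B = 1 and B' = "\<bar>gc\<bar>"]) (use g1 in auto)
    then show ?thesis using tint_abs_le_Icc[of "\<lambda>t. g t - gc" h \<eta>] e2 h tint_const[of h gc] by simp
  qed
  have sum4: "\<bar>x\<bar> \<le> P + Q + U + W"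
    if "x = p + q - u - w" "\<bar>p\<bar> \<le> P" "\<bar>q\<bar> \<le> Q" "\<bar>u\<bar> \<le> U" "\<bar>w\<bar> \<le> W" for x p q u w P Q U W :: real
    using that by linarith
  \<comment> \<open>Linearisation: N1 is replaced by Nc, g by gc, and D by b h in the two places
    where it occurs, with one error term for each replacement.\<close>
  have "N1 - N0 - h * (b * Nc - lam * gc) = (N1 - Nc) * D + Nc * (D - b * h)
     - (tint lam b {0..h} g - lam / b * D * gc) - lam / b * (D - b * h) * gc"
    unfolding flow D_def using b by (simp add: field_simps)
  moreover have "\<bar>(N1 - Nc) * D\<bar> \<le> \<eta> * (b * h)"
    using e1 e unfolding D_def abs_mult by (intro mult_mono) auto
  moreover have "\<bar>Nc * (D - b * h)\<bar> \<le> 1 * (b * h * (b * h))"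
    using Nc e' unfolding D_def abs_mult by (intro mult_mono) auto
  moreover have "\<bar>tint lam b {0..h} g - lam / b * D * gc\<bar> \<le> lam / b * (b * h) * \<eta>"
  proof -
    have "0 \<le> \<eta>" using e1 by linarith
    then have "lam / b * D * \<eta> \<le> lam / b * (b * h) * \<eta>"
      using e lam b unfolding D_def by (intro mult_right_mono mult_left_mono) auto
    then show ?thesis using t unfolding D_def by linarith
  qed
  moreover have "\<bar>lam / b * (D - b * h) * gc\<bar> \<le> lam / b * (b * h * (b * h)) * 1"
    using gc e' lam b h unfolding D_def abs_mult by (intro mult_mono) auto
  ultimately have "\<bar>N1 - N0 - h * (b * Nc - lam * gc)\<bar>
     \<le> \<eta> * (b * h) + 1 * (b * h * (b * h)) + lam / b * (b * h) * \<eta> + lam / b * (b * h * (b * h)) * 1"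
    by (rule sum4)
  also have "\<dots> = h * ((b + lam) * (\<eta> + b * h))" using b by (simp add: field_simps)
  finally show ?thesis .
qed

end

section \<open>The renewal equation and the linear flow\<close>

text \<open>The last assumption compares the discount rates s and s / 2; it is what remains of the pathwise coupling of
  the processes started from (y, -e) and (y, 0).\<close>
locale renewal = claim_density f for f +
  fixes r lam a1 a2 :: real and V :: "real \<Rightarrow> real \<Rightarrow> real \<Rightarrow> real"
  assumes r: "0 < r" and lam: "0 < lam" and a2: "0 < a2" and a12: "a2 < a1"
    and V_meas: "\<And>s. 0 < s \<Longrightarrow> (\<lambda>p. V s (fst p) (snd p)) \<in> borel_measurable (borel \<Otimes>\<^sub>M borel)"
    and V_nonneg: "\<And>s y d. 0 < s \<Longrightarrow> 0 \<le> V s y d" and V_le_1: "\<And>s y d. 0 < s \<Longrightarrow> V s y d \<le> 1"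
    and V_ruin: "\<And>s y d. 0 < s \<Longrightarrow> y < a1 \<or> y + d < a2 \<Longrightarrow> V s y d = 1"
    and V_renewal: "\<And>s y d. 0 < s \<Longrightarrow> a1 \<le> y \<Longrightarrow> a2 \<le> y + d \<Longrightarrow>
      V s y d = tint lam (lam + s) {0..} (\<lambda>t. avg (\<lambda>z. V s (exp (r * t) * y - z) (exp (r * t) * d)))"
    and V_right: "\<And>s y d. 0 < s \<Longrightarrow> 0 \<le> d \<Longrightarrow> V s y d = V s y 0"
    and V_left: "\<And>s y d y' d'. 0 < s \<Longrightarrow> d \<le> a2 - a1 \<Longrightarrow> d' \<le> a2 - a1 \<Longrightarrow> y + d = y' + d' \<Longrightarrow>
      V s y d = V s y' d'"
    and V_ge: "\<And>s y e. 0 < s \<Longrightarrow> 0 \<le> e \<Longrightarrow> V s y 0 \<le> V s y (- e)"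
    and V_shift: "\<And>s y e. 0 < s \<Longrightarrow> 0 \<le> e \<Longrightarrow> V s y (- e) \<le> V s (y - e) 0"
    and V_half: "\<And>s y e. 0 < s \<Longrightarrow> 0 < e \<Longrightarrow> V s y (- e) - V s y 0
      \<le> 2 * (e / (a1 - a2)) powr (s / (2 * r)) * (V (s / 2) y (- e) - V (s / 2) y 0)"
begin

definition G :: "real \<Rightarrow> real \<Rightarrow> real \<Rightarrow> real" where
  "G s y d = avg (\<lambda>z. V s (y - z) d)"

text \<open>The right-hand side of the renewal equation on the whole half-plane; unlike V it does not jump
  at the boundary of the survival region.\<close>
definition R :: "real \<Rightarrow> real \<Rightarrow> real \<Rightarrow> real" where
  "R s y d = tint lam (lam + s) {0..} (\<lambda>t. G s (exp (r * t) * y) (exp (r * t) * d))"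

context
  fixes s :: real assumes s: "0 < s"
begin

lemma V_abs: "\<bar>V s y d\<bar> \<le> 1"
  using V_nonneg[OF s, of y d] V_le_1[OF s, of y d] by simp

lemma V_abs_diff: "\<bar>V s y d - V s y' d'\<bar> \<le> 1"
  using V_nonneg[OF s, of y d] V_le_1[OF s, of y d] V_nonneg[OF s, of y' d'] V_le_1[OF s, of y' d'] by simp

lemma V_measurable [measurable (raw)]:
  "g \<in> borel_measurable N \<Longrightarrow> h \<in> borel_measurable N \<Longrightarrow> (\<lambda>x. V s (g x) (h x)) \<in> borel_measurable N"
  by (rule borel_measurable_binary[OF V_meas[OF s]])

lemma G_measurable [measurable (raw)]:
  "g \<in> borel_measurable N \<Longrightarrow> h \<in> borel_measurable N \<Longrightarrow> (\<lambda>x. G s (g x) (h x)) \<in> borel_measurable N"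
proof -
  have "(\<lambda>p. G s (fst p) (snd p)) \<in> borel_measurable (borel \<Otimes>\<^sub>M borel)"
    unfolding G_def avg_def by measurable
  then show "g \<in> borel_measurable N \<Longrightarrow> h \<in> borel_measurable N \<Longrightarrow> (\<lambda>x. G s (g x) (h x)) \<in> borel_measurable N"
    by (rule borel_measurable_binary)
qed

lemma G_abs: "\<bar>G s y d\<bar> \<le> 1"
  unfolding G_def by (rule avg_abs_le) (use V_abs in auto)

lemma G_nonneg: "0 \<le> G s y d"
  unfolding G_def avg_def using V_nonneg[OF s] f_nonneg by (intro Bochner_Integration.integral_nonneg) auto

lemma b_pos: "0 < lam + s" using lam s by simp

lemma V_eq_R: "a1 \<le> y \<Longrightarrow> a2 \<le> y + d \<Longrightarrow> V s y d = R s y d"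
  unfolding R_def G_def by (rule V_renewal[OF s])

lemma R_flow:
  assumes "0 \<le> h"
  shows "R s y d = tint lam (lam + s) {0..h} (\<lambda>t. G s (exp (r * t) * y) (exp (r * t) * d))
    + exp (- (lam + s) * h) * R s (exp (r * h) * y) (exp (r * h) * d)"
proof -
  have "(\<lambda>t. G s (exp (r * (t + h)) * y) (exp (r * (t + h)) * d))
     = (\<lambda>t. G s (exp (r * t) * (exp (r * h) * y)) (exp (r * t) * (exp (r * h) * d)))"
    by (simp add: distrib_left exp_add mult_ac)
  then show ?thesis unfolding R_def
    by (subst tint_split[OF lam b_pos, where h = h and B = 1]) (use assms G_abs in auto)
qed

lemma R_abs: "\<bar>R s y d\<bar> \<le> 1"
proof -
  have "\<bar>R s y d\<bar> \<le> lam / (lam + s) * 1"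
    unfolding R_def by (rule tint_abs_le_Ici[OF lam b_pos]) (use G_abs in auto)
  also have "\<dots> \<le> 1" using lam s by simp
  finally show ?thesis .
qed

lemma R_nonneg: "0 \<le> R s y d"
  unfolding R_def tint_def using lam by (intro Bochner_Integration.integral_nonneg) (auto simp: G_nonneg)

lemma flow_S:
  assumes "a1 \<le> y" "a2 \<le> y + d" "0 \<le> h"
  shows "a1 \<le> exp (r * h) * y" "a2 \<le> exp (r * h) * y + exp (r * h) * d"
proof -
  have "1 \<le> exp (r * h)" using r assms by simp
  then show "a1 \<le> exp (r * h) * y" using assms a2 a12 mult_mono[of 1 "exp (r * h)" a1 y] by simp
  show "a2 \<le> exp (r * h) * y + exp (r * h) * d"
    using \<open>1 \<le> exp (r * h)\<close> assms a2 mult_mono[of 1 "exp (r * h)" a2 "y + d"] by (simp add: distrib_left)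
qed

lemma V_flow:
  assumes "a1 \<le> y" "a2 \<le> y + d" "0 \<le> h"
  shows "V s y d = tint lam (lam + s) {0..h} (\<lambda>t. G s (exp (r * t) * y) (exp (r * t) * d))
    + exp (- (lam + s) * h) * V s (exp (r * h) * y) (exp (r * h) * d)"
  unfolding V_eq_R[OF assms(1,2)] V_eq_R[OF flow_S[OF assms]] by (rule R_flow[OF assms(3)])

lemma one_minus_exp:
  assumes "0 \<le> h"
  shows "0 \<le> 1 - exp (- (lam + s) * h)" "1 - exp (- (lam + s) * h) \<le> (lam + s) * h"
proof -
  have "0 \<le> (lam + s) * h" using b_pos assms by simp
  then show "0 \<le> 1 - exp (- (lam + s) * h)" by (simp only: mult_minus_left one_le_exp_iff) simp
  show "1 - exp (- (lam + s) * h) \<le> (lam + s) * h"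
    using exp_ge_add_one_self[of "- (lam + s) * h"] by linarith
qed

text \<open>Two effects change R over a time h: a claim before h, and the discount that the
  continuation has lost. Both lie between 0 and (lam + s) h and enter with opposite signs, so the
  constant is not doubled.\<close>

lemma R_lipschitz_flow:
  assumes h: "0 \<le> h"
  shows "\<bar>R s y d - R s (exp (r * h) * y) (exp (r * h) * d)\<bar> \<le> (lam + s) * h"
proof -
  let ?g = "\<lambda>t. G s (exp (r * t) * y) (exp (r * t) * d)" and ?b = "lam + s"
  let ?N = "R s (exp (r * h) * y) (exp (r * h) * d)"
  have "\<bar>tint lam ?b {0..h} ?g\<bar> \<le> lam / ?b * (1 - exp (- ?b * h)) * 1"
    by (rule tint_abs_le_Icc[OF lam b_pos]) (use G_abs h in auto)
  also have "\<dots> \<le> 1 * (?b * h) * 1"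
    using one_minus_exp[OF h] lam s h b_pos by (intro mult_mono) auto
  finally have 1: "tint lam ?b {0..h} ?g \<le> ?b * h" by simp
  have 2: "0 \<le> tint lam ?b {0..h} ?g"
    unfolding tint_def using lam by (intro Bochner_Integration.integral_nonneg) (auto simp: G_nonneg)
  have "(1 - exp (- ?b * h)) * ?N \<le> ?b * h * 1" "0 \<le> (1 - exp (- ?b * h)) * ?N"
    using one_minus_exp[OF h] R_nonneg R_abs h b_pos
    by (intro mult_mono mult_nonneg_nonneg; auto simp: abs_le_iff)+
  moreover have "R s y d - ?N = tint lam ?b {0..h} ?g - (1 - exp (- ?b * h)) * ?N"
    using R_flow[OF h, of y d] by (simp add: algebra_simps)
  ultimately show ?thesis using 1 2 by (simp add: abs_le_iff)
qed

text \<open>The condition on d and d' puts both points on one ray from the origin, hence on one flow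
  line, with flow time ln (y' / y) / r between them.\<close>

lemma R_lipschitz_ray:
  assumes "0 < y" "0 < y'" "d' * y = d * y'"
  shows "\<bar>R s y d - R s y' d'\<bar> \<le> (lam + s) / r * \<bar>ln (y' / y)\<bar>"
proof -
  have *: "\<bar>R s y d - R s y' d'\<bar> \<le> (lam + s) / r * ln (y' / y)"
    if "0 < y" "y \<le> y'" "d' * y = d * y'" for y d y' d'
  proof -
    define h where "h = ln (y' / y) / r"
    have "0 \<le> h" "exp (r * h) = y' / y" using that r by (auto simp: h_def)
    moreover from this have "exp (r * h) * y = y'" "exp (r * h) * d = d'"
      using that by (auto simp: field_simps)
    ultimately show ?thesis using R_lipschitz_flow[of h y d] by (simp add: h_def)
  qed
  show ?thesis
  proof (cases "y \<le> y'")
    case True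
    then have "0 \<le> ln (y' / y)" using assms by simp
    then show ?thesis using *[of y y' d' d] True assms by simp
  next
    case False
    then have "ln (y' / y) = - ln (y / y')" "0 \<le> ln (y / y')" using assms by (auto simp: ln_div)
    then show ?thesis using *[of y' y d d'] False assms by (simp add: abs_minus_commute)
  qed
qed

text \<open>The comparison point (y - e, 0) may lie below a1, where V has already jumped to 1. So
  \<open>V_shift\<close> is applied under the integrals defining \<open>R\<close>, which bounds R at
  (y, -e) by R at (y - e, 0); the axis is itself a ray, and \<open>R\<close> is Lipschitz along
  it.\<close>

lemma V_near_axis:
  assumes "a1 \<le> y" "0 \<le> e" "a2 \<le> y - e"
  shows "V s y (- e) - V s y 0 \<le> (lam + s) / (r * a2) * e"
proof -
  have "V s y (- e) = R s y (- e)" "V s y 0 = R s y 0"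
    using assms a2 a12 by (auto intro!: V_eq_R)
  moreover have "R s y (- e) \<le> R s (y - e) 0"
    unfolding R_def
  proof (rule tint_mono[OF lam b_pos, where B = 1 and B' = 1])
    fix t :: real
    have "G s (exp (r * t) * y) (exp (r * t) * - e) \<le> avg (\<lambda>z. V s (exp (r * t) * (y - e) - z) 0)"
      unfolding G_def
    proof (rule avg_mono[where B = 1 and B' = 1])
      show "V s (exp (r * t) * y - z) (exp (r * t) * - e) \<le> V s (exp (r * t) * (y - e) - z) 0" for z
        using V_shift[OF s, of "exp (r * t) * e" "exp (r * t) * y - z"] assms
        by (simp add: algebra_simps)
    qed (use V_abs in auto)
    then show "G s (exp (r * t) * y) (exp (r * t) * - e) \<le> G s (exp (r * t) * (y - e)) (exp (r * t) * 0)"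
      unfolding G_def by simp
  qed (use G_abs in auto)
  moreover have "\<bar>R s (y - e) 0 - R s y 0\<bar> \<le> (lam + s) / r * \<bar>ln (y / (y - e))\<bar>"
    using assms a2 by (intro R_lipschitz_ray) auto
  moreover have "(lam + s) / r * \<bar>ln (y / (y - e))\<bar> \<le> (lam + s) / r * (\<bar>y - (y - e)\<bar> / a2)"
    using b_pos r assms a2 by (intro mult_left_mono ln_ratio_le) auto
  ultimately show ?thesis using assms by (simp add: field_simps)
qed

end

text \<open>To the right of the axis V does not depend on d. To its left \<open>V_half\<close>
  supplies the vanishing power of e, and \<open>V_near_axis\<close>, taken at rate s / 2, a further
  factor e.\<close>

lemma V_deriv_axis:
  assumes s: "0 < s" and y: "a1 \<le> y"
  shows "(V s y has_real_derivative 0) (at 0)"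
proof -
  define \<gamma> where "\<gamma> = s / (2 * r)"
  define C where "C = 2 * (lam + s / 2) / (r * a2)"
  have "\<gamma> > 0" using s r by (simp add: \<gamma>_def)
  have C: "C \<ge> 0" using s r a2 lam by (simp add: C_def)
  have bd: "\<bar>V s y d - V s y 0\<bar> \<le> C * (\<bar>d\<bar> / (a1 - a2)) powr \<gamma> * \<bar>d\<bar>" if "\<bar>d\<bar> < a1 - a2" for d
  proof (cases "0 \<le> d")
    case True
    then show ?thesis using V_right[OF s True] C by simp
  next
    case False
    define e where "e = - d"
    have e: "0 < e" "a2 \<le> y - e" using False that y by (auto simp: e_def)
    have "V s y (- e) - V s y 0 \<le> 2 * (e / (a1 - a2)) powr \<gamma> * (V (s / 2) y (- e) - V (s / 2) y 0)"
      unfolding \<gamma>_def by (rule V_half[OF s e(1)])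
    also have "\<dots> \<le> 2 * (e / (a1 - a2)) powr \<gamma> * ((lam + s / 2) / (r * a2) * e)"
      using s e y by (intro mult_left_mono V_near_axis) auto
    also have "\<dots> = C * (e / (a1 - a2)) powr \<gamma> * e" by (simp add: C_def)
    finally have "V s y (- e) - V s y 0 \<le> C * (e / (a1 - a2)) powr \<gamma> * e" .
    moreover have "0 \<le> V s y (- e) - V s y 0" using V_ge[OF s, of e y] e by simp
    ultimately show ?thesis using e(1) unfolding e_def by simp
  qed
  have "((\<lambda>d. C * (\<bar>d\<bar> / (a1 - a2)) powr \<gamma>) \<longlongrightarrow> C * (\<bar>0\<bar> / (a1 - a2)) powr \<gamma>) (at 0)"
    using \<open>\<gamma> > 0\<close> a12 by (intro tendsto_intros) auto
  then have lim: "((\<lambda>d. C * (\<bar>d\<bar> / (a1 - a2)) powr \<gamma>) \<longlongrightarrow> 0) (at 0)"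
    using \<open>\<gamma> > 0\<close> by simp
  have "((\<lambda>d. (V s y d - V s y 0) / d) \<longlongrightarrow> 0) (at 0)"
  proof (rule Lim_null_comparison[OF _ lim])
    have "\<forall>\<^sub>F d in at 0. \<bar>d\<bar> < a1 - a2 \<and> d \<noteq> 0"
      unfolding eventually_at using a12 by (intro exI[of _ "a1 - a2"]) (simp add: dist_real_def)
    then show "\<forall>\<^sub>F d in at 0. norm ((V s y d - V s y 0) / d) \<le> C * (\<bar>d\<bar> / (a1 - a2)) powr \<gamma>"
    proof eventually_elim
      case (elim d)
      then show ?case using bd[of d] by (simp only: real_norm_def abs_divide) (simp add: pos_divide_le_eq)
    qed
  qed
  then show ?thesis by (simp add: has_field_derivative_iff)
qed

section \<open>First-order expansion along flow lines\<close>

text \<open>Keeps a whole flow segment near a point as soon as both of its ends are near: exp(r t) v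
  moves monotonically away from 0, whatever the sign of v.\<close>

lemma scale_between:
  fixes v :: real
  assumes "1 \<le> a" "a \<le> c" "\<bar>v - x\<bar> < \<rho>" "\<bar>c * v - x\<bar> < \<rho>"
  shows "\<bar>a * v - x\<bar> < \<rho>"
proof (cases "0 \<le> v")
  case True
  then have "v \<le> a * v" "a * v \<le> c * v" using assms by (auto intro: mult_right_mono simp: mult_le_cancel_right1)
  then show ?thesis using assms by linarith
next
  case False
  then have "a * v \<le> v" "c * v \<le> a * v" using assms by (auto simp: mult_le_cancel_right2 mult_le_cancel_right)
  then show ?thesis using assms by linarith
qed

lemma dist_pair_less:
  fixes x y x' y' :: real
  assumes "\<bar>x - x'\<bar> < e / 2" "\<bar>y - y'\<bar> < e / 2"
  shows "dist (x, y) (x', y') < e"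
  using sqrt_sum_squares_le_sum_abs[of "x - x'" "y - y'"] assms
  by (simp add: dist_Pair_Pair dist_real_def)

text \<open>A point of B is compared with the point of its flow line whose first coordinate is y0.\<close>
lemma flow_first_order:
  fixes N g :: "real \<times> real \<Rightarrow> real"
  assumes b: "0 < b"
    and flow: "\<And>y d h. (y, d) \<in> A \<Longrightarrow> 0 \<le> h \<Longrightarrow> N (y, d) =
      tint lam b {0..h} (\<lambda>t. g (exp (r * t) * y, exp (r * t) * d))
        + exp (- b * h) * N (exp (r * h) * y, exp (r * h) * d)"
    and inv: "\<And>y d h. (y, d) \<in> A \<Longrightarrow> 0 \<le> h \<Longrightarrow> (exp (r * h) * y, exp (r * h) * d) \<in> A"
    and meas: "\<And>y d. (\<lambda>t. g (exp (r * t) * y, exp (r * t) * d)) \<in> borel_measurable borel"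
    and g1: "\<And>p. \<bar>g p\<bar> \<le> 1" and N1: "\<And>p. \<bar>N p\<bar> \<le> 1"
    and pos: "\<And>y d. (y, d) \<in> A \<Longrightarrow> 0 < y"
    and BA: "B \<subseteq> A" and p0: "(y0, d0) \<in> A"
    and to_y0: "\<And>y d. (y, d) \<in> B \<Longrightarrow> (y0, d * y0 / y) \<in> A"
    and cN: "continuous (at (y0, d0) within A) N" and cg: "continuous (at (y0, d0) within A) g"
  shows "((\<lambda>p. N p - N (y0, snd p * y0 / fst p) - ln (fst p / y0) / r * (b * N (y0, d0) - lam * g (y0, d0)))
    has_derivative (\<lambda>_. 0)) (at (y0, d0) within B)"
  unfolding has_derivative_within_alt
proof (intro conjI allI impI)
  show "bounded_linear (\<lambda>_::real \<times> real. 0::real)" by simp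
  fix e :: real assume "0 < e"
  have y0: "0 < y0" using pos[OF p0] .
  define L where "L = b * N (y0, d0) - lam * g (y0, d0)"
  \<comment> \<open>Chosen backwards from the final estimate: the error is at most 2 (b + lam)
    \<eta> times the flow time, and the flow time is at most |y - y0| / (r y0 / 2).\<close>
  define \<eta> where "\<eta> = e * y0 / 2 * r / (2 * (b + lam))"
  have "\<eta> > 0" using \<open>0 < e\<close> y0 r b lam by (simp add: \<eta>_def)
  obtain \<rho>1 where \<rho>1: "\<rho>1 > 0" "\<And>p. p \<in> A \<Longrightarrow> dist p (y0, d0) < \<rho>1 \<Longrightarrow> \<bar>N p - N (y0, d0)\<bar> < \<eta>"
    using cN \<open>\<eta> > 0\<close> unfolding continuous_within_eps_delta dist_real_def by blast
  obtain \<rho>2 where \<rho>2: "\<rho>2 > 0" "\<And>p. p \<in> A \<Longrightarrow> dist p (y0, d0) < \<rho>2 \<Longrightarrow> \<bar>g p - g (y0, d0)\<bar> < \<eta>"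
    using cg \<open>\<eta> > 0\<close> unfolding continuous_within_eps_delta dist_real_def by blast
  define \<rho> where "\<rho> = min \<rho>1 \<rho>2"
  have \<rho>: "\<rho> > 0" using \<rho>1 \<rho>2 by (simp add: \<rho>_def)
  have key: "\<bar>N (exp (r * h) * u, exp (r * h) * v) - N (u, v) - h * L\<bar> \<le> h * ((b + lam) * (\<eta> + b * h))"
    if A: "(u, v) \<in> A" and h: "0 \<le> h"
      and u: "\<bar>u - y0\<bar> < \<rho> / 2" "\<bar>exp (r * h) * u - y0\<bar> < \<rho> / 2"
      and v: "\<bar>v - d0\<bar> < \<rho> / 2" "\<bar>exp (r * h) * v - d0\<bar> < \<rho> / 2" for u v h
  proof -
    have near: "dist (exp (r * t) * u, exp (r * t) * v) (y0, d0) < \<rho>" if t: "0 \<le> t" "t \<le> h" for t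
    proof (rule dist_pair_less)
      have "1 \<le> exp (r * t)" "exp (r * t) \<le> exp (r * h)" using t r by (auto intro: mult_left_mono)
      then show "\<bar>exp (r * t) * u - y0\<bar> < \<rho> / 2" "\<bar>exp (r * t) * v - d0\<bar> < \<rho> / 2"
        using scale_between[OF _ _ u] scale_between[OF _ _ v] by blast+
    qed
    show ?thesis unfolding L_def
    proof (rule flow_expansion[OF lam b meas _ flow[OF A h] h])
      show "\<bar>g (exp (r * t) * u, exp (r * t) * v) - g (y0, d0)\<bar> \<le> \<eta>" if "0 \<le> t" "t \<le> h" for t
        using \<rho>2(2)[OF inv[OF A that(1)]] near[OF that] by (simp add: \<rho>_def)
      show "\<bar>N (exp (r * h) * u, exp (r * h) * v) - N (y0, d0)\<bar> \<le> \<eta>"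
        using \<rho>1(2)[OF inv[OF A h]] near[OF h order_refl] by (simp add: \<rho>_def)
    qed (rule g1 N1)+
  qed
  \<comment> \<open>Bound on the logarithm that makes b times the flow time at most \<eta>.\<close>
  define \<mu> where "\<mu> = r * \<eta> / b"
  have "\<mu> > 0" using r b \<open>\<eta> > 0\<close> by (simp add: \<mu>_def)
  have "((\<lambda>p. snd p * y0 / fst p) \<longlongrightarrow> snd (y0, d0) * y0 / fst (y0, d0)) (nhds (y0, d0))"
    using y0 by (intro tendsto_intros filterlim_ident) auto
  from tendstoD[OF this, of "\<rho> / 2"]
  have t1: "\<forall>\<^sub>F p in nhds (y0, d0). \<bar>snd p * y0 / fst p - d0\<bar> < \<rho> / 2"
    using \<rho> y0 by (simp add: dist_real_def)
  have "((\<lambda>p. ln (fst p / y0)) \<longlongrightarrow> ln (fst (y0, d0) / y0)) (nhds (y0, d0))"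
    using y0 by (intro tendsto_intros filterlim_ident) auto
  from tendstoD[OF this, of \<mu>]
  have t2: "\<forall>\<^sub>F p in nhds (y0, d0). \<bar>ln (fst p / y0)\<bar> < \<mu>"
    using \<open>\<mu> > 0\<close> y0 by (simp add: dist_real_def)
  have "((\<lambda>p. fst p) \<longlongrightarrow> fst (y0, d0)) (nhds (y0, d0))"
    by (intro tendsto_intros filterlim_ident)
  from tendstoD[OF this, of "min (\<rho> / 2) (y0 / 2)"]
  have t3: "\<forall>\<^sub>F p in nhds (y0, d0). \<bar>fst p - y0\<bar> < min (\<rho> / 2) (y0 / 2)"
    using \<rho> y0 by (simp add: dist_real_def)
  have "((\<lambda>p. snd p) \<longlongrightarrow> snd (y0, d0)) (nhds (y0, d0))"
    by (intro tendsto_intros filterlim_ident)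
  from tendstoD[OF this, of "\<rho> / 2"]
  have t4: "\<forall>\<^sub>F p in nhds (y0, d0). \<bar>snd p - d0\<bar> < \<rho> / 2"
    using \<rho> by (simp add: dist_real_def)
  from eventually_conj[OF eventually_conj[OF t1 t2] eventually_conj[OF t3 t4]]
  obtain \<delta> where \<delta>: "\<delta> > 0" "\<And>p. dist p (y0, d0) < \<delta> \<Longrightarrow>
      (\<bar>snd p * y0 / fst p - d0\<bar> < \<rho> / 2 \<and> \<bar>ln (fst p / y0)\<bar> < \<mu>) \<and>
      (\<bar>fst p - y0\<bar> < min (\<rho> / 2) (y0 / 2) \<and> \<bar>snd p - d0\<bar> < \<rho> / 2)"
    unfolding eventually_nhds_metric by blast
  have main: "\<bar>N (y, d) - N (y0, d * y0 / y) - ln (y / y0) / r * L\<bar> \<le> e * dist (y, d) (y0, d0)"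
    if B: "(y, d) \<in> B" and near: "dist (y, d) (y0, d0) < \<delta>" for y d
  proof -
    have A: "(y, d) \<in> A" "(y0, d * y0 / y) \<in> A" using B BA to_y0 by auto
    have y: "0 < y" using pos A by blast
    note n = \<delta>(2)[OF near, simplified]
    define h where "h = \<bar>ln (y / y0)\<bar> / r"
    have h: "0 \<le> h" using r by (simp add: h_def)
    have "\<bar>N (y, d) - N (y0, d * y0 / y) - ln (y / y0) / r * L\<bar> \<le> h * ((b + lam) * (\<eta> + b * h))"
    \<comment> \<open>The expansion runs forward in time, so the segment starts at whichever point
      has the smaller first coordinate: the reference point on abscissa y0 in the first case, (y, d)
      in the second.\<close>
    proof (cases "y0 \<le> y")
      case True
      then have "0 \<le> ln (y / y0)" using y0 by simp
      then have "h = ln (y / y0) / r" "exp (r * h) = y / y0" using y0 y r by (auto simp: h_def)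
      then show ?thesis using key[OF A(2) h] n y y0 \<rho> by simp
    next
      case False
      then have l: "ln (y0 / y) = - ln (y / y0)" "ln (y / y0) \<le> 0" using y0 y by (auto simp: ln_div)
      then have "h = - ln (y / y0) / r" "h = ln (y0 / y) / r" by (auto simp: h_def)
      moreover from this(2) have "exp (r * h) = y0 / y" using y0 y r by simp
      ultimately show ?thesis using key[OF A(1) h] n y y0 \<rho> by (simp add: algebra_simps abs_minus_commute)
    qed
    also have "\<dots> \<le> h * ((b + lam) * (\<eta> + \<eta>))"
    proof -
      have "b * h \<le> \<eta>" using n b r unfolding h_def \<mu>_def by (simp add: field_simps)
      then show ?thesis using h b lam by (intro mult_left_mono add_left_mono) auto
    qed
    also have "\<dots> = \<bar>ln (y / y0)\<bar> * (e * y0 / 2)"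
    proof -
      have half: "q * (x / (2 * q) + x / (2 * q)) = x" if "q \<noteq> 0" for q x :: real
        using that by (simp add: field_simps)
      have "b + lam \<noteq> 0" using b lam by simp
      then have "(b + lam) * (\<eta> + \<eta>) = e * y0 / 2 * r" unfolding \<eta>_def
        using half[of "b + lam"] by blast
      then have "h * ((b + lam) * (\<eta> + \<eta>)) = h * (e * y0 / 2 * r)" by (rule arg_cong)
      then show ?thesis using r by (simp add: h_def)
    qed
    also have "\<dots> \<le> \<bar>y - y0\<bar> / (y0 / 2) * (e * y0 / 2)"
    proof (rule mult_right_mono)
      show "\<bar>ln (y / y0)\<bar> \<le> \<bar>y - y0\<bar> / (y0 / 2)"
      proof (rule ln_ratio_le)
        have "\<bar>y - y0\<bar> < y0 / 2" using n by simp
        then show "y0 / 2 \<le> y" by linarith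
      qed (use y0 in auto)
    qed (use \<open>0 < e\<close> y0 in auto)
    also have "\<dots> = e * \<bar>y - y0\<bar>" using y0 by simp
    also have "\<dots> \<le> e * dist (y, d) (y0, d0)"
      using \<open>0 < e\<close> dist_fst_le[of "(y, d)" "(y0, d0)"] by (auto simp: dist_real_def)
    finally show ?thesis .
  qed
  show "\<exists>\<delta>>0. \<forall>p\<in>B. norm (p - (y0, d0)) < \<delta> \<longrightarrow>
      norm (N p - N (y0, snd p * y0 / fst p) - ln (fst p / y0) / r * (b * N (y0, d0) - lam * g (y0, d0)) -
        (N (y0, d0) - N (y0, snd (y0, d0) * y0 / fst (y0, d0)) - ln (fst (y0, d0) / y0) / r * (b * N (y0, d0) - lam * g (y0, d0)))
        - 0) \<le> e * norm (p - (y0, d0))"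
    using main y0 \<delta>(1) by (intro exI[of _ \<delta>]) (auto simp: dist_norm L_def)
qed

section \<open>The one-dimensional problem of the second line\<close>

text \<open>Left of the line d = a2 - a1 (the diagonal of the original coordinates) only the second line can
  be ruined first; phi is its one-dimensional transform and P the derivative of phi.\<close>
definition phi :: "real \<Rightarrow> real \<Rightarrow> real" where
  "phi s w = V s (w + (a1 - a2)) (a2 - a1)"

definition g2 :: "real \<Rightarrow> real \<Rightarrow> real" where
  "g2 s w = avg (\<lambda>z. phi s (w - z))"

definition P :: "real \<Rightarrow> real \<Rightarrow> real" where
  "P s w = ((lam + s) * phi s w - lam * g2 s w) / (r * w)"

context
  fixes s :: real assumes s: "0 < s"
begin

lemma V_phi: "d \<le> a2 - a1 \<Longrightarrow> V s y d = phi s (y + d)"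
  unfolding phi_def by (rule V_left[OF s]) auto

lemma G_g2: "d \<le> a2 - a1 \<Longrightarrow> G s y d = g2 s (y + d)"
  unfolding G_def g2_def by (simp add: V_phi algebra_simps)

lemma phi_ruin: "w < a2 \<Longrightarrow> phi s w = 1"
  unfolding phi_def by (rule V_ruin[OF s]) auto

lemma phi_abs: "\<bar>phi s w\<bar> \<le> 1" unfolding phi_def by (rule V_abs[OF s])

lemma phi_measurable [measurable (raw)]:
  "h \<in> borel_measurable N \<Longrightarrow> (\<lambda>x. phi s (h x)) \<in> borel_measurable N"
  unfolding phi_def by (rule V_measurable[OF s]) auto

lemma g2_eq: "g2 s w = G s (w + (a1 - a2)) (a2 - a1)"
  by (simp add: G_g2)

lemma g2_abs: "\<bar>g2 s w\<bar> \<le> 1" unfolding g2_eq by (rule G_abs[OF s])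

lemma g2_measurable [measurable (raw)]:
  "h \<in> borel_measurable N \<Longrightarrow> (\<lambda>x. g2 s (h x)) \<in> borel_measurable N"
  unfolding g2_eq by (rule G_measurable[OF s]) auto

lemma scaled_left: "0 \<le> t \<Longrightarrow> exp (r * t) * (a2 - a1) \<le> a2 - a1"
  using r a12 mult_right_mono_neg[of 1 "exp (r * t)" "a2 - a1"] by simp

lemma phi_flow:
  assumes w: "a2 \<le> w" and h: "0 \<le> h"
  shows "phi s w = tint lam (lam + s) {0..h} (\<lambda>t. g2 s (exp (r * t) * w))
    + exp (- (lam + s) * h) * phi s (exp (r * h) * w)"
proof -
  have "phi s w = tint lam (lam + s) {0..h} (\<lambda>t. G s (exp (r * t) * (w + (a1 - a2))) (exp (r * t) * (a2 - a1)))
    + exp (- (lam + s) * h) * V s (exp (r * h) * (w + (a1 - a2))) (exp (r * h) * (a2 - a1))"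
    unfolding phi_def by (rule V_flow[OF s]) (use w h in auto)
  moreover have "tint lam (lam + s) {0..h} (\<lambda>t. G s (exp (r * t) * (w + (a1 - a2))) (exp (r * t) * (a2 - a1)))
     = tint lam (lam + s) {0..h} (\<lambda>t. g2 s (exp (r * t) * w))"
  proof (rule tint_cong[OF lam b_pos[OF s]])
    fix t assume "t \<in> {0..h}"
    then show "G s (exp (r * t) * (w + (a1 - a2))) (exp (r * t) * (a2 - a1)) = g2 s (exp (r * t) * w)"
      by (subst G_g2[OF scaled_left]) (auto simp: algebra_simps)
  qed
  moreover have "V s (exp (r * h) * (w + (a1 - a2))) (exp (r * h) * (a2 - a1)) = phi s (exp (r * h) * w)"
    by (subst V_phi[OF scaled_left[OF h]]) (simp add: algebra_simps)
  ultimately show ?thesis by simp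
qed

text \<open>The flow carries (w + (a1 - a2), a2 - a1) off the diagonal, but to its left V depends on
  the sum of the coordinates alone, so the flow estimate for \<open>R\<close> becomes one for
  phi.\<close>

lemma phi_lipschitz:
  assumes "a2 \<le> w" "a2 \<le> w'"
  shows "\<bar>phi s w - phi s w'\<bar> \<le> (lam + s) / (r * a2) * \<bar>w - w'\<bar>"
proof -
  have *: "\<bar>phi s w - phi s w'\<bar> \<le> (lam + s) / (r * a2) * \<bar>w - w'\<bar>" if "a2 \<le> w" "w \<le> w'" for w w'
  proof -
    define h where "h = ln (w' / w) / r"
    have h: "0 \<le> h" "exp (r * h) = w' / w" using that r a2 by (auto simp: h_def)
    have "phi s w = R s (w + (a1 - a2)) (a2 - a1)"
      unfolding phi_def by (rule V_eq_R[OF s]) (use that in auto)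
    moreover have "phi s w' = R s (exp (r * h) * (w + (a1 - a2))) (exp (r * h) * (a2 - a1))"
    proof -
      have "phi s w' = V s (exp (r * h) * (w + (a1 - a2))) (exp (r * h) * (a2 - a1))"
        using h that a2 by (subst V_phi[OF scaled_left[OF h(1)]]) (simp add: field_simps)
      also have "\<dots> = R s (exp (r * h) * (w + (a1 - a2))) (exp (r * h) * (a2 - a1))"
        by (rule V_eq_R[OF s flow_S[OF s, of "w + (a1 - a2)" "a2 - a1" h]]) (use that h in auto)
      finally show ?thesis .
    qed
    ultimately have "\<bar>phi s w - phi s w'\<bar> \<le> (lam + s) * h" using R_lipschitz_flow[OF s h(1)] by simp
    also have "\<dots> \<le> (lam + s) / r * (\<bar>w' - w\<bar> / a2)"
    proof -
      have "ln (w' / w) \<le> \<bar>w' - w\<bar> / a2" using ln_ratio_le[of a2 w w'] that a2 by linarith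
      then have "(lam + s) / r * ln (w' / w) \<le> (lam + s) / r * (\<bar>w' - w\<bar> / a2)"
        using b_pos[OF s] r by (intro mult_left_mono) auto
      then show ?thesis by (simp add: h_def)
    qed
    finally show ?thesis by (simp add: abs_minus_commute)
  qed
  show ?thesis
    using *[of w w'] *[of w' w] assms by (cases "w \<le> w'") (auto simp: abs_minus_commute)
qed

lemma phi_continuous: "continuous_on {a2..} (phi s)"
proof (rule continuous_onI)
  fix w e :: real assume w: "w \<in> {a2..}" and "0 < e"
  define K where "K = (lam + s) / (r * a2)"
  have K: "0 < K" using b_pos[OF s] r a2 by (simp add: K_def)
  show "\<exists>d>0. \<forall>w'\<in>{a2..}. dist w' w < d \<longrightarrow> dist (phi s w') (phi s w) \<le> e"
  proof (intro exI[of _ "e / K"] conjI ballI impI)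
    fix w' assume "w' \<in> {a2..}" "dist w' w < e / K"
    then have "K * \<bar>w' - w\<bar> \<le> e" using K by (simp add: dist_real_def field_simps)
    then show "dist (phi s w') (phi s w) \<le> e"
      using phi_lipschitz[of w' w] w \<open>w' \<in> {a2..}\<close> by (simp add: dist_real_def K_def)
  qed (use K \<open>0 < e\<close> in auto)
qed

text \<open>phi may jump at a2, but for fixed w only the claim size w - a2 meets the jump, and one
  point is Lebesgue-null.\<close>

lemma g2_continuous: "continuous_on {a2..} (g2 s)"
  unfolding continuous_on_sequentially comp_def
proof (intro allI ballI impI, elim conjE)
  fix x :: "nat \<Rightarrow> real" and w
  assume w: "w \<in> {a2..}" and x: "\<forall>n. x n \<in> {a2..}" "x \<longlonglongrightarrow> w"
  show "(\<lambda>n. g2 s (x n)) \<longlonglongrightarrow> g2 s w"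
    unfolding g2_def
  proof (rule avg_tendsto[where B = 1])
    have "AE z in lborel. z \<noteq> w - a2" by (rule AE_lborel_singleton)
    then show "AE z in lborel. 0 \<le> z \<longrightarrow> (\<lambda>n. phi s (x n - z)) \<longlonglongrightarrow> phi s (w - z)"
    proof eventually_elim
      case (elim z)
      have lim: "(\<lambda>n. x n - z) \<longlonglongrightarrow> w - z" using x by (intro tendsto_intros)
      show ?case
      proof (cases "w - z < a2")
        case True
        then have "\<forall>\<^sub>F n in sequentially. x n - z < a2" using lim by (rule order_tendstoD(2)[rotated])
        then have "\<forall>\<^sub>F n in sequentially. phi s (x n - z) = phi s (w - z)"
          by eventually_elim (use True in \<open>simp add: phi_ruin\<close>)
        then show ?thesis by (auto intro: tendsto_eventually)
      next
        case False
        then have "a2 < w - z" using elim by simp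
        then have "\<forall>\<^sub>F n in sequentially. a2 < x n - z" using lim by (rule order_tendstoD(1)[rotated])
        then have "\<forall>\<^sub>F n in sequentially. x n - z \<in> {a2..}" by eventually_elim simp
        then show ?thesis
          using continuous_on_tendsto_compose[OF phi_continuous lim] \<open>a2 < w - z\<close> by auto
      qed
    qed
  qed (use phi_abs in auto)
qed

text \<open>The one-dimensional flow is embedded in the plane with an inert second coordinate, so
  that \<open>flow_first_order\<close> applies. The slid value is then the constant phi w, and on
  the line of points (x, 0) only the logarithmic term remains; its derivative at w is
  \<open>P s w\<close>.\<close>

lemma phi_deriv:
  assumes w: "a2 \<le> w"
  shows "(phi s has_real_derivative P s w) (at w within {a2..})"
proof -
  have "((\<lambda>p. (phi s \<circ> fst) p - (phi s \<circ> fst) (w, snd p * w / fst p)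
      - ln (fst p / w) / r * ((lam + s) * (phi s \<circ> fst) (w, 0::real) - lam * (g2 s \<circ> fst) (w, 0::real)))
    has_derivative (\<lambda>_. 0)) (at (w, 0) within {a2..} \<times> UNIV)"
  proof (rule flow_first_order[where A = "{a2..} \<times> UNIV" and N = "phi s \<circ> fst" and g = "g2 s \<circ> fst"
        and b = "lam + s" and ?y0.0 = w and ?d0.0 = 0])
    show "(exp (r * h) * y, exp (r * h) * d) \<in> {a2..} \<times> UNIV"
      if "(y, d) \<in> {a2..} \<times> UNIV" "0 \<le> h" for y d h
      using flow_S(2)[OF s, of "y + (a1 - a2)" "a2 - a1" h] that by (simp add: algebra_simps)
    have c: "continuous (at w within fst ` ({a2..} \<times> (UNIV::real set))) k" if "continuous_on {a2..} k" for k :: "real \<Rightarrow> real"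
      using that w by (simp add: continuous_on_eq_continuous_within)
    show "continuous (at (w, 0) within {a2..} \<times> UNIV) (phi s \<circ> fst)"
      by (rule continuous_within_compose) (use c[OF phi_continuous] in \<open>auto intro: continuous_intros\<close>)
    show "continuous (at (w, 0) within {a2..} \<times> UNIV) (g2 s \<circ> fst)"
      by (rule continuous_within_compose) (use c[OF g2_continuous] in \<open>auto intro: continuous_intros\<close>)
    show "(phi s \<circ> fst) (y, d) = tint lam (lam + s) {0..h} (\<lambda>t. (g2 s \<circ> fst) (exp (r * t) * y, exp (r * t) * d)) +
       exp (- (lam + s) * h) * (phi s \<circ> fst) (exp (r * h) * y, exp (r * h) * d)"
      if "(y, d) \<in> {a2..} \<times> UNIV" "0 \<le> h" for y d h
      using phi_flow[of y h] that by simp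
  qed (use b_pos[OF s] w a2 phi_abs g2_abs in auto)
  then have E: "((\<lambda>p. phi s (fst p) - phi s w - ln (fst p / w) / r * ((lam + s) * phi s w - lam * g2 s w))
    has_derivative (\<lambda>_. 0)) (at (w, 0::real) within (\<lambda>x. (x, 0::real)) ` {a2..})"
    unfolding comp_def fst_conv by (rule has_derivative_subset) auto
  have emb: "((\<lambda>x. (x, 0::real)) has_derivative (\<lambda>x. (x, 0))) (at w within {a2..})"
    by (intro has_derivative_Pair has_derivative_ident has_derivative_const)
  have "((\<lambda>x. phi s x - phi s w - ln (x / w) / r * ((lam + s) * phi s w - lam * g2 s w))
    has_derivative (\<lambda>_. 0)) (at w within {a2..})"
    using has_derivative_in_compose[OF emb E] by simp
  then have "((\<lambda>x. phi s x - phi s w - ln (x / w) / r * ((lam + s) * phi s w - lam * g2 s w))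
    has_real_derivative 0) (at w within {a2..})"
    by (simp add: has_field_derivative_def lambda_zero)
  moreover have "((\<lambda>x. phi s w + ln (x / w) / r * ((lam + s) * phi s w - lam * g2 s w))
    has_real_derivative P s w) (at w within {a2..})"
    using w a2 r by (auto intro!: derivative_eq_intros simp: P_def)
  ultimately have "((\<lambda>x. (phi s x - phi s w - ln (x / w) / r * ((lam + s) * phi s w - lam * g2 s w)) +
     (phi s w + ln (x / w) / r * ((lam + s) * phi s w - lam * g2 s w)))
    has_real_derivative 0 + P s w) (at w within {a2..})"
    by (rule DERIV_add)
  then show ?thesis by simp
qed

lemma P_continuous: "continuous_on {a2..} (P s)"
  unfolding P_def using a2 r phi_continuous g2_continuous by (intro continuous_intros) auto

lemma P_abs:
  assumes "a2 \<le> w" shows "\<bar>P s w\<bar> \<le> (2 * lam + s) / (r * a2)"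
proof -
  have "\<bar>(lam + s) * phi s w - lam * g2 s w\<bar> \<le> (lam + s) * 1 + lam * 1"
    using phi_abs[of w] g2_abs[of w] lam s
    by (intro order.trans[OF abs_triangle_ineq4] add_mono) (auto simp: abs_mult)
  then show ?thesis unfolding P_def abs_divide
    using assms r a2 lam s by (intro frac_le) (auto simp: abs_mult)
qed

end

end

section \<open>Differentiability across the flow\<close>

lemma common_radius:
  fixes a b c :: real
  assumes "0 < a" "0 < b" "0 < c"
  shows "\<exists>\<rho>>0. \<rho> \<le> a \<and> \<rho> \<le> b \<and> \<rho> \<le> c"
  using assms by (intro exI[of _ "min a (min b c)"]) auto

text \<open>Only forward quotients are controlled, but uniformly in the base point. A backward
  quotient at T0 is a forward quotient based at T < T0, close to q T by uniformity, and q T is close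
  to q T0 because the limit q is continuous at T0.\<close>

lemma uniform_quotients_differentiable:
  fixes F :: "real \<Rightarrow> real"
  assumes F1: "\<And>T. \<bar>F T\<bar> \<le> 1"
    and cau: "\<And>\<eta>. 0 < \<eta> \<Longrightarrow> \<exists>\<delta>>0. \<forall>h h' T. 0 < h \<longrightarrow> h < \<delta> \<longrightarrow> 0 < h' \<longrightarrow> h' < \<delta> \<longrightarrow> 0 \<le> T \<longrightarrow> T \<le> T1
      \<longrightarrow> \<bar>(F (T + h) - F T) / h - (F (T + h') - F T) / h'\<bar> \<le> \<eta>"
    and T0: "0 \<le> T0" "T0 < T1"
  shows "\<exists>D. (F has_real_derivative D) (at T0 within {0..T1})"
proof -
  define Q where "Q h T = (F (T + h) - F T) / h" for h T
  define q where "q T = lim (\<lambda>n. Q (1 / real (Suc n)) T)" for T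
  have small: "\<forall>\<^sub>F n in sequentially. 1 / real (Suc n) < \<delta>" if "0 < \<delta>" for \<delta>
    using LIMSEQ_inverse_real_of_nat that by (auto dest!: order_tendstoD(2) simp: inverse_eq_divide)
  have conv: "(\<lambda>n. Q (1 / real (Suc n)) T) \<longlonglongrightarrow> q T" if T: "0 \<le> T" "T \<le> T1" for T
  proof -
    have "Cauchy (\<lambda>n. Q (1 / real (Suc n)) T)"
    proof (rule metric_CauchyI)
      fix e :: real assume "0 < e"
      then obtain \<delta> where \<delta>: "\<delta> > 0" "\<And>h h'. 0 < h \<Longrightarrow> h < \<delta> \<Longrightarrow> 0 < h' \<Longrightarrow> h' < \<delta> \<Longrightarrow> \<bar>Q h T - Q h' T\<bar> \<le> e / 2"
        using cau[of "e / 2"] T unfolding Q_def by auto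
      obtain N where N: "\<And>n. n \<ge> N \<Longrightarrow> 1 / real (Suc n) < \<delta>"
        using small[OF \<delta>(1)] unfolding eventually_sequentially by blast
      show "\<exists>M. \<forall>m\<ge>M. \<forall>n\<ge>M. dist (Q (1 / real (Suc m)) T) (Q (1 / real (Suc n)) T) < e"
      proof (intro exI[of _ N] allI impI)
        fix m n assume "N \<le> m" "N \<le> n"
        then have "\<bar>Q (1 / real (Suc m)) T - Q (1 / real (Suc n)) T\<bar> \<le> e / 2"
          by (intro \<delta>(2) N) auto
        then show "dist (Q (1 / real (Suc m)) T) (Q (1 / real (Suc n)) T) < e"
          using \<open>0 < e\<close> by (simp add: dist_real_def)
      qed
    qed
    then show ?thesis unfolding q_def by (simp add: Cauchy_convergent_iff convergent_LIMSEQ_iff)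
  qed
  have unif: "\<exists>\<delta>>0. \<forall>h T. 0 < h \<longrightarrow> h < \<delta> \<longrightarrow> 0 \<le> T \<longrightarrow> T \<le> T1 \<longrightarrow> \<bar>Q h T - q T\<bar> \<le> \<eta>" if \<eta>: "0 < \<eta>" for \<eta>
  proof -
    obtain \<delta> where \<delta>: "\<delta> > 0" "\<And>h h' T. 0 < h \<Longrightarrow> h < \<delta> \<Longrightarrow> 0 < h' \<Longrightarrow> h' < \<delta> \<Longrightarrow> 0 \<le> T \<Longrightarrow> T \<le> T1 \<Longrightarrow> \<bar>Q h T - Q h' T\<bar> \<le> \<eta>"
      using cau[OF \<eta>] unfolding Q_def by blast
    have "\<bar>Q h T - q T\<bar> \<le> \<eta>" if h: "0 < h" "h < \<delta>" and T: "0 \<le> T" "T \<le> T1" for h T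
    proof (rule tendsto_upperbound)
      show "(\<lambda>n. \<bar>Q h T - Q (1 / real (Suc n)) T\<bar>) \<longlonglongrightarrow> \<bar>Q h T - q T\<bar>"
        using conv[OF T] by (intro tendsto_intros)
      show "\<forall>\<^sub>F n in sequentially. \<bar>Q h T - Q (1 / real (Suc n)) T\<bar> \<le> \<eta>"
        using small[OF \<delta>(1)] by eventually_elim (use h T in \<open>auto intro!: \<delta>(2)\<close>)
    qed simp
    then show ?thesis using \<delta>(1) by blast
  qed
  obtain \<delta>1 where \<delta>1: "\<delta>1 > 0" "\<And>h T. 0 < h \<Longrightarrow> h < \<delta>1 \<Longrightarrow> 0 \<le> T \<Longrightarrow> T \<le> T1 \<Longrightarrow> \<bar>Q h T - q T\<bar> \<le> 1"
    using unif[of 1] by auto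
  \<comment> \<open>The quotient with step \<delta>1 / 2 is at most 2 / (\<delta>1 / 2) because F is
    bounded by 1; any other small step changes it by at most 2, both quotients being within 1 of
    q.\<close>
  define K where "K = 2 / (\<delta>1 / 2) + 2"
  have K: "0 < K" using \<delta>1 by (simp add: K_def add_pos_pos)
  have lip0: "\<bar>F (T + h) - F T\<bar> \<le> K * h" if h: "0 < h" "h < \<delta>1" and T: "0 \<le> T" "T \<le> T1" for h T
  proof -
    have "\<bar>Q (\<delta>1 / 2) T\<bar> \<le> 2 / (\<delta>1 / 2)"
      using F1[of "T + \<delta>1 / 2"] F1[of T] \<delta>1 unfolding Q_def abs_divide
      by (intro frac_le) auto
    moreover have "\<bar>Q h T - q T\<bar> \<le> 1" "\<bar>Q (\<delta>1 / 2) T - q T\<bar> \<le> 1" using h T \<delta>1 by auto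
    ultimately have "\<bar>Q h T\<bar> \<le> K" unfolding K_def by linarith
    then show ?thesis using h unfolding Q_def by (simp add: abs_divide pos_divide_le_eq)
  qed
  have lip: "\<bar>F x - F y\<bar> \<le> K * \<bar>x - y\<bar>" if "0 \<le> x" "x \<le> T1" "0 \<le> y" "y \<le> T1" "\<bar>x - y\<bar> < \<delta>1" for x y
    using lip0[of "y - x" x] lip0[of "x - y" y] that
    by (cases x y rule: linorder_cases) (auto simp: abs_minus_commute)
  have q_cont: "\<exists>\<delta>>0. \<forall>T. 0 \<le> T \<longrightarrow> \<bar>T - T0\<bar> < \<delta> \<longrightarrow> \<bar>q T - q T0\<bar> \<le> 3 * \<eta>" if \<eta>: "0 < \<eta>" for \<eta>
  proof -
    obtain \<delta> where \<delta>: "\<delta> > 0" "\<And>h T. 0 < h \<Longrightarrow> h < \<delta> \<Longrightarrow> 0 \<le> T \<Longrightarrow> T \<le> T1 \<Longrightarrow> \<bar>Q h T - q T\<bar> \<le> \<eta>"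
      using unif[OF \<eta>] by auto
    define h where "h = min (\<delta> / 2) ((T1 - T0) / 2)"
    have "h \<le> \<delta> / 2" and h3: "h \<le> (T1 - T0) / 2" unfolding h_def
      by (rule min.cobounded1, rule min.cobounded2)
    then have h: "0 < h" "h < \<delta>" using \<delta>(1) T0 by (auto simp: h_def)
    obtain \<rho> where \<rho>: "0 < \<rho>" "\<rho> \<le> \<delta>1" "\<rho> \<le> (T1 - T0) / 2" "\<rho> \<le> \<eta> * h / (2 * K)"
      using common_radius[of \<delta>1 "(T1 - T0) / 2" "\<eta> * h / (2 * K)"] \<delta>1(1) T0 h K \<eta> by auto
    have "\<bar>q T - q T0\<bar> \<le> 3 * \<eta>" if T: "0 \<le> T" "\<bar>T - T0\<bar> < \<rho>" for T
    proof -
      have TT: "T \<le> T1" "T + h \<le> T1" "T0 + h \<le> T1" using T(2) h(1) h3 \<rho>(3) T0 unfolding abs_less_iff by auto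
      have Kr: "K * \<bar>T - T0\<bar> \<le> \<eta> * h / 2"
      proof -
        have "K * \<bar>T - T0\<bar> \<le> K * (\<eta> * h / (2 * K))" using T \<rho> K by (intro mult_left_mono) auto
        then show ?thesis using K by simp
      qed
      have "\<bar>F (T + h) - F (T0 + h)\<bar> \<le> K * \<bar>T - T0\<bar>" "\<bar>F T - F T0\<bar> \<le> K * \<bar>T - T0\<bar>"
        using lip[of "T + h" "T0 + h"] lip[of T T0] T TT h \<rho> T0 by auto
      then have "\<bar>(F (T + h) - F T) - (F (T0 + h) - F T0)\<bar> \<le> \<eta> * h" using Kr by linarith
      moreover have "Q h T - Q h T0 = ((F (T + h) - F T) - (F (T0 + h) - F T0)) / h"
        unfolding Q_def by (simp add: diff_divide_distrib)
      ultimately have "\<bar>Q h T - Q h T0\<bar> \<le> \<eta>" using h by (simp add: abs_divide pos_divide_le_eq)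
      then show ?thesis using \<delta>(2)[OF h(1,2) T(1) TT(1)] \<delta>(2)[OF h(1,2) T0(1)] T0 by linarith
    qed
    then show ?thesis using \<rho>(1) by blast
  qed
  have "((\<lambda>T. (F T - F T0) / (T - T0)) \<longlongrightarrow> q T0) (at T0 within {0..T1})"
    unfolding Lim_within
  proof (intro allI impI)
    fix e :: real assume "0 < e"
    \<comment> \<open>One fifth for the quotient against q, three for the continuity of q; the
      remaining one makes the final inequality strict.\<close>
    then have e: "0 < e / 5" by simp
    obtain \<delta> where \<delta>: "\<delta> > 0" "\<And>h T. 0 < h \<Longrightarrow> h < \<delta> \<Longrightarrow> 0 \<le> T \<Longrightarrow> T \<le> T1 \<Longrightarrow> \<bar>Q h T - q T\<bar> \<le> e / 5"
      using unif[OF e] by auto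
    obtain \<rho> where \<rho>: "\<rho> > 0" "\<And>T. 0 \<le> T \<Longrightarrow> \<bar>T - T0\<bar> < \<rho> \<Longrightarrow> \<bar>q T - q T0\<bar> \<le> 3 * (e / 5)"
      using q_cont[OF e] by auto
    show "\<exists>d>0. \<forall>T\<in>{0..T1}. 0 < dist T T0 \<and> dist T T0 < d \<longrightarrow> dist ((F T - F T0) / (T - T0)) (q T0) < e"
    proof (intro exI[of _ "min \<delta> \<rho>"] conjI ballI impI)
      fix T assume T: "T \<in> {0..T1}" "0 < dist T T0 \<and> dist T T0 < min \<delta> \<rho>"
      show "dist ((F T - F T0) / (T - T0)) (q T0) < e"
      proof (cases "T0 < T")
        case True
        then have "\<bar>Q (T - T0) T0 - q T0\<bar> \<le> e / 5" using T T0 by (intro \<delta>(2)) (auto simp: dist_real_def)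
        then show ?thesis using \<open>0 < e\<close> unfolding Q_def dist_real_def by simp
      next
        case False
        then have "T < T0" using T by auto
        have "\<bar>Q (T0 - T) T - q T\<bar> \<le> e / 5"
          by (rule \<delta>(2)) (use T \<open>T < T0\<close> in \<open>auto simp: dist_real_def\<close>)
        moreover have "\<bar>q T - q T0\<bar> \<le> 3 * (e / 5)"
          by (rule \<rho>(2)) (use T in \<open>auto simp: dist_real_def\<close>)
        moreover have "(F T - F T0) / (T - T0) = Q (T0 - T) T"
          unfolding Q_def using \<open>T < T0\<close> by (simp add: field_simps)
        ultimately show ?thesis using \<open>0 < e\<close> unfolding dist_real_def by linarith
      qed
    qed (use \<delta> \<rho> in auto)
  qed
  then show ?thesis unfolding has_field_derivative_iff by blast
qed

section \<open>The equation in the time-to-diagonal coordinate and its maximum principle\<close>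

context renewal begin

text \<open>T is the time left until the diagonal: the flow runs until the first claim or until T is
  used up, and the values Z y 0 are the data. The equation is linear and homogeneous, so difference
  quotients of solutions solve it again. Z is left open below a1; in differences of V the common
  ruin value 1 cancels there.\<close>

definition solves :: "real \<Rightarrow> (real \<Rightarrow> real \<Rightarrow> real) \<Rightarrow> bool" where
  "solves b Z \<longleftrightarrow> (\<lambda>p. Z (fst p) (snd p)) \<in> borel_measurable (borel \<Otimes>\<^sub>M borel) \<and> (\<exists>B. \<forall>y T. \<bar>Z y T\<bar> \<le> B) \<and>
     (\<forall>y T. a1 \<le> y \<longrightarrow> 0 \<le> T \<longrightarrow>
       Z y T = tint lam b {0..T} (\<lambda>t. avg (\<lambda>z. Z (exp (r * t) * y - z) (T - t))) + exp (- b * T) * Z (exp (r * T) * y) 0)"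

lemma solves_meas:
  "solves b Z \<Longrightarrow> g \<in> borel_measurable N \<Longrightarrow> h \<in> borel_measurable N
    \<Longrightarrow> (\<lambda>x. Z (g x) (h x)) \<in> borel_measurable N"
  unfolding solves_def by (rule borel_measurable_binary) blast+

lemma solves_avg_meas:
  assumes "solves b Z"
  shows "(\<lambda>t. avg (\<lambda>z. Z (exp (r * t) * y - z) (T - t))) \<in> borel_measurable borel"
proof -
  note [measurable (raw)] = solves_meas[OF assms]
  show ?thesis unfolding avg_def by measurable
qed

lemma solves_diff:
  assumes b: "0 < b" and Z: "solves b Z" and W: "solves b W"
  shows "solves b (\<lambda>y T. Z y T - W y T)"
proof -
  note [measurable (raw)] = solves_meas[OF Z] solves_meas[OF W]
  obtain B B' where B: "\<And>y T. \<bar>Z y T\<bar> \<le> B" "\<And>y T. \<bar>W y T\<bar> \<le> B'"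
    using Z W unfolding solves_def by blast
  show ?thesis
    unfolding solves_def
  proof (intro conjI allI impI)
    show "(\<lambda>p. Z (fst p) (snd p) - W (fst p) (snd p)) \<in> borel_measurable (borel \<Otimes>\<^sub>M borel)" by measurable
    have "\<bar>Z y T - W y T\<bar> \<le> B + B'" for y T using B(1)[of y T] B(2)[of y T] by linarith
    then show "\<exists>B. \<forall>y T. \<bar>Z y T - W y T\<bar> \<le> B" by blast
    fix y T :: real assume y: "a1 \<le> y" and T: "0 \<le> T"
    have "tint lam b {0..T} (\<lambda>t. avg (\<lambda>z. Z (exp (r * t) * y - z) (T - t)))
        - tint lam b {0..T} (\<lambda>t. avg (\<lambda>z. W (exp (r * t) * y - z) (T - t)))
      = tint lam b {0..T} (\<lambda>t. avg (\<lambda>z. Z (exp (r * t) * y - z) (T - t)) - avg (\<lambda>z. W (exp (r * t) * y - z) (T - t)))"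
      by (rule tint_diff[OF lam b _ _ solves_avg_meas[OF Z] _ solves_avg_meas[OF W]])
        (use B in \<open>auto intro!: avg_abs_le\<close>)
    also have "\<dots> = tint lam b {0..T} (\<lambda>t. avg (\<lambda>z. Z (exp (r * t) * y - z) (T - t) - W (exp (r * t) * y - z) (T - t)))"
      by (rule tint_cong[OF lam b], rule avg_diff) (use B in auto)
    finally have e: "tint lam b {0..T} (\<lambda>t. avg (\<lambda>z. Z (exp (r * t) * y - z) (T - t) - W (exp (r * t) * y - z) (T - t)))
      = tint lam b {0..T} (\<lambda>t. avg (\<lambda>z. Z (exp (r * t) * y - z) (T - t)))
        - tint lam b {0..T} (\<lambda>t. avg (\<lambda>z. W (exp (r * t) * y - z) (T - t)))" by simp
    have eZ: "Z y T = tint lam b {0..T} (\<lambda>t. avg (\<lambda>z. Z (exp (r * t) * y - z) (T - t))) + exp (- b * T) * Z (exp (r * T) * y) 0"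
      and eW: "W y T = tint lam b {0..T} (\<lambda>t. avg (\<lambda>z. W (exp (r * t) * y - z) (T - t))) + exp (- b * T) * W (exp (r * T) * y) 0"
      using Z W y T unfolding solves_def by blast+
    show "Z y T - W y T = tint lam b {0..T} (\<lambda>t. avg (\<lambda>z. Z (exp (r * t) * y - z) (T - t) - W (exp (r * t) * y - z) (T - t)))
        + exp (- b * T) * (Z (exp (r * T) * y) 0 - W (exp (r * T) * y) 0)"
      unfolding e by (subst eZ, subst eW) (simp add: algebra_simps)
  qed
qed

lemma solves_cmult:
  assumes Z: "solves b Z"
  shows "solves b (\<lambda>y T. c * Z y T)"
proof -
  note [measurable (raw)] = solves_meas[OF Z]
  obtain B where B: "\<And>y T. \<bar>Z y T\<bar> \<le> B"
    using Z unfolding solves_def by blast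
  show ?thesis
    unfolding solves_def
  proof (intro conjI allI impI)
    show "(\<lambda>p. c * Z (fst p) (snd p)) \<in> borel_measurable (borel \<Otimes>\<^sub>M borel)" by measurable
    have "\<bar>c * Z y T\<bar> \<le> \<bar>c\<bar> * B" for y T using B[of y T] by (simp add: abs_mult mult_left_mono)
    then show "\<exists>B. \<forall>y T. \<bar>c * Z y T\<bar> \<le> B" by blast
    fix y T :: real assume y: "a1 \<le> y" and T: "0 \<le> T"
    have "Z y T = tint lam b {0..T} (\<lambda>t. avg (\<lambda>z. Z (exp (r * t) * y - z) (T - t))) + exp (- b * T) * Z (exp (r * T) * y) 0"
      using Z y T unfolding solves_def by blast
    moreover have "tint lam b {0..T} (\<lambda>t. c * avg (\<lambda>z. Z (exp (r * t) * y - z) (T - t)))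
       = c * tint lam b {0..T} (\<lambda>t. avg (\<lambda>z. Z (exp (r * t) * y - z) (T - t)))"
      unfolding tint_def by (subst Bochner_Integration.integral_mult_right_zero[symmetric]) (simp add: mult_ac)
    ultimately show "c * Z y T = tint lam b {0..T} (\<lambda>t. avg (\<lambda>z. c * Z (exp (r * t) * y - z) (T - t)))
        + exp (- b * T) * (c * Z (exp (r * T) * y) 0)"
      unfolding avg_cmult by (simp add: algebra_simps)
  qed
qed

text \<open>One step turns a bound m on Z into q (1 - E) m + E \<epsilon>, where E is the discounted
  weight of reaching T = 0 without a claim; iteration gives max(q^n B, \<epsilon>). Data up to X
  suffice because y exp(r T), the abscissa at which the flow meets the diagonal, is constant along
  the flow and can only drop at a claim.\<close>

lemma max_principle:
  assumes b: "lam < b" and Z: "solves b Z" and zero: "\<And>y T. y < a1 \<Longrightarrow> Z y T = 0"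
    and bd: "\<And>y. a1 \<le> y \<Longrightarrow> y \<le> X \<Longrightarrow> \<bar>Z y 0\<bar> \<le> \<epsilon>" and \<epsilon>: "0 \<le> \<epsilon>"
    and T: "0 \<le> T" "y * exp (r * T) \<le> X"
  shows "\<bar>Z y T\<bar> \<le> \<epsilon>"
proof -
  note [measurable (raw)] = solves_meas[OF Z]
  obtain B where B: "\<And>y T. \<bar>Z y T\<bar> \<le> B"
    using Z unfolding solves_def by blast
  define q where "q = lam / b"
  have q: "0 \<le> q" "q < 1" "0 < b" using lam b by (auto simp: q_def)
  have "\<bar>Z y T\<bar> \<le> max (q ^ n * B) \<epsilon>" if "0 \<le> T" "y * exp (r * T) \<le> X" for n y T
    using that
  proof (induction n arbitrary: y T)
    case 0
    then show ?case using B[of y T] by simp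
  next
    case (Suc n)
    define m where "m = max (q ^ n * B) \<epsilon>"
    show ?case
    proof (cases "a1 \<le> y")
      case False
      then show ?thesis using zero \<epsilon> by simp
    next
      case True
      define E where "E = exp (- b * T)"
      have E: "0 \<le> E" "E \<le> 1" using q Suc.prems by (auto simp: E_def)
      have m: "0 \<le> m" using \<epsilon> by (simp add: m_def)
      have "\<bar>avg (\<lambda>z. Z (exp (r * t) * y - z) (T - t))\<bar> \<le> m" if t: "0 \<le> t" "t \<le> T" for t
      proof (rule avg_abs_le)
        fix z :: real assume "0 \<le> z"
        have "(exp (r * t) * y - z) * exp (r * (T - t)) \<le> exp (r * t) * y * exp (r * (T - t))"
          using \<open>0 \<le> z\<close> by (intro mult_right_mono) auto
        also have "\<dots> = y * exp (r * T)"
          by (simp add: mult_ac exp_add[symmetric] right_diff_distrib)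
        finally show "\<bar>Z (exp (r * t) * y - z) (T - t)\<bar> \<le> m"
          unfolding m_def using Suc.prems t by (intro Suc.IH) auto
      qed measurable
      then have "\<bar>tint lam b {0..T} (\<lambda>t. avg (\<lambda>z. Z (exp (r * t) * y - z) (T - t)))\<bar> \<le> q * (1 - E) * m"
        unfolding q_def E_def using Suc.prems
        by (intro tint_abs_le_Icc[OF lam q(3)] solves_avg_meas[OF Z]) auto
      moreover have "\<bar>E * Z (exp (r * T) * y) 0\<bar> \<le> E * \<epsilon>"
      proof -
        have "y \<le> exp (r * T) * y" using True a2 a12 Suc.prems r by simp
        then have "\<bar>Z (exp (r * T) * y) 0\<bar> \<le> \<epsilon>" using True Suc.prems by (intro bd) (auto simp: mult.commute)
        then show ?thesis using E by (simp add: abs_mult mult_left_mono)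
      qed
      moreover have "Z y T = tint lam b {0..T} (\<lambda>t. avg (\<lambda>z. Z (exp (r * t) * y - z) (T - t))) + E * Z (exp (r * T) * y) 0"
        using Z True Suc.prems unfolding solves_def E_def by blast
      ultimately have "\<bar>Z y T\<bar> \<le> q * (1 - E) * m + E * \<epsilon>" by linarith
      also have "\<dots> \<le> (1 - E) * max (q * m) \<epsilon> + E * max (q * m) \<epsilon>"
      proof (intro add_mono)
        have "(1 - E) * (q * m) \<le> (1 - E) * max (q * m) \<epsilon>" using E by (intro mult_left_mono) auto
        then show "q * (1 - E) * m \<le> (1 - E) * max (q * m) \<epsilon>" by (simp add: mult_ac)
      qed (use E in \<open>auto intro: mult_left_mono\<close>)
      also have "\<dots> = max (q * m) \<epsilon>" by (simp add: algebra_simps)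
      also have "\<dots> \<le> max (q ^ Suc n * B) \<epsilon>"
      proof -
        have "q * m \<le> max (q ^ Suc n * B) \<epsilon>"
        proof (cases "q ^ n * B \<le> \<epsilon>")
          case True
          then have "q * m \<le> 1 * \<epsilon>" unfolding m_def using q \<epsilon> by (intro mult_mono) auto
          then show ?thesis by simp
        qed (simp add: m_def mult_ac)
        then show ?thesis by simp
      qed
      finally show ?thesis .
    qed
  qed
  then have *: "\<bar>Z y T\<bar> \<le> max (q ^ n * B) \<epsilon>" for n using T by blast
  have "(\<lambda>n. q ^ n * B) \<longlonglongrightarrow> 0" using q by (intro tendsto_mult_left_zero LIMSEQ_power_zero) auto
  then have "(\<lambda>n. max (q ^ n * B) \<epsilon>) \<longlonglongrightarrow> max 0 \<epsilon>" by (intro tendsto_intros)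
  then show ?thesis using * \<epsilon> by (auto intro: LIMSEQ_le_const)
qed

section \<open>Difference quotients at the diagonal\<close>

context
  fixes s :: real assumes s: "0 < s"
begin

text \<open>Time to go before a trajectory reaches the diagonal serves as transversal coordinate:
  it is unaffected by claims.\<close>
lemma solves_V:
  assumes h: "0 \<le> h"
  shows "solves (lam + s) (\<lambda>y T. V s y ((a2 - a1) * exp (- r * (T + h))))"
  unfolding solves_def
proof (intro conjI allI impI)
  note [measurable (raw)] = V_measurable[OF s]
  show "(\<lambda>p. V s (fst p) ((a2 - a1) * exp (- r * (snd p + h)))) \<in> borel_measurable (borel \<Otimes>\<^sub>M borel)"
    by measurable
  show "\<exists>B. \<forall>y T. \<bar>V s y ((a2 - a1) * exp (- r * (T + h)))\<bar> \<le> B" using V_abs[OF s] by blast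
  fix y T :: real assume y: "a1 \<le> y" and T: "0 \<le> T"
  define d where "d = (a2 - a1) * exp (- r * (T + h))"
  have "exp (- r * (T + h)) \<le> 1" using r T h by simp
  then have "a2 - a1 \<le> d" unfolding d_def using a12 mult_left_mono_neg[of "exp (- r * (T + h))" 1 "a2 - a1"] by simp
  then have d: "a2 \<le> y + d" using y by simp
  have e: "exp (r * t) * d = (a2 - a1) * exp (- r * (T - t + h))" for t
    unfolding d_def by (simp add: mult_ac exp_add[symmetric] algebra_simps)
  have "V s y d = tint lam (lam + s) {0..T} (\<lambda>t. G s (exp (r * t) * y) (exp (r * t) * d))
    + exp (- (lam + s) * T) * V s (exp (r * T) * y) (exp (r * T) * d)"
    by (rule V_flow[OF s y d T])
  then show "V s y ((a2 - a1) * exp (- r * (T + h))) =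
      tint lam (lam + s) {0..T} (\<lambda>t. avg (\<lambda>z. V s (exp (r * t) * y - z) ((a2 - a1) * exp (- r * (T - t + h)))))
      + exp (- (lam + s) * T) * V s (exp (r * T) * y) ((a2 - a1) * exp (- r * (0 + h)))"
    unfolding e G_def by (simp add: d_def)
qed

text \<open>Two trajectories with the same first coordinate are followed for time h: one reaches the
  diagonal exactly at time h, the other starts on it. Without a claim both are then in the
  one-dimensional regime, with second-line positions (a1 - a2) (exp(r h) - 1) apart.\<close>

lemma V_edge:
  assumes y: "a1 \<le> y" and h: "0 \<le> h"
  shows "V s y ((a2 - a1) * exp (- r * h)) - V s y (a2 - a1) =
    tint lam (lam + s) {0..h} (\<lambda>t. G s (exp (r * t) * y) ((a2 - a1) * exp (- r * (h - t))) - G s (exp (r * t) * y) (exp (r * t) * (a2 - a1)))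
    + exp (- (lam + s) * h) * (phi s (exp (r * h) * y - (a1 - a2)) - phi s (exp (r * h) * (y - (a1 - a2))))"
proof -
  note [measurable (raw)] = G_measurable[OF s]
  have "solves (lam + s) (\<lambda>y T. V s y ((a2 - a1) * exp (- r * (T + 0))))" by (rule solves_V) simp
  then have "V s y ((a2 - a1) * exp (- r * h)) =
    tint lam (lam + s) {0..h} (\<lambda>t. G s (exp (r * t) * y) ((a2 - a1) * exp (- r * (h - t))))
    + exp (- (lam + s) * h) * V s (exp (r * h) * y) (a2 - a1)"
    using y h unfolding solves_def G_def by simp
  moreover have "V s (exp (r * h) * y) (a2 - a1) = phi s (exp (r * h) * y - (a1 - a2))"
    by (subst V_phi[OF s]) (auto simp: algebra_simps)
  moreover have "V s y (a2 - a1) = tint lam (lam + s) {0..h} (\<lambda>t. G s (exp (r * t) * y) (exp (r * t) * (a2 - a1)))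
    + exp (- (lam + s) * h) * V s (exp (r * h) * y) (exp (r * h) * (a2 - a1))"
    by (rule V_flow[OF s]) (use y h in auto)
  moreover have "V s (exp (r * h) * y) (exp (r * h) * (a2 - a1)) = phi s (exp (r * h) * (y - (a1 - a2)))"
    by (subst V_phi[OF s scaled_left[OF s h]]) (auto simp: algebra_simps)
  moreover have "tint lam (lam + s) {0..h} (\<lambda>t. G s (exp (r * t) * y) ((a2 - a1) * exp (- r * (h - t))))
     - tint lam (lam + s) {0..h} (\<lambda>t. G s (exp (r * t) * y) (exp (r * t) * (a2 - a1)))
     = tint lam (lam + s) {0..h} (\<lambda>t. G s (exp (r * t) * y) ((a2 - a1) * exp (- r * (h - t))) - G s (exp (r * t) * y) (exp (r * t) * (a2 - a1)))"
    by (rule tint_diff[OF lam b_pos[OF s], where B = 1 and B' = 1]) (use G_abs[OF s] in auto)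
  ultimately show ?thesis by (simp add: algebra_simps)
qed

lemma exp_minus_one_le: "0 \<le> h \<Longrightarrow> h \<le> 1 \<Longrightarrow> exp (r * h) - 1 \<le> r * exp r * h"
proof -
  assume h: "0 \<le> h" "h \<le> 1"
  have "1 - r * h \<le> exp (- (r * h))" using exp_ge_add_one_self[of "- (r * h)"] by simp
  then have "exp (r * h) * (1 - r * h) \<le> exp (r * h) * exp (- (r * h))" by (rule mult_left_mono) simp
  also have "\<dots> = 1" by (simp add: exp_minus)
  finally have "exp (r * h) - 1 \<le> exp (r * h) * (r * h)" by (simp add: algebra_simps)
  also have "\<dots> \<le> exp r * (r * h)" using h r by (intro mult_right_mono) (auto simp: mult_left_le)
  finally show ?thesis by (simp add: mult_ac)
qed

lemma phi_edge_diff: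
  assumes y: "a1 \<le> y" and t: "0 \<le> t" "t \<le> h"
  shows "\<bar>phi s (y - (a1 - a2)) - phi s (y + exp (r * t) * (a2 - a1))\<bar>
    \<le> (lam + s) / (r * a2) * ((a1 - a2) * (exp (r * h) - 1)) \<or> y + exp (r * t) * (a2 - a1) < a2"
proof (cases "y + exp (r * t) * (a2 - a1) < a2")
  case False
  have "exp (r * t) \<le> exp (r * h)" "1 \<le> exp (r * t)" using t r by (auto intro: mult_left_mono)
  moreover have "(y - (a1 - a2)) - (y + exp (r * t) * (a2 - a1)) = (a1 - a2) * (exp (r * t) - 1)"
    by (simp add: algebra_simps)
  ultimately have "\<bar>(y - (a1 - a2)) - (y + exp (r * t) * (a2 - a1))\<bar> = (a1 - a2) * (exp (r * t) - 1)"
    using a12 by (simp add: abs_mult)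
  also have "\<dots> \<le> (a1 - a2) * (exp (r * h) - 1)"
    using a12 \<open>exp (r * t) \<le> exp (r * h)\<close> by (intro mult_left_mono) auto
  finally have "(lam + s) / (r * a2) * \<bar>(y - (a1 - a2)) - (y + exp (r * t) * (a2 - a1))\<bar>
     \<le> (lam + s) / (r * a2) * ((a1 - a2) * (exp (r * h) - 1))"
    using b_pos[OF s] r a2 by (intro mult_left_mono) auto
  then show ?thesis
    using phi_lipschitz[OF s, of "y - (a1 - a2)" "y + exp (r * t) * (a2 - a1)"] False y by linarith
qed simp

text \<open>A first crude bound: a claim within time h has weight at most lam h, so the trivial
  bound 2 on its effect suffices, and the rest is the Lipschitz bound for phi. It is used in
  \<open>edge_oscillation\<close> to show that the effect of a claim is in fact small.\<close>

lemma V_edge_lipschitz: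
  "\<exists>C>0. \<forall>h y. 0 \<le> h \<longrightarrow> h \<le> 1 \<longrightarrow> \<bar>V s y ((a2 - a1) * exp (- r * h)) - V s y (a2 - a1)\<bar> \<le> C * h"
proof -
  define K where "K = (lam + s) / (r * a2)"
  have K: "0 < K" using b_pos[OF s] r a2 by (simp add: K_def)
  define C where "C = 2 * lam + K * ((a1 - a2) * (r * exp r))"
  have C: "0 < C" unfolding C_def using lam K a12 r by (intro add_pos_pos mult_pos_pos) auto
  have "\<bar>V s y ((a2 - a1) * exp (- r * h)) - V s y (a2 - a1)\<bar> \<le> C * h" if h: "0 \<le> h" "h \<le> 1" for h y
  proof (cases "a1 \<le> y")
    case False
    then show ?thesis using V_ruin[OF s, of y] C h by simp
  next
    case y: True
    note [measurable (raw)] = G_measurable[OF s]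
    have "\<bar>G s (exp (r * t) * y) ((a2 - a1) * exp (- r * (h - t))) - G s (exp (r * t) * y) (exp (r * t) * (a2 - a1))\<bar> \<le> 2" for t
      using G_abs[OF s, of "exp (r * t) * y" "(a2 - a1) * exp (- r * (h - t))"]
        G_abs[OF s, of "exp (r * t) * y" "exp (r * t) * (a2 - a1)"] by linarith
    then have "\<bar>tint lam (lam + s) {0..h} (\<lambda>t. G s (exp (r * t) * y) ((a2 - a1) * exp (- r * (h - t))) - G s (exp (r * t) * y) (exp (r * t) * (a2 - a1)))\<bar>
       \<le> lam / (lam + s) * (1 - exp (- (lam + s) * h)) * 2"
      by (intro tint_abs_le_Icc[OF lam b_pos[OF s]]) (use h in auto)
    also have "\<dots> \<le> lam / (lam + s) * ((lam + s) * h) * 2"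
      using one_minus_exp[OF s h(1)] lam s by (intro mult_right_mono mult_left_mono) auto
    also have "\<dots> = 2 * lam * h" using b_pos[OF s] by simp
    finally have 1: "\<bar>tint lam (lam + s) {0..h} (\<lambda>t. G s (exp (r * t) * y) ((a2 - a1) * exp (- r * (h - t))) - G s (exp (r * t) * y) (exp (r * t) * (a2 - a1)))\<bar> \<le> 2 * lam * h" .
    have ey: "a1 \<le> exp (r * h) * y" "a2 \<le> exp (r * h) * y + exp (r * h) * (a2 - a1)"
      using flow_S[OF s y, of "a2 - a1" h] y h by auto
    have "\<bar>phi s (exp (r * h) * y - (a1 - a2)) - phi s (exp (r * h) * y + exp (r * h) * (a2 - a1))\<bar> \<le> K * ((a1 - a2) * (exp (r * h) - 1))"
      using phi_edge_diff[OF ey(1) h(1) order_refl] ey(2) unfolding K_def by linarith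
    also have "\<dots> \<le> K * ((a1 - a2) * (r * exp r * h))"
      using exp_minus_one_le[OF h] K a12 by (intro mult_left_mono) auto
    finally have 2: "\<bar>phi s (exp (r * h) * y - (a1 - a2)) - phi s (exp (r * h) * (y - (a1 - a2)))\<bar> \<le> K * ((a1 - a2) * (r * exp r)) * h"
      by (simp add: algebra_simps)
    have "\<bar>exp (- (lam + s) * h) * (phi s (exp (r * h) * y - (a1 - a2)) - phi s (exp (r * h) * (y - (a1 - a2))))\<bar>
       \<le> 1 * (K * ((a1 - a2) * (r * exp r)) * h)"
      unfolding abs_mult using 2 one_minus_exp[OF s h(1)] by (intro mult_mono) auto
    then show ?thesis unfolding V_edge[OF y h(1)] C_def using 1 by (simp add: distrib_right)
  qed
  then show ?thesis using C by blast
qed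

text \<open>Outside a short interval of claim sizes the two values of V are both 1 or differ by
  O(h), by \<open>V_edge_lipschitz\<close> and the Lipschitz bound for phi. The interval has length
  O(h), and \<open>avg_interval_small\<close> bounds its mass independently of y.\<close>

lemma edge_oscillation:
  assumes \<eta>: "0 < \<eta>"
  shows "\<exists>\<delta>>0. \<forall>h t y. 0 < h \<longrightarrow> h < \<delta> \<longrightarrow> 0 \<le> t \<longrightarrow> t \<le> h \<longrightarrow>
    \<bar>G s y ((a2 - a1) * exp (- r * (h - t))) - G s y (exp (r * t) * (a2 - a1))\<bar> \<le> \<eta>"
proof -
  define K where "K = (lam + s) / (r * a2)"
  have K: "0 < K" using b_pos[OF s] r a2 by (simp add: K_def)
  define k where "k = (a1 - a2) * (r * exp r)"
  have k: "0 < k" using a12 r by (simp add: k_def)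
  obtain C where C: "0 < C" "\<And>h y. 0 \<le> h \<Longrightarrow> h \<le> 1 \<Longrightarrow> \<bar>V s y ((a2 - a1) * exp (- r * h)) - V s y (a2 - a1)\<bar> \<le> C * h"
    using V_edge_lipschitz by blast
  obtain \<delta>1 where \<delta>1: "0 < \<delta>1" "\<And>a b. b - a \<le> \<delta>1 \<Longrightarrow> avg (indicator {a..b}) \<le> \<eta> / 2"
    using avg_interval_small[of "\<eta> / 2"] \<eta> by auto
  define C' where "C' = C + K * k"
  have C': "0 < C'" using C K k by (simp add: C'_def add_pos_pos)
  obtain \<rho> where \<rho>: "0 < \<rho>" "\<rho> \<le> 1" "\<rho> \<le> \<delta>1 / k" "\<rho> \<le> \<eta> / (2 * C')"
    using common_radius[of 1 "\<delta>1 / k" "\<eta> / (2 * C')"] \<delta>1 k C' \<eta> by auto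
  have "\<bar>G s y ((a2 - a1) * exp (- r * (h - t))) - G s y (exp (r * t) * (a2 - a1))\<bar> \<le> \<eta>"
    if h: "0 < h" "h < \<rho>" and t: "0 \<le> t" "t \<le> h" for h t y
  proof -
    define d1 where "d1 = (a2 - a1) * exp (- r * (h - t))"
    define d2 where "d2 = exp (r * t) * (a2 - a1)"
    have d2: "d2 \<le> a2 - a1" unfolding d2_def by (rule scaled_left[OF s t(1)])
    have eh: "(a1 - a2) * (exp (r * h) - 1) \<le> k * h"
      using exp_minus_one_le[of h] h \<rho> a12 unfolding k_def by (simp add: mult.assoc)
    have eth: "exp (r * t) \<le> exp (r * h)" using t r by simp
    have len: "- d2 - (a1 - a2) \<le> k * h"
    proof -
      have "- d2 - (a1 - a2) = (a1 - a2) * (exp (r * t) - 1)" unfolding d2_def by (simp add: algebra_simps)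
      also have "\<dots> \<le> (a1 - a2) * (exp (r * h) - 1)" using eth a12 by (intro mult_left_mono) auto
      finally show ?thesis using eh by simp
    qed
    \<comment> \<open>Contains the claim sizes that leave the first line solvent but ruin the second
      one when it is started from d2; only there can one value jump to 1 without the other.\<close>
    let ?I = "{y - (a2 - d2)..y - a1}"
    note [measurable (raw)] = V_measurable[OF s]
    have pt: "\<bar>V s (y - z) d1 - V s (y - z) d2\<bar> \<le> indicator ?I z + C' * h" for z
    proof -
      define x where "x = y - z"
      have Ch: "0 \<le> C' * h" using C' h by simp
      consider "x < a1" | "a1 \<le> x" "x + d2 < a2" | "a1 \<le> x" "a2 \<le> x + d2" by linarith
      then have "\<bar>V s x d1 - V s x d2\<bar> \<le> indicator ?I z + C' * h"
      proof cases
        case 1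
        then show ?thesis using V_ruin[OF s, of x] Ch by simp
      next
        case 2
        then have "z \<in> ?I" by (auto simp: x_def)
        then show ?thesis using V_abs_diff[OF s, of x d1 x d2] Ch by simp
      next
        case 3
        have "\<bar>V s x d1 - V s x (a2 - a1)\<bar> \<le> C * (h - t)"
          unfolding d1_def using h t \<rho> by (intro C(2)) auto
        also have "\<dots> \<le> C * h" using C t by simp
        finally have "\<bar>V s x d1 - V s x (a2 - a1)\<bar> \<le> C * h" .
        moreover have "V s x (a2 - a1) = phi s (x - (a1 - a2))" "V s x d2 = phi s (x + d2)"
          using V_phi[OF s d2] V_phi[OF s order_refl, of x] by (auto simp: algebra_simps)
        moreover have "\<bar>phi s (x - (a1 - a2)) - phi s (x + d2)\<bar> \<le> K * (k * h)"
        proof -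
          have "\<bar>phi s (x - (a1 - a2)) - phi s (x + d2)\<bar> \<le> K * ((a1 - a2) * (exp (r * h) - 1))"
            using phi_edge_diff[OF 3(1) t] 3(2) unfolding d2_def K_def by linarith
          also have "\<dots> \<le> K * (k * h)" using eh K by (intro mult_left_mono) auto
          finally show ?thesis .
        qed
        ultimately have "\<bar>V s x d1 - V s x d2\<bar> \<le> C * h + K * (k * h)" by linarith
        then show ?thesis by (simp add: C'_def algebra_simps indicator_def)
      qed
      then show ?thesis by (simp add: x_def)
    qed
    have "\<bar>G s y d1 - G s y d2\<bar> = \<bar>avg (\<lambda>z. V s (y - z) d1 - V s (y - z) d2)\<bar>"
      unfolding G_def by (subst avg_diff[where B = 1 and B' = 1]) (use V_abs[OF s] in auto)
    also have "\<dots> \<le> avg (\<lambda>z. indicator ?I z + C' * h)"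
    proof -
      have m: "avg u \<le> avg (\<lambda>z. indicator ?I z + C' * h)"
        if [measurable]: "u \<in> borel_measurable borel" and u: "\<And>z. u z \<le> indicator ?I z + C' * h" "\<And>z. \<bar>u z\<bar> \<le> 1" for u
        by (rule avg_mono[where B = 1 and B' = "1 + \<bar>C' * h\<bar>"]) (use u in \<open>auto simp: indicator_def\<close>)
      have "avg (\<lambda>z. V s (y - z) d1 - V s (y - z) d2) \<le> avg (\<lambda>z. indicator ?I z + C' * h)"
        using pt V_abs_diff[OF s] by (intro m) (auto simp: abs_le_iff)
      moreover have "avg (\<lambda>z. -1 * (V s (y - z) d1 - V s (y - z) d2)) \<le> avg (\<lambda>z. indicator ?I z + C' * h)"
        using pt V_abs_diff[OF s] by (intro m) (auto simp: abs_le_iff)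
      ultimately show ?thesis unfolding avg_cmult by linarith
    qed
    also have "\<dots> = avg (indicator ?I) + C' * h"
    proof -
      have "avg (\<lambda>z. indicator ?I z + C' * h) - avg (\<lambda>z. C' * h) = avg (\<lambda>z. (indicator ?I z + C' * h) - C' * h)"
        by (rule avg_diff[where B = "1 + \<bar>C' * h\<bar>" and B' = "\<bar>C' * h\<bar>"]) (auto simp: indicator_def)
      then show ?thesis by simp
    qed
    also have "\<dots> \<le> \<eta> / 2 + \<eta> / 2"
    proof (rule add_mono)
      have "k * h \<le> k * (\<delta>1 / k)" using h \<rho>(3) k by (intro mult_left_mono) auto
      then have "k * h \<le> \<delta>1" using k by simp
      then show "avg (indicator ?I) \<le> \<eta> / 2" using len by (intro \<delta>1(2)) auto
      have "C' * h \<le> C' * (\<eta> / (2 * C'))" using h \<rho>(4) C' by (intro mult_left_mono) auto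
      then show "C' * h \<le> \<eta> / 2" using C' by simp
    qed
    finally show ?thesis unfolding d1_def d2_def by simp
  qed
  then show ?thesis using \<rho>(1) by blast
qed

end

context
  fixes s :: real assumes s: "0 < s"
begin

text \<open>In \<open>V_edge\<close> the claim term is o(h) by \<open>edge_oscillation\<close>, and
  the phi term is a mean value increment over the distance (a1 - a2) (exp(r h) - 1). Uniformity in y
  comes from uniform continuity of \<open>P\<close> on a compact interval, whence the bound
  X.\<close>

lemma edge_quotient:
  assumes \<eta>: "0 < \<eta>"
  shows "\<exists>\<delta>>0. \<forall>h y. 0 < h \<longrightarrow> h < \<delta> \<longrightarrow> a1 \<le> y \<longrightarrow> y \<le> X \<longrightarrow>
    \<bar>(V s y ((a2 - a1) * exp (- r * h)) - V s y (a2 - a1)) / h - r * (a1 - a2) * P s (y - (a1 - a2))\<bar> \<le> \<eta>"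
proof -
  \<comment> \<open>Every argument of \<open>P\<close> met for h <= 1 lies between a2 and W.\<close>
  define W where "W = exp r * \<bar>X\<bar>"
  define cm where "cm = (a1 - a2) * (r * exp r)"
  define Pm where "Pm = (2 * lam + s) / (r * a2)"
  have pos: "0 < cm" "0 < Pm" using a12 r lam s a2 by (auto simp: cm_def Pm_def add_pos_pos)
  \<comment> \<open>Coefficient of \<open>P s \<xi>\<close> after division by h: discount times
    displacement per unit of time, with limit r (a1 - a2).\<close>
  define c where "c h = exp (- (lam + s) * h) * ((a1 - a2) * ((exp (r * h) - 1) / h))" for h
  have "((\<lambda>h. exp (r * h)) has_real_derivative r) (at 0)" by (auto intro!: derivative_eq_intros)
  then have "((\<lambda>h. (exp (r * h) - 1) / h) \<longlongrightarrow> r) (at 0)" by (simp add: has_field_derivative_iff)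
  then have "(c \<longlongrightarrow> exp (- (lam + s) * 0) * ((a1 - a2) * r)) (at 0)"
    unfolding c_def by (intro tendsto_intros)
  then have "(c \<longlongrightarrow> r * (a1 - a2)) (at 0)" by (simp add: mult.commute)
  from tendstoD[OF this, of "\<eta> / (4 * Pm)"]
  obtain \<delta>1 where \<delta>1: "0 < \<delta>1" "\<And>h. 0 < h \<Longrightarrow> h < \<delta>1 \<Longrightarrow> \<bar>c h - r * (a1 - a2)\<bar> < \<eta> / (4 * Pm)"
    using \<eta> pos by (auto simp: eventually_at dist_real_def)
  have "uniformly_continuous_on {a2..W} (P s)"
    by (rule compact_uniformly_continuous) (auto intro: continuous_on_subset[OF P_continuous[OF s]])
  moreover have "0 < \<eta> / (4 * cm)" using \<eta> pos by simp
  ultimately obtain \<delta>2 where \<delta>2: "0 < \<delta>2" "\<And>x x'. x \<in> {a2..W} \<Longrightarrow> x' \<in> {a2..W} \<Longrightarrow> \<bar>x' - x\<bar> < \<delta>2 \<Longrightarrow> \<bar>P s x' - P s x\<bar> < \<eta> / (4 * cm)"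
    unfolding uniformly_continuous_on_def dist_real_def by metis
  have "0 < \<eta> / (2 * lam)" using \<eta> lam by simp
  then obtain \<delta>3 where \<delta>3: "0 < \<delta>3" "\<And>h t y. 0 < h \<Longrightarrow> h < \<delta>3 \<Longrightarrow> 0 \<le> t \<Longrightarrow> t \<le> h \<Longrightarrow>
    \<bar>G s y ((a2 - a1) * exp (- r * (h - t))) - G s y (exp (r * t) * (a2 - a1))\<bar> \<le> \<eta> / (2 * lam)"
    using edge_oscillation[OF s] by meson
  define k where "k = r * exp r * (\<bar>X\<bar> + 1)"
  have k: "0 < k" using r by (simp add: k_def add_nonneg_pos)
  obtain \<rho>1 where \<rho>1: "0 < \<rho>1" "\<rho>1 \<le> \<delta>1" "\<rho>1 \<le> \<delta>3" "\<rho>1 \<le> 1"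
    using common_radius[of \<delta>1 \<delta>3 1] \<delta>1(1) \<delta>3(1) by auto
  obtain \<rho> where \<rho>: "0 < \<rho>" "\<rho> \<le> \<rho>1" "\<rho> \<le> \<delta>2 / k"
    using common_radius[of \<rho>1 "\<delta>2 / k" 1] \<rho>1(1) \<delta>2(1) k by auto
  have main: "\<bar>(V s y ((a2 - a1) * exp (- r * h)) - V s y (a2 - a1)) / h - r * (a1 - a2) * P s (y - (a1 - a2))\<bar> \<le> \<eta>"
    if h: "0 < h" "h < \<rho>" and y: "a1 \<le> y" "y \<le> X" for h y
  proof -
    have h': "0 \<le> h" "h \<le> 1" "h < \<delta>1" "h < \<delta>3" using h \<rho> \<rho>1 by auto
    define A where "A = tint lam (lam + s) {0..h} (\<lambda>t. G s (exp (r * t) * y) ((a2 - a1) * exp (- r * (h - t))) - G s (exp (r * t) * y) (exp (r * t) * (a2 - a1)))"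
    note [measurable (raw)] = G_measurable[OF s]
    have "\<bar>A\<bar> \<le> lam / (lam + s) * (1 - exp (- (lam + s) * h)) * (\<eta> / (2 * lam))"
      unfolding A_def by (intro tint_abs_le_Icc[OF lam b_pos[OF s]] \<delta>3) (use h h' in auto)
    also have "\<dots> \<le> lam / (lam + s) * ((lam + s) * h) * (\<eta> / (2 * lam))"
      using one_minus_exp[OF s h'(1)] lam s \<eta> by (intro mult_right_mono mult_left_mono) auto
    also have "\<dots> = h * (\<eta> / 2)" using b_pos[OF s] lam by simp
    finally have A: "\<bar>A / h\<bar> \<le> \<eta> / 2" using h by (simp add: abs_divide pos_divide_le_eq mult.commute)
    define w where "w = y - (a1 - a2)"
    define x0 where "x0 = exp (r * h) * w"
    define x1 where "x1 = exp (r * h) * y - (a1 - a2)"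
    have eh: "1 < exp (r * h)" using r h by simp
    have w: "a2 \<le> w" "w \<le> y" using y a12 by (auto simp: w_def)
    have "1 * w < exp (r * h) * w" by (rule mult_strict_right_mono[OF eh]) (use w a2 in linarith)
    then have "w < x0" and x0: "a2 < x0" using w by (auto simp: x0_def)
    have x01: "x1 - x0 = (a1 - a2) * (exp (r * h) - 1)" unfolding x0_def x1_def w_def by (simp add: algebra_simps)
    have lt: "x0 < x1" using x01 eh a12 by (smt (verit) mult_pos_pos)
    have "\<exists>\<xi>>x0. \<xi> < x1 \<and> phi s x1 - phi s x0 = (x1 - x0) * P s \<xi>"
    proof (rule MVT2[OF lt])
      fix x assume "x0 \<le> x"
      then have "a2 < x" using x0 by simp
      then have "(phi s has_real_derivative P s x) (at x within {a2<..})"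
        by (intro DERIV_subset[OF phi_deriv[OF s]]) auto
      moreover have "at x within {a2<..} = at x" using \<open>a2 < x\<close> by (intro at_within_open) auto
      ultimately show "(phi s has_real_derivative P s x) (at x)" by simp
    qed
    then obtain \<xi> where \<xi>: "x0 < \<xi>" "\<xi> < x1" "phi s x1 - phi s x0 = (x1 - x0) * P s \<xi>" by blast
    have "exp (r * h) \<le> exp r" using h' r by simp
    then have "exp (r * h) * y \<le> exp r * \<bar>X\<bar>" using y a2 a12 by (intro mult_mono) auto
    then have x1W: "x1 \<le> W" using a12 by (simp add: x1_def W_def)
    have "x1 - w = (exp (r * h) - 1) * y" unfolding x1_def w_def by (simp add: algebra_simps)
    also have "\<dots> \<le> (r * exp r * h) * (\<bar>X\<bar> + 1)"
      using exp_minus_one_le[OF s h'(1,2)] y a2 a12 r h by (intro mult_mono) auto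
    also have "\<dots> = k * h" by (simp add: k_def)
    also have "\<dots> < k * (\<delta>2 / k)" using h \<rho>(3) k by (intro mult_strict_left_mono) auto
    finally have "x1 - w < \<delta>2" using k by simp
    then have "\<bar>P s \<xi> - P s w\<bar> < \<eta> / (4 * cm)"
      using \<xi> x1W x0 w lt \<open>w < x0\<close> by (intro \<delta>2(2)) auto
    moreover have "\<bar>c h\<bar> \<le> cm"
    proof -
      have "(exp (r * h) - 1) / h \<le> r * exp r"
        using exp_minus_one_le[OF s h'(1,2)] h by (simp add: pos_divide_le_eq)
      then have "\<bar>c h\<bar> \<le> 1 * ((a1 - a2) * (r * exp r))"
        unfolding c_def abs_mult using a12 h eh one_minus_exp[OF s h'(1)] by (intro mult_mono) auto
      then show ?thesis by (simp add: cm_def)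
    qed
    ultimately have 1: "\<bar>c h * (P s \<xi> - P s w)\<bar> \<le> cm * (\<eta> / (4 * cm))"
      unfolding abs_mult using pos by (intro mult_mono) auto
    have 2: "\<bar>(c h - r * (a1 - a2)) * P s w\<bar> \<le> \<eta> / (4 * Pm) * Pm"
      unfolding abs_mult using \<delta>1(2)[OF h(1) h'(3)] P_abs[OF s w(1)] pos \<eta>
      by (intro mult_mono) (auto simp: Pm_def)
    have "(V s y ((a2 - a1) * exp (- r * h)) - V s y (a2 - a1)) / h = A / h + c h * P s \<xi>"
      unfolding V_edge[OF s y(1) h'(1)] A_def[symmetric]
      using \<xi>(3) unfolding x0_def[symmetric] x1_def[symmetric] w_def[symmetric] x01
      by (simp add: c_def add_divide_distrib)
    then have "(V s y ((a2 - a1) * exp (- r * h)) - V s y (a2 - a1)) / h - r * (a1 - a2) * P s w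
       = A / h + c h * (P s \<xi> - P s w) + (c h - r * (a1 - a2)) * P s w" by (simp add: algebra_simps)
    moreover have "cm * (\<eta> / (4 * cm)) = \<eta> / 4" "\<eta> / (4 * Pm) * Pm = \<eta> / 4" using pos by auto
    ultimately show ?thesis using A 1 2 unfolding w_def by linarith
  qed
  show ?thesis using \<rho>(1) main by blast
qed

text \<open>For T > 0 there is no candidate for the limit, so the quotients for two steps h and h'
  are subtracted. The difference vanishes below a1, where V is 1; on the diagonal
  \<open>edge_quotient\<close> puts both quotients within \<eta> / 2 of one function, and
  \<open>max_principle\<close> carries the resulting bound \<eta> to all T.\<close>

lemma V_deriv_time:
  assumes y: "a1 \<le> y" and T0: "0 \<le> T0"
  shows "\<exists>D. ((\<lambda>T. V s y ((a2 - a1) * exp (- r * T))) has_real_derivative D) (at T0 within {0..})"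
proof -
  define F where "F T = V s y ((a2 - a1) * exp (- r * T))" for T
  have "\<exists>D. (F has_real_derivative D) (at T0 within {0..T0 + 1})"
  proof (rule uniform_quotients_differentiable)
    show "\<bar>F T\<bar> \<le> 1" for T unfolding F_def by (rule V_abs[OF s])
    fix \<eta> :: real assume "0 < \<eta>"
    \<comment> \<open>Largest abscissa at which a path from y can meet the diagonal with at most T0
      + 1 time left; the extra unit leaves room to the right of T0.\<close>
    define X where "X = y * exp (r * (T0 + 1))"
    obtain \<delta> where \<delta>: "0 < \<delta>" "\<And>h y. 0 < h \<Longrightarrow> h < \<delta> \<Longrightarrow> a1 \<le> y \<Longrightarrow> y \<le> X \<Longrightarrow>
      \<bar>(V s y ((a2 - a1) * exp (- r * h)) - V s y (a2 - a1)) / h - r * (a1 - a2) * P s (y - (a1 - a2))\<bar> \<le> \<eta> / 2"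
      using edge_quotient[of "\<eta> / 2" X] \<open>0 < \<eta>\<close> by auto
    have "\<bar>(F (T + h) - F T) / h - (F (T + h') - F T) / h'\<bar> \<le> \<eta>"
      if h: "0 < h" "h < \<delta>" "0 < h'" "h' < \<delta>" and T: "0 \<le> T" "T \<le> T0 + 1" for h h' T
    proof -
      define U where "U h y T = V s y ((a2 - a1) * exp (- r * (T + h)))" for h y T
      define Z where "Z y T = 1 / h * (U h y T - U 0 y T) - 1 / h' * (U h' y T - U 0 y T)" for y T
      have "solves (lam + s) Z"
        unfolding Z_def U_def
        by (intro solves_diff solves_cmult solves_V b_pos s) (use h in auto)
      then have "\<bar>Z y T\<bar> \<le> \<eta>"
      proof (rule max_principle[rotated])
        show "Z y T = 0" if "y < a1" for y T
          unfolding Z_def U_def using V_ruin[OF s, of y] that by simp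
        show "\<bar>Z y 0\<bar> \<le> \<eta>" if "a1 \<le> y" "y \<le> X" for y
        proof -
          have tri: "\<bar>p - q\<bar> \<le> \<eta>" if "\<bar>p - c\<bar> \<le> \<eta> / 2" "\<bar>q - c\<bar> \<le> \<eta> / 2" for p q c :: real
            using that by linarith
          show ?thesis
            using tri[OF \<delta>(2)[OF h(1,2) that] \<delta>(2)[OF h(3,4) that]] unfolding Z_def U_def by simp
        qed
        show "y * exp (r * T) \<le> X"
          unfolding X_def using y a2 a12 T r by (intro mult_left_mono) auto
      qed (use s T \<open>0 < \<eta>\<close> in auto)
      then show ?thesis unfolding Z_def U_def F_def by simp
    qed
    then show "\<exists>\<delta>>0. \<forall>h h' T. 0 < h \<longrightarrow> h < \<delta> \<longrightarrow> 0 < h' \<longrightarrow> h' < \<delta> \<longrightarrow> 0 \<le> T \<longrightarrow> T \<le> T0 + 1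
      \<longrightarrow> \<bar>(F (T + h) - F T) / h - (F (T + h') - F T) / h'\<bar> \<le> \<eta>" using \<delta>(1) by blast
  qed (use T0 in auto)
  moreover have "at T0 within {0..T0 + 1} = at T0 within {0..}"
    by (rule at_within_nhd[of _ "{..<T0 + 1}"]) auto
  ultimately show ?thesis unfolding F_def by auto
qed

text \<open>On the diagonal the limit is needed in closed form, to be matched with the derivative of
  phi on the other side.\<close>

lemma V_deriv_time_0:
  assumes y: "a1 \<le> y"
  shows "((\<lambda>T. V s y ((a2 - a1) * exp (- r * T))) has_real_derivative r * (a1 - a2) * P s (y - (a1 - a2))) (at 0 within {0..})"
  unfolding has_field_derivative_iff Lim_within
proof (intro allI impI)
  fix e :: real assume "0 < e"
  then obtain \<delta> where \<delta>: "0 < \<delta>" "\<And>h. 0 < h \<Longrightarrow> h < \<delta> \<Longrightarrow>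
      \<bar>(V s y ((a2 - a1) * exp (- r * h)) - V s y (a2 - a1)) / h - r * (a1 - a2) * P s (y - (a1 - a2))\<bar> \<le> e / 2"
    using edge_quotient[of "e / 2" y] y by auto
  have "dist ((V s y ((a2 - a1) * exp (- r * h)) - V s y ((a2 - a1) * exp (- r * 0))) / (h - 0))
        (r * (a1 - a2) * P s (y - (a1 - a2))) < e" if "h \<in> {0..}" "0 < dist h 0 \<and> dist h 0 < \<delta>" for h
    using \<delta>(2)[of h] that \<open>0 < e\<close> by (simp add: dist_real_def)
  then show "\<exists>d>0. \<forall>h\<in>{0..}. 0 < dist h 0 \<and> dist h 0 < d \<longrightarrow>
      dist ((V s y ((a2 - a1) * exp (- r * h)) - V s y ((a2 - a1) * exp (- r * 0))) / (h - 0))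
        (r * (a1 - a2) * P s (y - (a1 - a2))) < e" using \<delta>(1) by blast
qed

section \<open>The derivative in d, on both sides of the diagonal and of the axis\<close>

lemma time_coordinate:
  assumes "a2 - a1 \<le> d" "d < 0"
  shows "0 \<le> ln ((a2 - a1) / d) / r" "(a2 - a1) * exp (- r * (ln ((a2 - a1) / d) / r)) = d"
proof -
  have "1 \<le> (a2 - a1) / d" using assms by (simp add: le_divide_eq)
  then show "0 \<le> ln ((a2 - a1) / d) / r" using r by simp
  show "(a2 - a1) * exp (- r * (ln ((a2 - a1) / d) / r)) = d"
    using assms r a12 by (simp add: exp_minus divide_neg_neg)
qed

lemma V_deriv_left_of_axis:
  assumes D: "((\<lambda>T. V s y ((a2 - a1) * exp (- r * T))) has_real_derivative D) (at (ln ((a2 - a1) / d) / r) within {0..})"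
    and d: "a2 - a1 \<le> d" "d < 0"
  shows "(V s y has_real_derivative D * (- 1 / (r * d))) (at d within {a2 - a1..<0})"
proof -
  define \<tau> where "\<tau> d = ln ((a2 - a1) / d) / r" for d
  have "(\<tau> has_real_derivative - 1 / (r * d)) (at d within {a2 - a1..<0})"
    unfolding \<tau>_def using d a12 r
    by (auto intro!: derivative_eq_intros simp: divide_neg_neg field_simps power2_eq_square)
  moreover have "((\<lambda>T. V s y ((a2 - a1) * exp (- r * T))) has_real_derivative D) (at (\<tau> d) within \<tau> ` {a2 - a1..<0})"
    unfolding \<tau>_def by (rule DERIV_subset[OF D]) (use time_coordinate in force)
  ultimately have "((\<lambda>T. V s y ((a2 - a1) * exp (- r * T))) \<circ> \<tau> has_real_derivative D * (- 1 / (r * d))) (at d within {a2 - a1..<0})"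
    by (rule DERIV_image_chain[rotated])
  then show ?thesis
    by (rule has_field_derivative_transform_within[OF _ zero_less_one])
      (use d time_coordinate(2) in \<open>auto simp: \<tau>_def\<close>)
qed

text \<open>The set \<open>{a2 - y..}\<close> reaches beyond the diagonal on purpose: sliding a
  point of \<open>upper\<close> along its ray to another abscissa may carry it to the left of the
  diagonal. Hence both one-sided derivatives are needed there and have to agree.\<close>

lemma V_deriv:
  assumes y: "a1 \<le> y" and d: "a2 - a1 \<le> d"
  shows "\<exists>D. (V s y has_real_derivative D) (at d within {a2 - y..})"
proof -
  consider "0 < d" | "d = 0" | "a2 - a1 < d" "d < 0" | "d = a2 - a1" using d by linarith
  then show ?thesis
  proof cases
    case 1
    have "((\<lambda>_. V s y 0) has_real_derivative 0) (at d)" by simp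
    then have "(V s y has_real_derivative 0) (at d)"
    proof (rule has_field_derivative_transform_within_open[where S = "{0<..}"])
      show "V s y 0 = V s y x" if "x \<in> {0<..}" for x
        using that by (intro V_right[OF s, symmetric]) auto
    qed (use 1 in auto)
    then show ?thesis using has_field_derivative_at_within by blast
  next
    case 2
    then show ?thesis using V_deriv_axis[OF s y] has_field_derivative_at_within by blast
  next
    case 3
    obtain D where "((\<lambda>T. V s y ((a2 - a1) * exp (- r * T))) has_real_derivative D) (at (ln ((a2 - a1) / d) / r) within {0..})"
      using V_deriv_time[OF y time_coordinate(1)[of d]] 3 by auto
    then have "(V s y has_real_derivative D * (- 1 / (r * d))) (at d within {a2 - a1..<0})"
      by (rule V_deriv_left_of_axis) (use 3 in auto)
    then have "(V s y has_real_derivative D * (- 1 / (r * d))) (at d within {a2 - a1<..<0})"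
      by (rule DERIV_subset) auto
    then have "(V s y has_real_derivative D * (- 1 / (r * d))) (at d)"
      using 3 at_within_open[of d "{a2 - a1<..<0}"] by simp
    then show ?thesis using has_field_derivative_at_within by blast
  next
    case 4
    let ?D = "P s (y - (a1 - a2))"
    have "(V s y has_real_derivative (r * (a1 - a2) * ?D) * (- 1 / (r * d))) (at d within {a2 - a1..<0})"
      by (rule V_deriv_left_of_axis) (use 4 a12 V_deriv_time_0[OF y] in auto)
    \<comment> \<open>With d = a2 - a1 the chain-rule factor -1 / (r d) cancels r (a1 - a2) and
      leaves exactly the derivative of phi.\<close>
    moreover have "(r * (a1 - a2) * ?D) * (- 1 / (r * d)) = ?D"
    proof -
      have "r * d = - (r * (a1 - a2))" "r * (a1 - a2) \<noteq> 0" using 4 r a12 by (auto simp: algebra_simps)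
      then show ?thesis by simp
    qed
    ultimately have right: "(V s y has_real_derivative ?D) (at d within {a2 - a1..<0})" by simp
    have "((\<lambda>d. phi s (y + d)) has_real_derivative ?D * 1) (at d within {a2 - y..a2 - a1})"
    proof (rule DERIV_image_chain[where g = "\<lambda>d. y + d" and f = "phi s", unfolded comp_def])
      have "(phi s has_real_derivative ?D) (at (y + d) within {a2..})"
      proof -
        have e: "y + d = y - (a1 - a2)" using 4 by simp
        show ?thesis unfolding e by (rule phi_deriv[OF s]) (use y in simp)
      qed
      then show "(phi s has_real_derivative ?D) (at (y + d) within (+) y ` {a2 - y..a2 - a1})"
        by (rule DERIV_subset) auto
    qed (auto intro!: derivative_eq_intros)
    then have "((\<lambda>d. phi s (y + d)) has_real_derivative ?D) (at d within {a2 - y..a2 - a1})" by simp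
    then have left: "(V s y has_real_derivative ?D) (at d within {a2 - y..a2 - a1})"
      by (rule has_field_derivative_transform_within[OF _ zero_less_one]) (use 4 y V_phi[OF s] in auto)
    have "(V s y has_real_derivative ?D) (at d within {a2 - y..a2 - a1} \<union> {a2 - a1..<0})"
      using left right unfolding has_field_derivative_iff unfolding at_within_union by (rule filterlim_sup)
    moreover have "{a2 - y..a2 - a1} \<union> {a2 - a1..<0} = {a2 - y..<0}" using y a12 by auto
    moreover have "at d within {a2 - y..<0} = at d within {a2 - y..}"
      by (rule at_within_nhd[of _ "{..<0}"]) (use 4 a12 in auto)
    ultimately show ?thesis by auto
  qed
qed

end

section \<open>Joint continuity and total differentiability\<close>

definition survival :: "(real \<times> real) set" where
  "survival = {(y, d). a1 \<le> y \<and> a2 \<le> y + d}"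

text \<open>The domain of the equation in the new coordinates. The flow carries points with d < 0
  out of it across the diagonal, whereas it maps \<open>survival\<close> into itself; so derivatives
  are taken within \<open>upper\<close> but continuity within \<open>survival\<close>.\<close>

definition upper :: "(real \<times> real) set" where
  "upper = {(y, d). a1 \<le> y \<and> a2 - a1 \<le> d}"

lemma upper_survival: "upper \<subseteq> survival"
  unfolding upper_def survival_def by auto

text \<open>Moving inwards along a ray brings a negative d closer to 0, moving outwards enlarges y +
  d. Either way the second line survives, although the diagonal may be crossed.\<close>

lemma upper_to_y0:
  assumes p: "(y, d) \<in> upper" and y0: "a1 \<le> y0"
  shows "a2 \<le> y0 + d * y0 / y"
proof -
  have y: "a1 \<le> y" "a2 - a1 \<le> d" "0 < y" "0 < y0" using p y0 a2 a12 by (auto simp: upper_def)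
  show ?thesis
  proof (cases "y0 \<le> y")
    case True
    have "a2 - a1 \<le> d * (y0 / y)"
    proof (cases "0 \<le> d")
      case True
      then have "0 \<le> d * (y0 / y)" using y by simp
      then show ?thesis using a12 by linarith
    next
      case False
      then have "d * 1 \<le> d * (y0 / y)" using True y by (intro mult_left_mono_neg) auto
      then show ?thesis using y by simp
    qed
    then show ?thesis using y0 by simp
  next
    case False
    have "a2 * 1 \<le> (y + d) * (y0 / y)"
      using False y a2 by (intro mult_mono) auto
    also have "\<dots> = y0 + d * y0 / y" using y by (simp add: field_simps)
    finally show ?thesis by simp
  qed
qed

context
  fixes s :: real assumes s: "0 < s"
begin

text \<open>Points of \<open>upper\<close> are slid along their rays to abscissa y0 and compared on
  that vertical line. Points to the left of the diagonal occur only near a base point on it, and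
  there phi gives the comparison. B adds the two bounds.\<close>

lemma V_tendsto:
  assumes p0: "(y0, d0) \<in> upper"
  shows "((\<lambda>p. V s (fst p) (snd p)) \<longlongrightarrow> V s y0 d0) (at (y0, d0) within survival)"
proof -
  have y0: "a1 \<le> y0" "a2 - a1 \<le> d0" "0 < y0" using p0 a2 a12 by (auto simp: upper_def)
  \<comment> \<open>Clamped from below so that m takes values in \<open>{a2 - y0..}\<close>, within
    which continuity of \<open>V s y0\<close> is known; at points of \<open>upper\<close> the clamp
    has no effect.\<close>
  define m where "m p = max (snd p * y0 / fst p) (a2 - y0)" for p
  define B where "B p = (lam + s) / (r * a2) * \<bar>(fst p + snd p) - (y0 + d0)\<bar>
    + ((lam + s) / r * \<bar>ln (y0 / fst p)\<bar> + \<bar>V s y0 (m p) - V s y0 d0\<bar>)" for p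
  have fs: "(fst \<longlongrightarrow> y0) (at (y0, d0) within survival)" "(snd \<longlongrightarrow> d0) (at (y0, d0) within survival)"
    using tendsto_fst[OF tendsto_ident_at] tendsto_snd[OF tendsto_ident_at] by auto
  have "(m \<longlongrightarrow> max (d0 * y0 / y0) (a2 - y0)) (at (y0, d0) within survival)"
    unfolding m_def using y0 by (intro tendsto_intros fs) auto
  moreover have "max (d0 * y0 / y0) (a2 - y0) = d0" using y0 max_absorb1[of "a2 - y0" d0] by simp
  ultimately have m: "(m \<longlongrightarrow> d0) (at (y0, d0) within survival)" by simp
  obtain D where "(V s y0 has_real_derivative D) (at d0 within {a2 - y0..})"
    using V_deriv[OF s y0(1,2)] by blast
  then have "continuous (at d0 within {a2 - y0..}) (V s y0)" by (rule DERIV_continuous)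
  then have "((\<lambda>p. V s y0 (m p)) \<longlongrightarrow> V s y0 d0) (at (y0, d0) within survival)"
    by (rule continuous_within_tendsto_compose[OF _ always_eventually m]) (simp add: m_def)
  then have "(B \<longlongrightarrow> (lam + s) / (r * a2) * \<bar>(y0 + d0) - (y0 + d0)\<bar>
    + ((lam + s) / r * \<bar>ln (y0 / y0)\<bar> + \<bar>V s y0 d0 - V s y0 d0\<bar>)) (at (y0, d0) within survival)"
    unfolding B_def using y0 by (intro tendsto_intros fs) auto
  then have B: "(B \<longlongrightarrow> 0) (at (y0, d0) within survival)" using y0 by simp
  have pos: "0 \<le> (lam + s) / (r * a2)" "0 \<le> (lam + s) / r" using lam s r a2 by auto
  have bd: "\<bar>V s y d - V s y0 d0\<bar> \<le> B (y, d)"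
    if S: "(y, d) \<in> survival" and d: "a2 - a1 < d0 \<longrightarrow> a2 - a1 < d" for y d
  proof (cases "a2 - a1 \<le> d")
    case True
    have yd: "(y, d) \<in> upper" "0 < y" using S True a2 a12 by (auto simp: upper_def survival_def)
    have mm: "m (y, d) = d * y0 / y" using upper_to_y0[OF yd(1) y0(1)] by (simp add: m_def)
    have "V s y d = R s y d" using S by (intro V_eq_R[OF s]) (auto simp: survival_def)
    moreover have "V s y0 (d * y0 / y) = R s y0 (d * y0 / y)"
      using upper_to_y0[OF yd(1) y0(1)] y0 by (intro V_eq_R[OF s]) auto
    moreover have "\<bar>R s y d - R s y0 (d * y0 / y)\<bar> \<le> (lam + s) / r * \<bar>ln (y0 / y)\<bar>"
      using yd y0 by (intro R_lipschitz_ray[OF s]) auto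
    moreover have "0 \<le> (lam + s) / (r * a2) * \<bar>(y + d) - (y0 + d0)\<bar>" using pos by (intro mult_nonneg_nonneg) auto
    ultimately show ?thesis unfolding B_def mm fst_conv snd_conv by linarith
  next
    case False
    then have "d0 = a2 - a1" using d y0 by auto
    then have "V s y d = phi s (y + d)" "V s y0 d0 = phi s (y0 + d0)"
      using False by (auto intro!: V_phi[OF s])
    moreover have "\<bar>phi s (y + d) - phi s (y0 + d0)\<bar> \<le> (lam + s) / (r * a2) * \<bar>(y + d) - (y0 + d0)\<bar>"
      by (rule phi_lipschitz[OF s]) (use S y0 \<open>d0 = a2 - a1\<close> in \<open>auto simp: survival_def\<close>)
    moreover have "0 \<le> (lam + s) / r * \<bar>ln (y0 / y)\<bar>" using pos by (intro mult_nonneg_nonneg) auto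
    ultimately show ?thesis unfolding B_def fst_conv snd_conv by linarith
  qed
  have "\<forall>\<^sub>F p in at (y0, d0) within survival. a2 - a1 < d0 \<longrightarrow> a2 - a1 < snd p"
    using order_tendstoD(1)[OF fs(2), of "a2 - a1"] by (cases "a2 - a1 < d0") auto
  moreover have "\<forall>\<^sub>F p in at (y0, d0) within survival. p \<in> survival"
    by (simp add: eventually_at_topological) blast
  ultimately have "\<forall>\<^sub>F p in at (y0, d0) within survival. norm (V s (fst p) (snd p) - V s y0 d0) \<le> B p"
    by eventually_elim (use bd in auto)
  then have "((\<lambda>p. V s (fst p) (snd p) - V s y0 d0) \<longlongrightarrow> 0) (at (y0, d0) within survival)"
    by (rule Lim_null_comparison[OF _ B])
  then show ?thesis by (rule LIM_zero_cancel)
qed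

lemma V_continuous:
  "(y0, d0) \<in> upper \<Longrightarrow> continuous (at (y0, d0) within survival) (\<lambda>p. V s (fst p) (snd p))"
  unfolding continuous_within using V_tendsto by simp

text \<open>With d0 >= a2 - a1 a claim cannot ruin the second line without ruining the first, so V
  at (y0 - z, d0) can jump only for the claim size z = y0 - a1. For smaller z both lines have room
  to spare, so that nearby points survive even to the left of the diagonal.\<close>

lemma G_continuous:
  assumes p0: "(y0, d0) \<in> upper"
  shows "continuous (at (y0, d0) within survival) (\<lambda>p. G s (fst p) (snd p))"
  unfolding continuous_within_sequentially comp_def
proof (intro allI impI, elim conjE)
  note [measurable (raw)] = V_measurable[OF s]
  fix x :: "nat \<Rightarrow> real \<times> real"
  assume x: "\<forall>n. x n \<in> survival" "x \<longlonglongrightarrow> (y0, d0)"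
  have lim: "(\<lambda>n. fst (x n)) \<longlonglongrightarrow> y0" "(\<lambda>n. snd (x n)) \<longlonglongrightarrow> d0"
    using tendsto_fst[OF x(2)] tendsto_snd[OF x(2)] by auto
  have "(\<lambda>n. avg (\<lambda>z. V s (fst (x n) - z) (snd (x n)))) \<longlonglongrightarrow> avg (\<lambda>z. V s (y0 - z) d0)"
  proof (rule avg_tendsto[where B = 1])
    have "AE z in lborel. z \<noteq> y0 - a1" by (rule AE_lborel_singleton)
    then show "AE z in lborel. 0 \<le> z \<longrightarrow> (\<lambda>n. V s (fst (x n) - z) (snd (x n))) \<longlonglongrightarrow> V s (y0 - z) d0"
    proof eventually_elim
      case (elim z)
      have l: "(\<lambda>n. fst (x n) - z) \<longlonglongrightarrow> y0 - z" using lim by (intro tendsto_intros)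
      show ?case
      proof (cases "y0 - z < a1")
        case True
        have "\<forall>\<^sub>F n in sequentially. fst (x n) - z < a1" using l True by (rule order_tendstoD(2))
        then have "\<forall>\<^sub>F n in sequentially. V s (fst (x n) - z) (snd (x n)) = V s (y0 - z) d0"
          by eventually_elim (use True V_ruin[OF s] in simp)
        then show ?thesis by (auto intro: tendsto_eventually)
      next
        case False
        then have yz: "a1 < y0 - z" using elim by simp
        then have up: "(y0 - z, d0) \<in> upper" using p0 by (simp add: upper_def)
        have "\<forall>\<^sub>F n in sequentially. a1 < fst (x n) - z" using l yz by (rule order_tendstoD(1))
        moreover have "(\<lambda>n. fst (x n) - z + snd (x n)) \<longlonglongrightarrow> y0 - z + d0" using l lim by (intro tendsto_intros)
        then have "\<forall>\<^sub>F n in sequentially. a2 < fst (x n) - z + snd (x n)"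
          by (rule order_tendstoD(1)) (use yz p0 in \<open>auto simp: upper_def\<close>)
        ultimately have "\<forall>\<^sub>F n in sequentially. (fst (x n) - z, snd (x n)) \<in> survival"
          by eventually_elim (simp add: survival_def)
        then have "(\<lambda>n. V s (fst (fst (x n) - z, snd (x n))) (snd (fst (x n) - z, snd (x n)))) \<longlonglongrightarrow> V s (fst (y0 - z, d0)) (snd (y0 - z, d0))"
          by (rule continuous_within_tendsto_compose[OF V_continuous[OF up]]) (use l lim in \<open>auto intro: tendsto_Pair\<close>)
        then show ?thesis by simp
      qed
    qed
  qed (use V_abs[OF s] in auto)
  then show "(\<lambda>n. G s (fst (x n)) (snd (x n))) \<longlonglongrightarrow> G s (fst (y0, d0)) (snd (y0, d0))"
    unfolding G_def by simp
qed

text \<open>Sliding to abscissa y0 writes V as a function of the single variable d y0 / y, plus a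
  logarithmic flow term, plus an error that is flat to first order. The derivative of V in d is
  therefore needed on the abscissa y0 only, and no continuity of partial derivatives has to be
  shown.\<close>

lemma V_frechet:
  assumes p0: "(y0, d0) \<in> upper"
  shows "\<exists>a b. ((\<lambda>p. V s (fst p) (snd p)) has_derivative (\<lambda>h. a * fst h + b * snd h)) (at (y0, d0) within upper)
    \<and> r * (y0 * a + d0 * b) = (lam + s) * V s y0 d0 - lam * G s y0 d0"
proof -
  have y0: "a1 \<le> y0" "a2 - a1 \<le> d0" "0 < y0" using p0 a2 a12 by (auto simp: upper_def)
  define N where "N p = V s (fst p) (snd p)" for p
  define g where "g p = G s (fst p) (snd p)" for p
  define L where "L = (lam + s) * V s y0 d0 - lam * G s y0 d0"
  note [measurable (raw)] = G_measurable[OF s]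
  have E: "((\<lambda>p. N p - N (y0, snd p * y0 / fst p) - ln (fst p / y0) / r * ((lam + s) * N (y0, d0) - lam * g (y0, d0)))
    has_derivative (\<lambda>_. 0)) (at (y0, d0) within upper)"
  \<comment> \<open>The larger set must be invariant under the flow and contain the slid points;
    \<open>upper\<close> is neither invariant nor closed under sliding.\<close>
  proof (rule flow_first_order[where A = survival and g = g])
    show "0 < lam + s" by (rule b_pos[OF s])
    show "N (y, d) = tint lam (lam + s) {0..h} (\<lambda>t. g (exp (r * t) * y, exp (r * t) * d)) +
        exp (- (lam + s) * h) * N (exp (r * h) * y, exp (r * h) * d)"
      if "(y, d) \<in> survival" "0 \<le> h" for y d h
      unfolding N_def g_def fst_conv snd_conv using that by (intro V_flow[OF s]) (auto simp: survival_def)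
    show "(exp (r * h) * y, exp (r * h) * d) \<in> survival" if "(y, d) \<in> survival" "0 \<le> h" for y d h
      using flow_S[OF s, of y d h] that by (simp add: survival_def)
    show "(\<lambda>t. g (exp (r * t) * y, exp (r * t) * d)) \<in> borel_measurable borel" for y d
      unfolding g_def fst_conv snd_conv by measurable
    show "\<bar>g p\<bar> \<le> 1" "\<bar>N p\<bar> \<le> 1" for p unfolding g_def N_def by (rule G_abs[OF s], rule V_abs[OF s])
    show "0 < y" if "(y, d) \<in> survival" for y d using that a2 a12 by (simp add: survival_def)
    show "upper \<subseteq> survival" by (rule upper_survival)
    show "(y0, d0) \<in> survival" using p0 upper_survival by blast
    show "(y0, d * y0 / y) \<in> survival" if "(y, d) \<in> upper" for y d
      using upper_to_y0[OF that y0(1)] y0 by (simp add: survival_def)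
    show "continuous (at (y0, d0) within survival) N" unfolding N_def[abs_def] by (rule V_continuous[OF p0])
    show "continuous (at (y0, d0) within survival) g" unfolding g_def[abs_def] by (rule G_continuous[OF p0])
  qed
  obtain D where D: "(V s y0 has_real_derivative D) (at d0 within {a2 - y0..})"
    using V_deriv[OF s y0(1,2)] by blast
  define \<delta> where "\<delta> p = snd p * y0 / fst p" for p
  have \<delta>: "(\<delta> has_derivative (\<lambda>h. snd h - d0 / y0 * fst h)) (at (y0, d0) within upper)"
    unfolding \<delta>_def[abs_def] using y0
    by (auto intro!: derivative_eq_intros simp: fun_eq_iff field_simps)
  have "(V s y0 has_derivative (*) D) (at (\<delta> (y0, d0)) within \<delta> ` upper)"
  proof (rule has_derivative_subset)
    show "(V s y0 has_derivative (*) D) (at (\<delta> (y0, d0)) within {a2 - y0..})"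
      using D y0 by (simp add: has_field_derivative_def \<delta>_def)
    show "\<delta> ` upper \<subseteq> {a2 - y0..}"
      using upper_to_y0[OF _ y0(1)] by (force simp: \<delta>_def)
  qed
  from has_derivative_in_compose[OF \<delta> this]
  have C: "((\<lambda>p. N (y0, snd p * y0 / fst p)) has_derivative (\<lambda>h. D * (snd h - d0 / y0 * fst h))) (at (y0, d0) within upper)"
    by (simp add: N_def \<delta>_def)
  have T: "((\<lambda>p. ln (fst p / y0) / r * L) has_derivative (\<lambda>h. L / (r * y0) * fst h)) (at (y0, d0) within upper)"
    using y0 r by (auto intro!: derivative_eq_intros simp: fun_eq_iff field_simps)
  have "((\<lambda>p. (N p - N (y0, snd p * y0 / fst p) - ln (fst p / y0) / r * L) + N (y0, snd p * y0 / fst p) + ln (fst p / y0) / r * L)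
      has_derivative (\<lambda>h. 0 + D * (snd h - d0 / y0 * fst h) + L / (r * y0) * fst h)) (at (y0, d0) within upper)"
    using E unfolding L_def by (intro has_derivative_add C T[unfolded L_def]) (simp add: N_def g_def)
  moreover have "(\<lambda>h. 0 + D * (snd h - d0 / y0 * fst h) + L / (r * y0) * fst h)
      = (\<lambda>h :: real \<times> real. (L / (r * y0) - D * d0 / y0) * fst h + D * snd h)"
    by (simp add: fun_eq_iff algebra_simps)
  ultimately have "((\<lambda>p. V s (fst p) (snd p)) has_derivative (\<lambda>h. (L / (r * y0) - D * d0 / y0) * fst h + D * snd h)) (at (y0, d0) within upper)"
    by (simp add: N_def)
  \<comment> \<open>\<open>d * y0 / y\<close> is homogeneous of degree 0, so its derivative in the
    direction (y0, d0) vanishes and only the logarithmic term contributes.\<close>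
  moreover have "r * (y0 * (L / (r * y0) - D * d0 / y0) + d0 * D) = L"
    using y0 r by (simp add: field_simps)
  ultimately show ?thesis unfolding L_def by blast
qed

end

end

section \<open>Ruin times of a path\<close>

text \<open>Discount factor at the first time in A. The case distinction encodes an infinite ruin
  time, for which the real-valued \<open>Inf\<close> has no meaningful value.\<close>

definition disc :: "real \<Rightarrow> real set \<Rightarrow> real" where
  "disc s A = (if A = {} then 0 else exp (- s * Inf A))"

context
  fixes s :: real assumes s: "0 < s"
begin

lemma disc_nonneg: "0 \<le> disc s A" by (simp add: disc_def)

lemma disc_ge: "(\<And>t. t \<in> A \<Longrightarrow> T \<le> t) \<Longrightarrow> disc s A \<le> exp (- s * T)"
  using s by (auto simp: disc_def intro!: cInf_greatest mult_left_mono)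

lemma disc_le_1: "A \<subseteq> {0..} \<Longrightarrow> disc s A \<le> 1"
  using disc_ge[of A 0] by auto

lemma disc_mono:
  assumes "A \<subseteq> B" "B \<subseteq> {0..}" shows "disc s A \<le> disc s B"
proof (cases "A = {}")
  case True
  then show ?thesis by (simp add: disc_def)
next
  case False
  then have "Inf B \<le> Inf A" using assms by (intro cInf_superset_mono) (auto simp: bdd_below_def)
  then show ?thesis using False assms s by (auto simp: disc_def)
qed

lemma disc_eq_1:
  assumes "0 \<in> A" "A \<subseteq> {0..}" shows "disc s A = 1"
proof -
  have "Inf A = 0" using assms by (intro cInf_eq_minimum) auto
  then show ?thesis using assms by (auto simp: disc_def)
qed

lemma disc_translate:
  assumes "A \<subseteq> {0..}" shows "disc s ((+) c ` A) = exp (- s * c) * disc s A"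
proof (cases "A = {}")
  case False
  have "bdd_below A" using assms by (auto simp: bdd_below_def)
  have "Inf ((+) c ` A) = c + Inf A"
  proof (rule cInf_eq_non_empty)
    show "(+) c ` A \<noteq> {}" using False by simp
    show "c + Inf A \<le> x" if "x \<in> (+) c ` A" for x
      using that \<open>bdd_below A\<close> by (auto intro: cInf_lower)
    show "x \<le> c + Inf A" if "\<And>t. t \<in> (+) c ` A \<Longrightarrow> x \<le> t" for x
    proof -
      have "x - c \<le> Inf A"
      proof (rule cInf_greatest[OF False])
        fix t assume "t \<in> A"
        then show "x - c \<le> t" using that[of "c + t"] by simp
      qed
      then show ?thesis by simp
    qed
  qed
  then show ?thesis using False by (simp add: disc_def exp_add[symmetric] algebra_simps)
qed (simp add: disc_def)

text \<open>If some point of A precedes T, the infimum is decided before T, where A and A0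
  agree.\<close>

lemma disc_split:
  assumes "A0 \<subseteq> A" "A \<subseteq> {0..}" and "\<And>t. t \<in> A \<Longrightarrow> t < T \<Longrightarrow> t \<in> A0"
  shows "disc s A = disc s A0 \<or> disc s A \<le> exp (- s * T)"
proof (cases "\<forall>t\<in>A. T \<le> t")
  case False
  then obtain t0 where t0: "t0 \<in> A" "t0 < T" "t0 \<in> A0" using assms(3) by force
  have bdd: "bdd_below A" "bdd_below A0" using assms by (auto simp: bdd_below_def)
  have "Inf A0 \<le> Inf A"
  proof (rule cInf_greatest)
    fix t assume "t \<in> A"
    show "Inf A0 \<le> t"
    proof (cases "t < T")
      case True
      then show ?thesis using assms(3)[OF \<open>t \<in> A\<close>] bdd by (auto intro: cInf_lower)
    next
      case False
      then show ?thesis using cInf_lower[OF t0(3) bdd(2)] t0(2) by simp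
    qed
  qed (use t0 in auto)
  moreover have "Inf A \<le> Inf A0" using t0 bdd assms by (intro cInf_superset_mono) auto
  ultimately have "Inf A = Inf A0" by simp
  then show ?thesis using t0 by (auto simp: disc_def)
qed (use disc_ge in auto)

lemma disc_double: "disc s A = (disc (s / 2) A)\<^sup>2"
  by (simp add: disc_def exp_double[symmetric])

lemma laplace_integrand:
  assumes "A \<subseteq> {0..}"
  shows "(if Inf (ereal ` A) = \<infinity> then 0 else exp (- s * real_of_ereal (Inf (ereal ` A)))) = disc s A"
proof (cases "A = {}")
  case False
  have "bdd_below A" using assms by (auto simp: bdd_below_def)
  then have "Inf (ereal ` A) = ereal (Inf A)" using False by (simp add: ereal_Inf')
  then show ?thesis using False by (simp add: disc_def)
qed (simp add: disc_def top_ereal_def)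

end

section \<open>Ruin of a path in scaled coordinates\<close>

definition claims :: "real \<Rightarrow> (nat \<Rightarrow> 'a \<Rightarrow> real) \<Rightarrow> (nat \<Rightarrow> 'a \<Rightarrow> real) \<Rightarrow> real \<Rightarrow> 'a \<Rightarrow> real" where
  "claims r E \<sigma> t \<omega> = (\<Sum>k | arrival E k \<omega> \<le> t. exp (r * (t - arrival E k \<omega>)) * \<sigma> k \<omega>)"

text \<open>After scaling, both lines are charged with the same accumulated claims; they differ only
  in their starting levels and in the constant thresholds a1 and a2 (see
  \<open>surplus_neg_iff\<close>).\<close>

definition ruin_set :: "real \<Rightarrow> real \<Rightarrow> real \<Rightarrow> (nat \<Rightarrow> 'a \<Rightarrow> real) \<Rightarrow> (nat \<Rightarrow> 'a \<Rightarrow> real)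
    \<Rightarrow> real \<Rightarrow> real \<Rightarrow> 'a \<Rightarrow> real set" where
  "ruin_set r a1 a2 E \<sigma> y d \<omega> = {t. 0 \<le> t \<and>
     (exp (r * t) * y < a1 + claims r E \<sigma> t \<omega> \<or> exp (r * t) * (y + d) < a2 + claims r E \<sigma> t \<omega>)}"

lemma ruin_set_nonneg: "ruin_set r a1 a2 E \<sigma> y d \<omega> \<subseteq> {0..}"
  by (auto simp: ruin_set_def)

lemma surplus_neg_iff:
  assumes "0 < r" "0 < \<delta>"
  shows "surplus r c \<delta> u E \<sigma> t \<omega> < 0 \<longleftrightarrow>
    exp (r * t) * (u / \<delta> + c / (\<delta> * r)) < c / (\<delta> * r) + claims r E \<sigma> t \<omega>"
proof -
  have "surplus r c \<delta> u E \<sigma> t \<omega>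
    = \<delta> * (exp (r * t) * (u / \<delta> + c / (\<delta> * r)) - (c / (\<delta> * r) + claims r E \<sigma> t \<omega>))"
    unfolding surplus_def claims_def using assms by (simp add: field_simps)
  then show ?thesis using assms by (simp add: mult_less_0_iff)
qed

lemma arrival_Suc: "arrival E (Suc k) \<omega> = E 0 \<omega> + arrival (\<lambda>j. E (Suc j)) k \<omega>"
  unfolding arrival_def by (rule sum.atMost_Suc_shift)

lemma claims_before:
  assumes "\<And>k. 0 < E k \<omega>" "t < E 0 \<omega>"
  shows "claims r E \<sigma> t \<omega> = 0"
proof -
  have "E 0 \<omega> \<le> arrival E k \<omega>" for k
  proof (cases k)
    case (Suc j)
    have "0 \<le> arrival (\<lambda>j. E (Suc j)) j \<omega>"
      unfolding arrival_def by (intro sum_nonneg) (use assms in \<open>auto simp: less_imp_le\<close>)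
    then show ?thesis unfolding Suc arrival_Suc by simp
  qed (simp add: arrival_def)
  then have "\<not> arrival E k \<omega> \<le> t" for k using assms(2) by (simp add: not_le less_le_trans)
  then have "{k. arrival E k \<omega> \<le> t} = {}" by blast
  then show ?thesis by (simp add: claims_def)
qed

lemma claims_after:
  assumes "finite {k. arrival E k \<omega> \<le> t}" "E 0 \<omega> \<le> t"
  shows "claims r E \<sigma> t \<omega> = exp (r * (t - E 0 \<omega>)) * \<sigma> 0 \<omega>
    + claims r (\<lambda>j. E (Suc j)) (\<lambda>j. \<sigma> (Suc j)) (t - E 0 \<omega>) \<omega>"
proof -
  let ?K = "{k. arrival (\<lambda>j. E (Suc j)) k \<omega> \<le> t - E 0 \<omega>}"
  have K: "{k. arrival E k \<omega> \<le> t} = insert 0 (Suc ` ?K)"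
  proof (intro set_eqI)
    fix k show "k \<in> {k. arrival E k \<omega> \<le> t} \<longleftrightarrow> k \<in> insert 0 (Suc ` ?K)"
      using assms(2) by (cases k) (auto simp: arrival_Suc arrival_def[of E 0])
  qed
  then have "finite (Suc ` ?K)" using assms(1) by simp
  then show ?thesis
    unfolding claims_def K
    by (subst sum.insert) (auto simp: sum.reindex arrival_Suc arrival_def[of E 0] algebra_simps)
qed

lemma ruin_set_at_0:
  assumes "\<And>k. 0 < E k \<omega>" "y < a1 \<or> y + d < a2"
  shows "0 \<in> ruin_set r a1 a2 E \<sigma> y d \<omega>"
  using claims_before[of E \<omega> 0] assms by (auto simp: ruin_set_def)

text \<open>Before the first claim the flow only moves a surviving point outwards. Afterwards the
  accumulated first claim can be subtracted from the starting level, which restarts the path at the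
  point reached by flow and jump.\<close>

lemma ruin_set_first_claim:
  assumes r: "0 < r" and a: "0 < a1" "0 < a2" and E: "\<And>k. 0 < E k \<omega>" and fin: "\<And>t. finite {k. arrival E k \<omega> \<le> t}"
    and surv: "a1 \<le> y" "a2 \<le> y + d"
  shows "ruin_set r a1 a2 E \<sigma> y d \<omega> = (+) (E 0 \<omega>) ` ruin_set r a1 a2 (\<lambda>j. E (Suc j)) (\<lambda>j. \<sigma> (Suc j))
    (exp (r * E 0 \<omega>) * y - \<sigma> 0 \<omega>) (exp (r * E 0 \<omega>) * d) \<omega>"
proof (intro set_eqI)
  fix t
  let ?C = "claims r (\<lambda>j. E (Suc j)) (\<lambda>j. \<sigma> (Suc j)) (t - E 0 \<omega>) \<omega>"
  let ?B = "ruin_set r a1 a2 (\<lambda>j. E (Suc j)) (\<lambda>j. \<sigma> (Suc j)) (exp (r * E 0 \<omega>) * y - \<sigma> 0 \<omega>) (exp (r * E 0 \<omega>) * d) \<omega>"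
  have im: "t \<in> (+) (E 0 \<omega>) ` ?B \<longleftrightarrow> t - E 0 \<omega> \<in> ?B"
    by (auto simp: image_iff intro: bexI[of _ "t - E 0 \<omega>"])
  show "t \<in> ruin_set r a1 a2 E \<sigma> y d \<omega> \<longleftrightarrow> t \<in> (+) (E 0 \<omega>) ` ?B"
  proof (cases "t < E 0 \<omega>")
    case True
    have "t \<notin> ruin_set r a1 a2 E \<sigma> y d \<omega>"
    proof
      assume t: "t \<in> ruin_set r a1 a2 E \<sigma> y d \<omega>"
      then have "1 \<le> exp (r * t)" using r by (simp add: ruin_set_def)
      then have "1 * y \<le> exp (r * t) * y" "1 * (y + d) \<le> exp (r * t) * (y + d)"
        using surv a by (auto intro!: mult_right_mono simp del: mult_1)
      then show False using t surv claims_before[of E \<omega> t r \<sigma>, OF E True] by (auto simp: ruin_set_def)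
    qed
    moreover have "t - E 0 \<omega> \<notin> ?B" using True by (simp add: ruin_set_def)
    ultimately show ?thesis unfolding im by simp
  next
    case False
    have c: "claims r E \<sigma> t \<omega> = exp (r * (t - E 0 \<omega>)) * \<sigma> 0 \<omega> + ?C"
      by (rule claims_after) (use fin False in auto)
    have e: "exp (r * t) = exp (r * (t - E 0 \<omega>)) * exp (r * E 0 \<omega>)"
      by (simp add: exp_add[symmetric] algebra_simps)
    have "exp (r * t) * y < a1 + claims r E \<sigma> t \<omega> \<longleftrightarrow> exp (r * (t - E 0 \<omega>)) * (exp (r * E 0 \<omega>) * y - \<sigma> 0 \<omega>) < a1 + ?C"
      unfolding c e by (simp add: algebra_simps)
    moreover have "exp (r * t) * (y + d) < a2 + claims r E \<sigma> t \<omega> \<longleftrightarrow>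
        exp (r * (t - E 0 \<omega>)) * ((exp (r * E 0 \<omega>) * y - \<sigma> 0 \<omega>) + exp (r * E 0 \<omega>) * d) < a2 + ?C"
      unfolding c e by (simp add: algebra_simps)
    ultimately show ?thesis unfolding im using False E[of 0] by (auto simp: ruin_set_def)
  qed
qed

text \<open>Exceptional paths (accumulating or unordered arrivals) are included, where an infinite sum of
  claims counts as 0; this makes the ruin time measurable without completing the measure.\<close>
lemma ruin_set_countable_approx:
  assumes t: "t \<in> ruin_set r a1 a2 E \<sigma> y d \<omega>" and \<eta>: "0 < \<eta>"
  shows "\<exists>t'\<in>ruin_set r a1 a2 E \<sigma> y d \<omega>. t' < t + \<eta> \<and> (t' \<in> \<rat> \<or> t' \<in> range (\<lambda>k. arrival E k \<omega>))"
proof (cases "t \<in> \<rat> \<or> t \<in> range (\<lambda>k. arrival E k \<omega>)")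
  case True
  then show ?thesis using t \<eta> by (intro bexI[of _ t]) auto
next
  case False
  then have t0: "0 < t" "t \<notin> range (\<lambda>k. arrival E k \<omega>)" using t by (force simp: ruin_set_def less_le)+
  define K where "K = {k. arrival E k \<omega> \<le> t}"
  define S where "S x = (\<Sum>k\<in>K. exp (r * (x - arrival E k \<omega>)) * \<sigma> k \<omega>)" for x
  have S: "isCont S x" for x unfolding S_def[abs_def] by (intro continuous_intros)
  have lim: "((\<lambda>x. exp (r * x) * y - (a1 + S x)) \<longlongrightarrow> exp (r * t) * y - (a1 + S t)) (at t)"
     "((\<lambda>x. exp (r * x) * (y + d) - (a2 + S x)) \<longlongrightarrow> exp (r * t) * (y + d) - (a2 + S t)) (at t)"
    using S[of t] unfolding isCont_def by (intro tendsto_intros; simp)+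
  have "exp (r * t) * y - (a1 + S t) < 0 \<or> exp (r * t) * (y + d) - (a2 + S t) < 0"
    using t by (auto simp: ruin_set_def claims_def S_def K_def)
  then have "(\<forall>\<^sub>F x in at t. exp (r * x) * y - (a1 + S x) < 0) \<or> (\<forall>\<^sub>F x in at t. exp (r * x) * (y + d) - (a2 + S x) < 0)"
    using order_tendstoD(2)[OF lim(1)] order_tendstoD(2)[OF lim(2)] by blast
  then have "\<forall>\<^sub>F x in at t. exp (r * x) * y - (a1 + S x) < 0 \<or> exp (r * x) * (y + d) - (a2 + S x) < 0"
    by (auto elim: eventually_mono)
  then obtain \<delta> where \<delta>: "0 < \<delta>" "\<And>x. x \<noteq> t \<Longrightarrow> \<bar>x - t\<bar> < \<delta> \<Longrightarrow>
      exp (r * x) * y < a1 + S x \<or> exp (r * x) * (y + d) < a2 + S x"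
    by (auto simp: eventually_at dist_real_def)
  \<comment> \<open>If finitely many claims have arrived by t, none of them arrives exactly at t, so
    the same claims have arrived throughout an interval just before t. If infinitely many have
    arrived, the sum is 0 at t and at all later times, so an interval after t serves.\<close>
  obtain lo hi where int: "lo < hi" "t - \<delta> \<le> lo" "0 \<le> lo" "hi \<le> t + \<delta>" "hi \<le> t + \<eta>" "t \<le> lo \<or> hi \<le> t"
    and C: "\<And>x. lo < x \<Longrightarrow> x < hi \<Longrightarrow> claims r E \<sigma> x \<omega> = S x"
  proof (cases "finite K")
    case True
    define m where "m = Max (insert 0 ((\<lambda>k. arrival E k \<omega>) ` K))"
    have "arrival E k \<omega> < t" if "k \<in> K" for k
    proof -
      have "arrival E k \<omega> \<noteq> t" using t0(2) by blast
      then show ?thesis using that by (simp add: K_def)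
    qed
    then have "m < t" unfolding m_def using True t0(1) by (subst Max_less_iff) auto
    have m: "0 \<le> m" "\<And>k. k \<in> K \<Longrightarrow> arrival E k \<omega> \<le> m" unfolding m_def using True by auto
    show ?thesis
    proof (rule that[of "max m (t - \<delta>)" t])
      fix x assume "max m (t - \<delta>) < x" "x < t"
      then have "{k. arrival E k \<omega> \<le> x} = K" using m by (force simp: K_def)
      then show "claims r E \<sigma> x \<omega> = S x" by (simp add: claims_def S_def)
    qed (use \<open>m < t\<close> m \<delta> \<eta> in auto)
  next
    case False
    show ?thesis
    proof (rule that[of t "t + min \<delta> \<eta>"])
      fix x assume "t < x"
      then have "K \<subseteq> {k. arrival E k \<omega> \<le> x}" by (auto simp: K_def)
      then have "infinite {k. arrival E k \<omega> \<le> x}" using False finite_subset by blast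
      then show "claims r E \<sigma> x \<omega> = S x" using False by (simp add: claims_def S_def)
    qed (use \<delta> \<eta> t0 in auto)
  qed
  obtain q where q: "q \<in> \<rat>" "lo < q" "q < hi" using Rats_dense_in_real[OF int(1)] by blast
  have "q \<noteq> t" "\<bar>q - t\<bar> < \<delta>" using q int by auto
  then have "q \<in> ruin_set r a1 a2 E \<sigma> y d \<omega>"
    using \<delta>(2)[of q] C[OF q(2,3)] q int by (simp add: ruin_set_def)
  then show ?thesis using q int by (intro bexI[of _ q]) auto
qed

section \<open>The renewal equation for the ruin model\<close>

lemma (in prob_space) indep_var_integral:
  fixes h :: "'b \<times> 'b \<Rightarrow> real"
  assumes ind: "indep_var S U T W" and h [measurable]: "h \<in> borel_measurable (S \<Otimes>\<^sub>M T)"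
    and B: "\<And>p. \<bar>h p\<bar> \<le> B"
  shows "(\<integral>\<omega>. h (U \<omega>, W \<omega>) \<partial>M) = (\<integral>\<omega>'. (\<integral>\<omega>. h (U \<omega>', W \<omega>) \<partial>M) \<partial>M)"
proof -
  have rv [measurable]: "U \<in> measurable M S" "W \<in> measurable M T"
    using ind by (blast dest: indep_var_rv1 indep_var_rv2)+
  interpret U: prob_space "distr M S U" by (rule prob_space_distr) fact
  interpret W: prob_space "distr M T W" by (rule prob_space_distr) fact
  interpret P: pair_prob_space "distr M S U" "distr M T W" ..
  have int: "integrable (distr M S U \<Otimes>\<^sub>M distr M T W) h"
    by (rule P.integrable_const_bound[where B = B]) (use B in auto)
  have "(\<integral>\<omega>. h (U \<omega>, W \<omega>) \<partial>M) = integral\<^sup>L (distr M (S \<Otimes>\<^sub>M T) (\<lambda>x. (U x, W x))) h"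
    by (subst integral_distr) auto
  also have "distr M (S \<Otimes>\<^sub>M T) (\<lambda>x. (U x, W x)) = distr M S U \<Otimes>\<^sub>M distr M T W"
    using ind by (simp add: indep_var_distribution_eq)
  also have "integral\<^sup>L (distr M S U \<Otimes>\<^sub>M distr M T W) h = (\<integral>u. (\<integral>w. h (u, w) \<partial>distr M T W) \<partial>distr M S U)"
    by (rule P.integral_fst'[OF int, symmetric])
  also have "\<dots> = (\<integral>u. (\<integral>\<omega>. h (u, W \<omega>) \<partial>M) \<partial>distr M S U)"
    by (rule Bochner_Integration.integral_cong) (auto intro!: integral_distr)
  also have "\<dots> = (\<integral>\<omega>'. (\<integral>\<omega>. h (U \<omega>', W \<omega>) \<partial>M) \<partial>M)"
    by (rule integral_distr) auto
  finally show ?thesis .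
qed

definition regular_path :: "(nat \<Rightarrow> 'a \<Rightarrow> real) \<Rightarrow> (nat \<Rightarrow> 'a \<Rightarrow> real) \<Rightarrow> 'a \<Rightarrow> bool" where
  "regular_path E \<sigma> \<omega> \<longleftrightarrow> (\<forall>k. 0 < E k \<omega>) \<and> (\<forall>k. 0 \<le> \<sigma> k \<omega>) \<and> (\<forall>t. finite {k. arrival E k \<omega> \<le> t})"

lemma regular_path_Suc:
  assumes "regular_path E \<sigma> \<omega>"
  shows "regular_path (\<lambda>j. E (Suc j)) (\<lambda>j. \<sigma> (Suc j)) \<omega>"
proof -
  have "{k. arrival (\<lambda>j. E (Suc j)) k \<omega> \<le> t} = Suc -` {k. arrival E k \<omega> \<le> t + E 0 \<omega>}" for t
    by (auto simp: arrival_Suc)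
  moreover have "finite (Suc -` {k. arrival E k \<omega> \<le> t + E 0 \<omega>})" for t
    using assms unfolding regular_path_def by (intro finite_vimageI) auto
  ultimately show ?thesis using assms unfolding regular_path_def by simp
qed

lemma regular_path_shift:
  "regular_path E \<sigma> \<omega> \<Longrightarrow> regular_path (\<lambda>j. E (j + k)) (\<lambda>j. \<sigma> (j + k)) \<omega>"
proof (induction k)
  case (Suc k)
  from regular_path_Suc[OF Suc.IH[OF Suc.prems]] show ?case by simp
qed simp

section \<open>Measurability and almost sure regularity of the paths\<close>

locale risk = prob_space M + claim_density f for M :: "'a measure" and f +
  fixes r lam a1 a2 :: real and E \<sigma> :: "nat \<Rightarrow> 'a \<Rightarrow> real"
  assumes r: "0 < r" and lam: "0 < lam" and a2: "0 < a2" and a12: "a2 < a1"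
    and indep: "indep_vars (\<lambda>_. borel) (\<lambda>i. case i of Inl k \<Rightarrow> E k | Inr k \<Rightarrow> \<sigma> k) UNIV"
    and E_dist: "\<And>k. distributed M lborel (E k) (\<lambda>x. ennreal (exponential_density lam x))"
    and \<sigma>_dist: "\<And>k. distributed M lborel (\<sigma> k) (\<lambda>x. ennreal (f x))"
begin

abbreviation ruin_times :: "real \<Rightarrow> real \<Rightarrow> 'a \<Rightarrow> real set" where
  "ruin_times \<equiv> ruin_set r a1 a2 E \<sigma>"

definition V :: "real \<Rightarrow> real \<Rightarrow> real \<Rightarrow> real" where
  "V s y d = (\<integral>\<omega>. disc s (ruin_times y d \<omega>) \<partial>M)"

text \<open>The path as one point of a product space, so that independence of blocks of indices can
  be used for functionals of the path.\<close>

definition X :: "'a \<Rightarrow> nat + nat \<Rightarrow> real" where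
  "X \<omega> i = (case i of Inl k \<Rightarrow> E k \<omega> | Inr k \<Rightarrow> \<sigma> k \<omega>)"

lemma E_measurable [measurable]: "E k \<in> borel_measurable M"
  using distributed_measurable[OF E_dist[of k]] by simp

lemma \<sigma>_measurable [measurable]: "\<sigma> k \<in> borel_measurable M"
  using distributed_measurable[OF \<sigma>_dist[of k]] by simp

lemma X_measurable [measurable]: "(\<lambda>\<omega>. X \<omega> i) \<in> borel_measurable M"
  unfolding X_def by (cases i) auto

lemma arrival_measurable [measurable]: "arrival E k \<in> borel_measurable M"
  unfolding arrival_def[abs_def] by measurable

text \<open>The random index set is turned into a series with indicator-like terms. The guard
  reproduces the value 0 of a sum over an infinite set; under it the series has finitely many
  nonzero terms.\<close>

lemma claims_measurable [measurable (raw)]: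
  assumes [measurable]: "g \<in> borel_measurable M"
  shows "(\<lambda>\<omega>. claims r E \<sigma> (g \<omega>) \<omega>) \<in> borel_measurable M"
proof -
  have eq: "claims r E \<sigma> (g \<omega>) \<omega> = (if \<exists>N. \<forall>k. N \<le> k \<longrightarrow> \<not> arrival E k \<omega> \<le> g \<omega>
      then \<Sum>k. (if arrival E k \<omega> \<le> g \<omega> then exp (r * (g \<omega> - arrival E k \<omega>)) * \<sigma> k \<omega> else 0) else 0)" for \<omega>
  proof -
    let ?K = "{k. arrival E k \<omega> \<le> g \<omega>}"
    have fin: "finite ?K \<longleftrightarrow> (\<exists>N. \<forall>k. N \<le> k \<longrightarrow> \<not> arrival E k \<omega> \<le> g \<omega>)"
      unfolding finite_nat_set_iff_bounded by (auto simp: not_le[symmetric])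
    show ?thesis
    proof (cases "finite ?K")
      case True
      then have "(\<Sum>k. (if arrival E k \<omega> \<le> g \<omega> then exp (r * (g \<omega> - arrival E k \<omega>)) * \<sigma> k \<omega> else 0))
        = (\<Sum>k\<in>?K. (if arrival E k \<omega> \<le> g \<omega> then exp (r * (g \<omega> - arrival E k \<omega>)) * \<sigma> k \<omega> else 0))"
        by (intro suminf_finite) auto
      also have "\<dots> = claims r E \<sigma> (g \<omega>) \<omega>" unfolding claims_def by (intro sum.cong) auto
      finally show ?thesis using True fin by simp
    next
      case False
      then have n: "\<not> (\<exists>N. \<forall>k. N \<le> k \<longrightarrow> \<not> arrival E k \<omega> \<le> g \<omega>)" unfolding fin .
      have "claims r E \<sigma> (g \<omega>) \<omega> = 0" using False by (simp add: claims_def)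
      then show ?thesis by (simp only: n if_False)
    qed
  qed
  show ?thesis unfolding eq by measurable
qed

lemma ruin_times_measurable [measurable (raw)]:
  assumes [measurable]: "g \<in> borel_measurable M"
  shows "Measurable.pred M (\<lambda>\<omega>. g \<omega> \<in> ruin_times y d \<omega>)"
  unfolding ruin_set_def mem_Collect_eq by measurable

text \<open>Rational times and arrival times approximate the infimum, by
  \<open>ruin_set_countable_approx\<close>, which makes it a countable infimum of measurable
  functions.\<close>

lemma disc_measurable [measurable]:
  assumes s: "0 < s"
  shows "(\<lambda>\<omega>. disc s (ruin_times y d \<omega>)) \<in> borel_measurable M"
proof -
  let ?R = "\<lambda>\<omega>. INF q\<in>\<rat>. if q \<in> ruin_times y d \<omega> then ereal q else \<infinity>"
  let ?A = "\<lambda>\<omega>. INF k. if arrival E k \<omega> \<in> ruin_times y d \<omega> then ereal (arrival E k \<omega>) else \<infinity>"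
  have "Inf (ereal ` ruin_times y d \<omega>) = inf (?R \<omega>) (?A \<omega>)" for \<omega>
  proof (rule antisym)
    show "Inf (ereal ` ruin_times y d \<omega>) \<le> inf (?R \<omega>) (?A \<omega>)"
    proof (intro inf_greatest INF_greatest)
      show "Inf (ereal ` ruin_times y d \<omega>) \<le> (if q \<in> ruin_times y d \<omega> then ereal q else \<infinity>)" for q
        by (auto intro: INF_lower)
      show "Inf (ereal ` ruin_times y d \<omega>)
          \<le> (if arrival E k \<omega> \<in> ruin_times y d \<omega> then ereal (arrival E k \<omega>) else \<infinity>)" for k
        by (auto intro: INF_lower)
    qed
    show "inf (?R \<omega>) (?A \<omega>) \<le> Inf (ereal ` ruin_times y d \<omega>)"
    proof (rule INF_greatest)
      fix t assume t: "t \<in> ruin_times y d \<omega>"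
      show "inf (?R \<omega>) (?A \<omega>) \<le> ereal t"
      proof (rule ereal_le_epsilon2)
        fix \<eta> :: real assume "0 < \<eta>"
        then obtain t' where t': "t' \<in> ruin_times y d \<omega>" "t' < t + \<eta>" "t' \<in> \<rat> \<or> t' \<in> range (\<lambda>k. arrival E k \<omega>)"
          using ruin_set_countable_approx[OF t] by blast
        have "inf (?R \<omega>) (?A \<omega>) \<le> ereal t'"
          using t'(3)
        proof
          assume "t' \<in> \<rat>"
          then have "?R \<omega> \<le> ereal t'" using t'(1) by (intro INF_lower2[of t']) auto
          then show ?thesis by (rule le_infI1)
        next
          assume "t' \<in> range (\<lambda>k. arrival E k \<omega>)"
          then obtain k where "t' = arrival E k \<omega>" by blast
          then have "?A \<omega> \<le> ereal t'" using t'(1) by (intro INF_lower2[of k]) auto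
          then show ?thesis by (rule le_infI2)
        qed
        also have "ereal t' \<le> ereal t + ereal \<eta>" using t'(2) by simp
        finally show "inf (?R \<omega>) (?A \<omega>) \<le> ereal t + ereal \<eta>" .
      qed
    qed
  qed
  moreover have "(\<lambda>\<omega>. inf (?R \<omega>) (?A \<omega>)) \<in> borel_measurable M"
    using countable_rat by measurable
  ultimately have [measurable]: "(\<lambda>\<omega>. Inf (ereal ` ruin_times y d \<omega>)) \<in> borel_measurable M" by simp
  show ?thesis
    unfolding laplace_integrand[OF s ruin_set_nonneg, symmetric] by measurable
qed

lemma disc_integrable: "0 < s \<Longrightarrow> integrable M (\<lambda>\<omega>. disc s (ruin_times y d \<omega>))"
  by (rule integrable_const_bound[where B = 1])
    (auto simp: disc_nonneg disc_le_1 ruin_set_nonneg)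

lemma laplace_ruin_V:
  assumes "0 < s" "\<And>\<omega>. T \<omega> = Inf (ereal ` ruin_times y d \<omega>)"
  shows "laplace_ruin M s T = V s y d"
  unfolding laplace_ruin_def V_def assms(2)
  by (simp add: laplace_integrand[OF assms(1) ruin_set_nonneg])

lemma AE_E_pos: "AE \<omega> in M. \<forall>k. 0 < E k \<omega>"
proof (subst AE_all_countable, rule allI)
  fix k
  \<comment> \<open>The exponential density is positive at 0 as well; that point is removed as a
    null set.\<close>
  have "AE x in lborel. x \<noteq> (0::real)" by (rule AE_lborel_singleton)
  then have "AE x in lborel. 0 < ennreal (exponential_density lam x) \<longrightarrow> 0 < x"
    by eventually_elim (auto simp: exponential_density_def split: if_splits)
  then show "AE \<omega> in M. 0 < E k \<omega>"
    by (subst distributed_AE2[OF E_dist[of k], where P = "\<lambda>x. 0 < x"]) auto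
qed

lemma AE_\<sigma>_nonneg: "AE \<omega> in M. \<forall>k. 0 \<le> \<sigma> k \<omega>"
proof (subst AE_all_countable, rule allI)
  fix k
  have "AE x in lborel. 0 < ennreal (f x) \<longrightarrow> 0 \<le> x"
    by (rule AE_I2) (metis f_neg ennreal_0 less_irrefl not_le)
  then show "AE \<omega> in M. 0 \<le> \<sigma> k \<omega>"
    by (subst distributed_AE2[OF \<sigma>_dist[of k], where P = "\<lambda>x. 0 \<le> x"]) auto
qed

text \<open>Laplace transform at 1 of the Gamma law of an arrival time. Its geometric decay in n
  makes the expected sum of exp(-arrival) finite, so that almost surely the arrivals tend to
  infinity.\<close>

lemma nn_exp_arrival: "(\<integral>\<^sup>+\<omega>. ennreal (exp (- arrival E n \<omega>)) \<partial>M) = ennreal ((lam / (lam + 1)) ^ Suc n)"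
proof -
  have one: "(\<integral>\<^sup>+\<omega>. ennreal (exp (- E k \<omega>)) \<partial>M) = ennreal (lam / (lam + 1))" for k
  proof -
    have "(\<integral>\<^sup>+\<omega>. ennreal (exp (- E k \<omega>)) \<partial>M)
       = (\<integral>\<^sup>+x. ennreal (exponential_density lam x) * ennreal (exp (- x)) \<partial>lborel)"
      by (rule distributed_nn_integral[OF E_dist, symmetric]) measurable
    also have "\<dots> = (\<integral>\<^sup>+x. ennreal (indicator {0..} x * (lam * exp (- (lam + 1) * x))) \<partial>lborel)"
    proof (rule nn_integral_cong)
      fix x :: real
      have "exponential_density lam x * exp (- x) = indicator {0..} x * (lam * exp (- (lam + 1) * x))"
        by (auto simp: exponential_density_def indicator_def exp_add[symmetric] algebra_simps)
      then show "ennreal (exponential_density lam x) * ennreal (exp (- x)) = ennreal (indicator {0..} x * (lam * exp (- (lam + 1) * x)))"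
        using lam by (subst ennreal_mult[symmetric]) (auto simp: exponential_density_nonneg)
    qed
    also have "\<dots> = ennreal (lam / (lam + 1))"
      using exp_integral_Ici[of "lam + 1" lam] lam by (subst nn_integral_eq_integral) auto
    finally show ?thesis .
  qed
  let ?Z = "\<lambda>i \<omega>. ennreal (exp (- X \<omega> i))"
  have ind: "indep_vars (\<lambda>_. borel) ?Z (Inl ` {..n})"
  proof -
    have "indep_vars (\<lambda>_. borel) (\<lambda>i \<omega>. X \<omega> i) UNIV"
      using indep unfolding X_def by (rule indep_vars_cong[THEN iffD1, rotated 3]) (auto split: sum.split)
    then have "indep_vars (\<lambda>_. borel) ?Z UNIV"
      by (rule indep_vars_compose2) measurable
    then show ?thesis by (rule indep_vars_subset) simp
  qed
  have "(\<integral>\<^sup>+\<omega>. ennreal (exp (- arrival E n \<omega>)) \<partial>M) = (\<integral>\<^sup>+\<omega>. (\<Prod>i\<in>Inl ` {..n}. ?Z i \<omega>) \<partial>M)"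
    by (simp add: arrival_def X_def sum_negf[symmetric] exp_sum prod_ennreal prod.reindex)
  also have "\<dots> = (\<Prod>i\<in>Inl ` {..n}. \<integral>\<^sup>+\<omega>. ?Z i \<omega> \<partial>M)"
    by (rule indep_vars_nn_integral[OF _ ind]) auto
  also have "\<dots> = ennreal ((lam / (lam + 1)) ^ Suc n)"
    using lam by (simp add: prod.reindex X_def one ennreal_power del: power_Suc)
  finally show ?thesis .
qed

lemma AE_arrivals: "AE \<omega> in M. \<forall>t. finite {k. arrival E k \<omega> \<le> t}"
proof -
  define c where "c = lam / (lam + 1)"
  have c: "0 \<le> c" "c < 1" using lam by (auto simp: c_def)
  have "(\<integral>\<^sup>+\<omega>. (\<Sum>n. ennreal (exp (- arrival E n \<omega>))) \<partial>M) = (\<Sum>n. ennreal (c ^ Suc n))"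
    by (subst nn_integral_suminf) (auto simp: nn_exp_arrival c_def)
  also have "\<dots> \<noteq> \<infinity>"
  proof -
    have "summable (\<lambda>n. c ^ Suc n)" using c by (subst summable_Suc_iff) (simp add: summable_geometric)
    then have "(\<Sum>n. ennreal (c ^ Suc n)) = ennreal (\<Sum>n. c ^ Suc n)"
      using c by (intro suminf_ennreal2) auto
    then show ?thesis by simp
  qed
  finally have "AE \<omega> in M. (\<Sum>n. ennreal (exp (- arrival E n \<omega>))) \<noteq> \<infinity>"
    by (intro nn_integral_noteq_infinite) auto
  then show ?thesis
  proof eventually_elim
    case (elim \<omega>)
    have "summable (\<lambda>n. exp (- arrival E n \<omega>))"
      using elim by (intro summable_suminf_not_top) (auto simp: top_ennreal_def)
    then have lim: "(\<lambda>n. exp (- arrival E n \<omega>)) \<longlonglongrightarrow> 0" by (rule summable_LIMSEQ_zero)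
    show ?case
    proof
      fix t
      have "\<forall>\<^sub>F n in sequentially. exp (- arrival E n \<omega>) < exp (- t)"
        by (rule order_tendstoD(2)[OF lim]) simp
      then obtain N where N: "\<And>n. N \<le> n \<Longrightarrow> t < arrival E n \<omega>"
        by (auto simp: eventually_sequentially)
      have "{k. arrival E k \<omega> \<le> t} \<subseteq> {..<N}"
        using N by (auto simp: not_le[symmetric])
      then show "finite {k. arrival E k \<omega> \<le> t}" using finite_subset by blast
    qed
  qed
qed

lemma AE_regular: "AE \<omega> in M. regular_path E \<sigma> \<omega>"
  using AE_E_pos AE_\<sigma>_nonneg AE_arrivals unfolding regular_path_def by eventually_elim auto

section \<open>Truncation after finitely many claims\<close>

text \<open>The parameter b is the value assigned to survival of the n claims following claim k.
  Inter-arrival times are cut off at 0 to keep J bounded on all of the product space.\<close>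
primrec J :: "real \<Rightarrow> real \<Rightarrow> nat \<Rightarrow> nat \<Rightarrow> real \<Rightarrow> real \<Rightarrow> (nat + nat \<Rightarrow> real) \<Rightarrow> real" where
  "J s b 0 = (\<lambda>k y d w. if y < a1 \<or> y + d < a2 then 1 else b)"
| "J s b (Suc n) = (\<lambda>k y d w. if y < a1 \<or> y + d < a2 then 1 else
     exp (- s * max 0 (w (Inl k))) * J s b n (Suc k) (exp (r * w (Inl k)) * y - w (Inr k)) (exp (r * w (Inl k)) * d) w)"

text \<open>Counterpart of \<open>J\<close> after all claims have been integrated out: the iterates
  of the renewal operator, started from the terminal value b.\<close>

primrec A :: "real \<Rightarrow> real \<Rightarrow> nat \<Rightarrow> real \<Rightarrow> real \<Rightarrow> real" where
  "A s b 0 = (\<lambda>y d. if y < a1 \<or> y + d < a2 then 1 else b)"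
| "A s b (Suc n) = (\<lambda>y d. if y < a1 \<or> y + d < a2 then 1 else
     tint lam (lam + s) {0..} (\<lambda>t. avg (\<lambda>z. A s b n (exp (r * t) * y - z) (exp (r * t) * d))))"

definition later :: "nat \<Rightarrow> (nat + nat) set" where
  "later k = {i. case i of Inl j \<Rightarrow> k \<le> j | Inr j \<Rightarrow> k \<le> j}"

lemma later_mem [simp]: "Inl j \<in> later k \<longleftrightarrow> k \<le> j" "Inr j \<in> later k \<longleftrightarrow> k \<le> j"
  by (auto simp: later_def)

lemma later_Suc: "i \<in> later (Suc k) \<Longrightarrow> i \<in> later k"
  by (auto simp: later_def split: sum.splits)

lemma J_cong:
  "(\<And>i. i \<in> later k \<Longrightarrow> w i = w' i) \<Longrightarrow> J s b n k y d w = J s b n k y d w'"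
proof (induction n arbitrary: k y d)
  case (Suc n)
  have "w (Inl k) = w' (Inl k)" "w (Inr k) = w' (Inr k)" by (auto intro: Suc.prems)
  moreover have "J s b n (Suc k) y' d' w = J s b n (Suc k) y' d' w'" for y' d'
    by (rule Suc.IH) (auto intro: Suc.prems later_Suc)
  ultimately show ?case by simp
qed simp

lemma J_bounds: "0 < s \<Longrightarrow> 0 \<le> b \<Longrightarrow> b \<le> 1 \<Longrightarrow> 0 \<le> J s b n k y d w \<and> J s b n k y d w \<le> 1"
proof (induction n arbitrary: k y d)
  case (Suc n)
  have "exp (- s * max 0 (w (Inl k))) \<le> 1" using Suc.prems by simp
  then show ?case using Suc.IH[OF Suc.prems]
    by (auto intro!: mult_le_one)
qed simp

lemma J_measurable:
  assumes "g \<in> borel_measurable N" "h \<in> borel_measurable N"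
    and "\<And>i. i \<in> later k \<Longrightarrow> (\<lambda>x. W x i) \<in> borel_measurable N"
  shows "(\<lambda>x. J s b n k (g x) (h x) (W x)) \<in> borel_measurable N"
  using assms
proof (induction n arbitrary: k g h)
  case 0
  note [measurable] = 0(1,2)
  show ?case by simp
next
  case (Suc n)
  note [measurable] = Suc.prems(1,2)
  have [measurable]: "(\<lambda>x. W x (Inl k)) \<in> borel_measurable N" "(\<lambda>x. W x (Inr k)) \<in> borel_measurable N"
    by (auto intro: Suc.prems(3))
  have [measurable]: "(\<lambda>x. J s b n (Suc k) (exp (r * W x (Inl k)) * g x - W x (Inr k)) (exp (r * W x (Inl k)) * h x) (W x)) \<in> borel_measurable N"
    by (rule Suc.IH) (auto intro: Suc.prems(3) later_Suc)
  show ?case by simp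
qed

lemma A_measurable [measurable (raw)]:
  "g \<in> borel_measurable N \<Longrightarrow> h \<in> borel_measurable N \<Longrightarrow> (\<lambda>x. A s b n (g x) (h x)) \<in> borel_measurable N"
proof -
  have "(\<lambda>p. A s b n (fst p) (snd p)) \<in> borel_measurable (borel \<Otimes>\<^sub>M borel)"
  proof (induction n)
    case (Suc n)
    note [measurable (raw)] = borel_measurable_binary[OF Suc.IH]
    show ?case unfolding A.simps tint_def avg_def by measurable
  qed simp
  then show "g \<in> borel_measurable N \<Longrightarrow> h \<in> borel_measurable N \<Longrightarrow> (\<lambda>x. A s b n (g x) (h x)) \<in> borel_measurable N"
    by (rule borel_measurable_binary)
qed

lemma b_pos: "0 < s \<Longrightarrow> 0 < lam + s" using lam by simp

lemma tint_avg_measurable: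
  assumes U: "(\<lambda>p. U (fst p) (snd p)) \<in> borel_measurable (borel \<Otimes>\<^sub>M borel)"
  shows "(\<lambda>t :: real. avg (\<lambda>z. U (exp (r * t) * y - z) (exp (r * t) * d))) \<in> borel_measurable borel"
proof -
  note [measurable (raw)] = borel_measurable_binary[OF U]
  have "(\<lambda>x. U (exp (r * fst x) * y - snd x) (exp (r * fst x) * d) * f (snd x)) \<in> borel_measurable (borel \<Otimes>\<^sub>M lborel)"
    by measurable
  then show ?thesis unfolding avg_def
    by (intro lborel.borel_measurable_lebesgue_integral) (simp add: case_prod_unfold)
qed

lemma A_measurable_pair: "(\<lambda>p. A s b n (fst p) (snd p)) \<in> borel_measurable (borel \<Otimes>\<^sub>M borel)"
  by measurable

lemma A_measurable_claim: "(\<lambda>z. A s b n (u - z) v) \<in> borel_measurable borel"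
  by measurable

lemma A_abs:
  assumes s: "0 < s" and b: "0 \<le> b" "b \<le> 1"
  shows "\<bar>A s b n y d\<bar> \<le> 1"
proof (induction n arbitrary: y d)
  case (Suc n)
  have "\<bar>tint lam (lam + s) {0..} (\<lambda>t. avg (\<lambda>z. A s b n (exp (r * t) * y - z) (exp (r * t) * d)))\<bar> \<le> lam / (lam + s) * 1"
    by (intro tint_abs_le_Ici[OF lam b_pos[OF s]] tint_avg_measurable A_measurable_pair avg_abs_le Suc.IH A_measurable_claim)
  also have "\<dots> \<le> 1" using lam s by simp
  finally show ?case by simp
qed (use b in auto)

text \<open>The terminal value is seen only after n claims, and each waiting time discounts it by
  lam / (lam + s).\<close>

lemma A_gap:
  assumes s: "0 < s"
  shows "\<bar>A s 1 n y d - A s 0 n y d\<bar> \<le> (lam / (lam + s)) ^ n"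
proof (induction n arbitrary: y d)
  case (Suc n)
  define T where "T b = tint lam (lam + s) {0..} (\<lambda>t. avg (\<lambda>z. A s b n (exp (r * t) * y - z) (exp (r * t) * d)))" for b
  have m: "(\<lambda>t. avg (\<lambda>z. A s b n (exp (r * t) * y - z) (exp (r * t) * d))) \<in> borel_measurable borel" for b
    by (rule tint_avg_measurable[OF A_measurable_pair])
  have bd: "\<bar>avg (\<lambda>z. A s b n (exp (r * t) * y - z) (exp (r * t) * d))\<bar> \<le> 1" if "0 \<le> b" "b \<le> 1" for b t
    by (rule avg_abs_le) (use A_abs[OF s that] in auto)
  have "T 1 - T 0 = tint lam (lam + s) {0..} (\<lambda>t. avg (\<lambda>z. A s 1 n (exp (r * t) * y - z) (exp (r * t) * d))
      - avg (\<lambda>z. A s 0 n (exp (r * t) * y - z) (exp (r * t) * d)))"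
    unfolding T_def by (rule tint_diff[OF lam b_pos[OF s], where B = 1 and B' = 1]) (use m bd in auto)
  also have "\<bar>\<dots>\<bar> \<le> lam / (lam + s) * (lam / (lam + s)) ^ n"
  proof (rule tint_abs_le_Ici[OF lam b_pos[OF s]])
    fix t :: real
    have "avg (\<lambda>z. A s 1 n (exp (r * t) * y - z) (exp (r * t) * d)) - avg (\<lambda>z. A s 0 n (exp (r * t) * y - z) (exp (r * t) * d))
      = avg (\<lambda>z. A s 1 n (exp (r * t) * y - z) (exp (r * t) * d) - A s 0 n (exp (r * t) * y - z) (exp (r * t) * d))"
      by (rule avg_diff[where B = 1 and B' = 1]) (use A_abs[OF s] in auto)
    also have "\<bar>\<dots>\<bar> \<le> (lam / (lam + s)) ^ n" by (rule avg_abs_le[OF _ Suc.IH]) measurable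
    finally show "\<bar>avg (\<lambda>z. A s 1 n (exp (r * t) * y - z) (exp (r * t) * d))
      - avg (\<lambda>z. A s 0 n (exp (r * t) * y - z) (exp (r * t) * d))\<bar> \<le> (lam / (lam + s)) ^ n" .
  qed (use m in measurable)
  finally have "\<bar>T 1 - T 0\<bar> \<le> (lam / (lam + s)) ^ Suc n" by simp
  then show ?case using lam s by (simp add: T_def)
qed simp

lemma indep_X: "indep_vars (\<lambda>_. borel) (\<lambda>i \<omega>. X \<omega> i) UNIV"
  using indep unfolding X_def by (rule indep_vars_cong[THEN iffD1, rotated 3]) (auto split: sum.split)

text \<open>The cut-off at 0 disappears because the exponential density vanishes on negative times;
  discount and density then merge into the rate lam + s.\<close>

lemma expectation_first_claim:
  assumes s: "0 < s" and g [measurable]: "(\<lambda>p. g (fst p) (snd p)) \<in> borel_measurable (borel \<Otimes>\<^sub>M borel)"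
    and B: "\<And>e z. \<bar>g e z\<bar> \<le> 1"
  shows "(\<integral>\<omega>. exp (- s * max 0 (E k \<omega>)) * g (E k \<omega>) (\<sigma> k \<omega>) \<partial>M) = tint lam (lam + s) {0..} (\<lambda>t. avg (g t))"
proof -
  note [measurable (raw)] = borel_measurable_binary[OF g]
  define h where "h p = exp (- s * max 0 (fst p)) * g (fst p) (snd p)" for p :: "real \<times> real"
  have h: "h \<in> borel_measurable (borel \<Otimes>\<^sub>M borel)" unfolding h_def[abs_def] by measurable
  have hB: "\<bar>h p\<bar> \<le> 1" for p
    unfolding h_def abs_mult using B s by (intro mult_le_one) auto
  have "indep_var (PiM {Inl k} (\<lambda>_. borel)) (\<lambda>\<omega>. restrict (X \<omega>) {Inl k}) (PiM {Inr k} (\<lambda>_. borel)) (\<lambda>\<omega>. restrict (X \<omega>) {Inr k})"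
    by (rule indep_var_restrict[OF indep_X]) auto
  then have "indep_var borel ((\<lambda>w. w (Inl k)) \<circ> (\<lambda>\<omega>. restrict (X \<omega>) {Inl k})) borel ((\<lambda>w. w (Inr k)) \<circ> (\<lambda>\<omega>. restrict (X \<omega>) {Inr k}))"
    by (rule indep_var_compose) (auto intro: measurable_component_singleton)
  then have "indep_var borel (E k) borel (\<sigma> k)" by (simp add: comp_def X_def)
  from indep_var_integral[OF this h hB]
  have "(\<integral>\<omega>. exp (- s * max 0 (E k \<omega>)) * g (E k \<omega>) (\<sigma> k \<omega>) \<partial>M) = (\<integral>\<omega>'. \<integral>\<omega>. exp (- s * max 0 (E k \<omega>')) * g (E k \<omega>') (\<sigma> k \<omega>) \<partial>M \<partial>M)"
    by (simp add: h_def)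
  also have "\<dots> = (\<integral>\<omega>'. exp (- s * max 0 (E k \<omega>')) * avg (g (E k \<omega>')) \<partial>M)"
  proof (rule Bochner_Integration.integral_cong[OF refl])
    fix \<omega>'
    have "(\<integral>x. f x * g (E k \<omega>') x \<partial>lborel) = (\<integral>\<omega>. g (E k \<omega>') (\<sigma> k \<omega>) \<partial>M)"
      by (rule distributed_integral[OF \<sigma>_dist]) (auto simp: f_nonneg)
    then show "(\<integral>\<omega>. exp (- s * max 0 (E k \<omega>')) * g (E k \<omega>') (\<sigma> k \<omega>) \<partial>M) = exp (- s * max 0 (E k \<omega>')) * avg (g (E k \<omega>'))"
      by (simp add: avg_def mult.commute)
  qed
  also have "\<dots> = (\<integral>t. exponential_density lam t * (exp (- s * max 0 t) * avg (g t)) \<partial>lborel)"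
  proof (rule distributed_integral[OF E_dist, symmetric])
    have "(\<lambda>t. avg (g t)) \<in> borel_measurable borel" unfolding avg_def by measurable
    then show "(\<lambda>t. exp (- s * max 0 t) * avg (g t)) \<in> borel_measurable lborel" by measurable
  qed (use lam in \<open>auto simp: exponential_density_nonneg\<close>)
  also have "\<dots> = tint lam (lam + s) {0..} (\<lambda>t. avg (g t))"
    unfolding tint_def
  proof (rule Bochner_Integration.integral_cong[OF refl])
    fix t :: real
    show "exponential_density lam t * (exp (- s * max 0 t) * avg (g t))
      = indicator {0..} t * (lam * exp (- (lam + s) * t) * avg (g t))"
      by (cases "0 \<le> t") (auto simp: exponential_density_def exp_add[symmetric] algebra_simps)
  qed
  finally show ?thesis .
qed

text \<open>The pair with index k is independent of the block of later indices, to which the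
  induction hypothesis applies with k + 1. The value does not depend on k because the claims and the
  waiting times are identically distributed.\<close>

lemma expectation_J:
  assumes s: "0 < s" and b: "0 \<le> b" "b \<le> 1"
  shows "(\<integral>\<omega>. J s b n k y d (X \<omega>) \<partial>M) = A s b n y d"
proof (induction n arbitrary: k y d)
  case 0
  show ?case by (simp add: prob_space)
next
  case (Suc n)
  show ?case
  proof (cases "y < a1 \<or> y + d < a2")
    case True
    then show ?thesis by (simp add: prob_space)
  next
    case False
    let ?S = "PiM {Inl k, Inr k} (\<lambda>_. borel :: real measure)" and ?T = "PiM (later (Suc k)) (\<lambda>_. borel :: real measure)"
    define h where "h p = exp (- s * max 0 (fst p (Inl k))) * J s b n (Suc k)
      (exp (r * fst p (Inl k)) * y - fst p (Inr k)) (exp (r * fst p (Inl k)) * d) (snd p)"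
      for p :: "(nat + nat \<Rightarrow> real) \<times> (nat + nat \<Rightarrow> real)"
    have c [measurable]: "(\<lambda>p. fst p (Inl k)) \<in> borel_measurable (?S \<Otimes>\<^sub>M ?T)" "(\<lambda>p. fst p (Inr k)) \<in> borel_measurable (?S \<Otimes>\<^sub>M ?T)"
      by (rule measurable_compose[OF measurable_fst], rule measurable_component_singleton, simp)+
    have [measurable]: "(\<lambda>p. J s b n (Suc k) (exp (r * fst p (Inl k)) * y - fst p (Inr k)) (exp (r * fst p (Inl k)) * d) (snd p))
       \<in> borel_measurable (?S \<Otimes>\<^sub>M ?T)"
    proof (rule J_measurable)
      show "(\<lambda>p. snd p i) \<in> borel_measurable (?S \<Otimes>\<^sub>M ?T)" if "i \<in> later (Suc k)" for i
        by (rule measurable_compose[OF measurable_snd], rule measurable_component_singleton, rule that)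
    qed measurable
    have h: "h \<in> borel_measurable (?S \<Otimes>\<^sub>M ?T)" unfolding h_def[abs_def] by measurable
    have hB: "\<bar>h p\<bar> \<le> 1" for p
      unfolding h_def abs_mult using J_bounds[OF s b] s by (intro mult_le_one) (auto simp: abs_le_iff intro: order_trans[of _ 0])
    have "indep_var ?S (\<lambda>\<omega>. restrict (X \<omega>) {Inl k, Inr k}) ?T (\<lambda>\<omega>. restrict (X \<omega>) (later (Suc k)))"
      by (rule indep_var_restrict[OF indep_X]) auto
    from indep_var_integral[OF this h hB]
    have step: "(\<integral>\<omega>. h (restrict (X \<omega>) {Inl k, Inr k}, restrict (X \<omega>) (later (Suc k))) \<partial>M)
       = (\<integral>\<omega>'. \<integral>\<omega>. h (restrict (X \<omega>') {Inl k, Inr k}, restrict (X \<omega>) (later (Suc k))) \<partial>M \<partial>M)" .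
    have h_eq: "h (restrict (X \<omega>') {Inl k, Inr k}, restrict (X \<omega>) (later (Suc k)))
      = exp (- s * max 0 (E k \<omega>')) * J s b n (Suc k) (exp (r * E k \<omega>') * y - \<sigma> k \<omega>') (exp (r * E k \<omega>') * d) (X \<omega>)" for \<omega> \<omega>'
    proof -
      have "J s b n (Suc k) y' d' (restrict (X \<omega>) (later (Suc k))) = J s b n (Suc k) y' d' (X \<omega>)" for y' d'
        by (rule J_cong) simp
      then show ?thesis by (simp add: h_def X_def)
    qed
    have "(\<integral>\<omega>. J s b (Suc n) k y d (X \<omega>) \<partial>M)
      = (\<integral>\<omega>. exp (- s * max 0 (E k \<omega>)) * J s b n (Suc k) (exp (r * E k \<omega>) * y - \<sigma> k \<omega>) (exp (r * E k \<omega>) * d) (X \<omega>) \<partial>M)"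
      using False by (simp add: X_def)
    also have "\<dots> = (\<integral>\<omega>'. exp (- s * max 0 (E k \<omega>')) * A s b n (exp (r * E k \<omega>') * y - \<sigma> k \<omega>') (exp (r * E k \<omega>') * d) \<partial>M)"
      using step unfolding h_eq by (simp add: Suc.IH)
    also have "\<dots> = tint lam (lam + s) {0..} (\<lambda>t. avg (\<lambda>z. A s b n (exp (r * t) * y - z) (exp (r * t) * d)))"
      by (rule expectation_first_claim[OF s]) (measurable, rule A_abs[OF s b])
    finally show ?thesis using False by simp
  qed
qed

text \<open>The discount factor still open after n claims lies between 0 and 1, so these two
  terminal values bracket it. The offset k is general because the path restarts with shifted
  sequences after each claim.\<close>

lemma J_sandwich:
  assumes s: "0 < s" and reg: "regular_path E \<sigma> \<omega>"
  shows "J s 0 n k y d (X \<omega>) \<le> disc s (ruin_set r a1 a2 (\<lambda>j. E (j + k)) (\<lambda>j. \<sigma> (j + k)) y d \<omega>)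
    \<and> disc s (ruin_set r a1 a2 (\<lambda>j. E (j + k)) (\<lambda>j. \<sigma> (j + k)) y d \<omega>) \<le> J s 1 n k y d (X \<omega>)"
proof (induction n arbitrary: k y d)
  case (0 k)
  have reg_k: "\<And>j. 0 < E (j + k) \<omega>" using reg by (simp add: regular_path_def)
  have "disc s (ruin_set r a1 a2 (\<lambda>j. E (j + k)) (\<lambda>j. \<sigma> (j + k)) y d \<omega>) \<le> 1"
    by (rule disc_le_1[OF s ruin_set_nonneg])
  then show ?case
    using disc_eq_1[OF s ruin_set_at_0[of "\<lambda>j. E (j + k)" \<omega>, OF reg_k] ruin_set_nonneg] disc_nonneg[OF s]
    by simp
next
  case (Suc n k)
  note reg_k = regular_path_shift[OF reg, of k]
  have pos: "\<And>j. 0 < E (j + k) \<omega>" using reg by (simp add: regular_path_def)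
  show ?case
  proof (cases "y < a1 \<or> y + d < a2")
    case True
    then show ?thesis
      using disc_eq_1[OF s ruin_set_at_0[of "\<lambda>j. E (j + k)" \<omega>, OF pos True] ruin_set_nonneg] by simp
  next
    case False
    have "ruin_set r a1 a2 (\<lambda>j. E (j + k)) (\<lambda>j. \<sigma> (j + k)) y d \<omega> =
      (+) (E k \<omega>) ` ruin_set r a1 a2 (\<lambda>j. E (j + Suc k)) (\<lambda>j. \<sigma> (j + Suc k)) (exp (r * E k \<omega>) * y - \<sigma> k \<omega>) (exp (r * E k \<omega>) * d) \<omega>"
      using ruin_set_first_claim[where E = "\<lambda>j. E (j + k)" and \<sigma> = "\<lambda>j. \<sigma> (j + k)" and \<omega> = \<omega> and r = r and ?a1.0 = a1 and ?a2.0 = a2 and y = y and d = d]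
        r a2 a12 pos reg_k False by (simp add: regular_path_def)
    then have "disc s (ruin_set r a1 a2 (\<lambda>j. E (j + k)) (\<lambda>j. \<sigma> (j + k)) y d \<omega>) =
      exp (- s * E k \<omega>) * disc s (ruin_set r a1 a2 (\<lambda>j. E (j + Suc k)) (\<lambda>j. \<sigma> (j + Suc k)) (exp (r * E k \<omega>) * y - \<sigma> k \<omega>) (exp (r * E k \<omega>) * d) \<omega>)"
      by (simp only: disc_translate[OF s ruin_set_nonneg])
    moreover have "max 0 (E k \<omega>) = E k \<omega>" using pos[of 0] by simp
    ultimately show ?thesis using False Suc.IH[of "Suc k" "exp (r * E k \<omega>) * y - \<sigma> k \<omega>" "exp (r * E k \<omega>) * d"]
      by (simp add: X_def)
  qed
qed

lemma V_between:
  assumes s: "0 < s" shows "A s 0 n y d \<le> V s y d" "V s y d \<le> A s 1 n y d"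
proof -
  have int: "integrable M (\<lambda>\<omega>. J s b n 0 y d (X \<omega>))" if "0 \<le> b" "b \<le> 1" for b
  proof (rule integrable_const_bound[where B = 1])
    show "AE \<omega> in M. norm (J s b n 0 y d (X \<omega>)) \<le> 1" using J_bounds[OF s that] by simp
    show "(\<lambda>\<omega>. J s b n 0 y d (X \<omega>)) \<in> borel_measurable M" by (rule J_measurable) auto
  qed
  have "AE \<omega> in M. J s 0 n 0 y d (X \<omega>) \<le> disc s (ruin_times y d \<omega>) \<and> disc s (ruin_times y d \<omega>) \<le> J s 1 n 0 y d (X \<omega>)"
    using AE_regular by eventually_elim (use J_sandwich[OF s, where k = 0] in simp)
  then have "AE \<omega> in M. J s 0 n 0 y d (X \<omega>) \<le> disc s (ruin_times y d \<omega>)" "AE \<omega> in M. disc s (ruin_times y d \<omega>) \<le> J s 1 n 0 y d (X \<omega>)"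
    by auto
  then have "(\<integral>\<omega>. J s 0 n 0 y d (X \<omega>) \<partial>M) \<le> V s y d" "V s y d \<le> (\<integral>\<omega>. J s 1 n 0 y d (X \<omega>) \<partial>M)"
    unfolding V_def by (intro integral_mono_AE int disc_integrable[OF s]; simp)+
  then show "A s 0 n y d \<le> V s y d" "V s y d \<le> A s 1 n y d"
    using expectation_J[OF s] by auto
qed

lemma V_approx: "0 < s \<Longrightarrow> \<bar>V s y d - A s 0 n y d\<bar> \<le> (lam / (lam + s)) ^ n"
  using V_between(1)[where s = s and n = n and y = y and d = d] V_between(2)[where s = s and n = n and y = y and d = d] A_gap[where s = s and n = n and y = y and d = d] by linarith

lemma geometric_null: "0 < s \<Longrightarrow> (\<lambda>n. c * (lam / (lam + s)) ^ n) \<longlonglongrightarrow> 0"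
  using lam by (intro tendsto_mult_right_zero LIMSEQ_power_zero) auto

lemma A_tendsto_V: 
  assumes s: "0 < s" shows "(\<lambda>n. A s 0 n y d) \<longlonglongrightarrow> V s y d"
proof -
  have "(\<lambda>n. A s 0 n y d - V s y d) \<longlonglongrightarrow> 0"
    by (rule Lim_null_comparison[OF _ geometric_null[OF s, of 1]])
      (use V_approx[OF s] in \<open>auto simp: abs_minus_commute intro!: always_eventually\<close>)
  then show ?thesis by (rule LIM_zero_cancel)
qed

text \<open>Joint measurability in the starting point is inherited from the iterates rather than
  derived from the paths.\<close>

lemma V_measurable_pair:
  assumes s: "0 < s" shows "(\<lambda>p. V s (fst p) (snd p)) \<in> borel_measurable (borel \<Otimes>\<^sub>M borel)"
  by (rule borel_measurable_LIMSEQ_real[where u = "\<lambda>n p. A s 0 n (fst p) (snd p)"])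
    (use A_tendsto_V[OF s] in measurable)

lemma V_bounds:
  assumes s: "0 < s" shows "0 \<le> V s y d \<and> V s y d \<le> 1"
proof
  show "0 \<le> V s y d" unfolding V_def by (simp add: disc_nonneg[OF s])
  show "V s y d \<le> 1" using V_between(2)[OF s, where y = y and d = d and n = 0] by (auto split: if_splits)
qed

lemma V_eq_1: "0 < s \<Longrightarrow> y < a1 \<or> y + d < a2 \<Longrightarrow> V s y d = 1"
  using V_between(1)[where s = s and n = 0 and y = y and d = d] V_between(2)[where s = s and n = 0 and y = y and d = d] by auto

text \<open>A passage to the limit in the recursion for \<open>A\<close>, with uniform geometric
  error. Conditioning on the first claim was carried out only for the truncated functionals, which
  depend on finitely many coordinates.\<close>

lemma V_renewal_equation:
  assumes s: "0 < s" and surv: "a1 \<le> y" "a2 \<le> y + d"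
  shows "V s y d = tint lam (lam + s) {0..} (\<lambda>t. avg (\<lambda>z. V s (exp (r * t) * y - z) (exp (r * t) * d)))"
proof -
  let ?q = "lam / (lam + s)"
  let ?K = "\<lambda>U. tint lam (lam + s) {0..} (\<lambda>t. avg (\<lambda>z. U (exp (r * t) * y - z) (exp (r * t) * d)))"
  note Vm = borel_measurable_binary[OF V_measurable_pair[OF s]]
  have Vb: "\<bar>V s y d\<bar> \<le> 1" for y d using V_bounds[OF s, of y d] by simp
  have mV: "(\<lambda>t. avg (\<lambda>z. V s (exp (r * t) * y - z) (exp (r * t) * d))) \<in> borel_measurable borel"
    by (rule tint_avg_measurable[OF V_measurable_pair[OF s]])
  have mA: "(\<lambda>t. avg (\<lambda>z. A s 0 n (exp (r * t) * y - z) (exp (r * t) * d))) \<in> borel_measurable borel" for n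
    by (rule tint_avg_measurable[OF A_measurable_pair])
  have V1: "(\<lambda>z. V s (u - z) v) \<in> borel_measurable borel" for u v by (rule Vm) auto
  have diff: "\<bar>avg (\<lambda>z. A s 0 n (u - z) v) - avg (\<lambda>z. V s (u - z) v)\<bar> \<le> ?q ^ n" for n u v
  proof -
    have "avg (\<lambda>z. A s 0 n (u - z) v) - avg (\<lambda>z. V s (u - z) v) = avg (\<lambda>z. A s 0 n (u - z) v - V s (u - z) v)"
      by (rule avg_diff[where B = 1 and B' = 1]) (use A_abs[OF s] Vb V1 in auto)
    also have "\<bar>\<dots>\<bar> \<le> ?q ^ n"
      by (rule avg_abs_le) (use V_approx[OF s] V1 in \<open>auto simp: abs_minus_commute\<close>)
    finally show ?thesis .
  qed
  have "\<bar>?K (A s 0 n) - ?K (V s)\<bar> \<le> ?q * ?q ^ n" for n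
  proof -
    have "?K (A s 0 n) - ?K (V s) = tint lam (lam + s) {0..} (\<lambda>t. avg (\<lambda>z. A s 0 n (exp (r * t) * y - z) (exp (r * t) * d))
      - avg (\<lambda>z. V s (exp (r * t) * y - z) (exp (r * t) * d)))"
      by (rule tint_diff[OF lam b_pos[OF s], where B = 1 and B' = 1])
        (use mA mV A_abs[OF s] Vb V1 in \<open>auto intro!: avg_abs_le\<close>)
    also have "\<bar>\<dots>\<bar> \<le> ?q * ?q ^ n"
      by (rule tint_abs_le_Ici[OF lam b_pos[OF s]]) (use mA mV diff in auto)
    finally show ?thesis .
  qed
  then have "(\<lambda>n. ?K (A s 0 n) - ?K (V s)) \<longlonglongrightarrow> 0"
    by (intro Lim_null_comparison[OF _ geometric_null[OF s, of ?q]]) (auto intro!: always_eventually)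
  then have "(\<lambda>n. ?K (A s 0 n)) \<longlonglongrightarrow> ?K (V s)" by (rule LIM_zero_cancel)
  moreover have "(\<lambda>n. A s 0 (Suc n) y d) \<longlonglongrightarrow> V s y d"
    using A_tendsto_V[OF s] by (rule LIMSEQ_Suc)
  then have "(\<lambda>n. ?K (A s 0 n)) \<longlonglongrightarrow> V s y d" using surv by (simp add: not_less)
  ultimately show ?thesis by (rule LIMSEQ_unique[rotated])
qed

section \<open>Pathwise comparison of starting points\<close>

text \<open>The second line starts no lower and has the smaller threshold, so its ruin always
  entails ruin of the first.\<close>

lemma ruin_times_right:
  assumes "0 \<le> d" shows "ruin_times y d \<omega> = ruin_times y 0 \<omega>"
proof -
  have le: "exp (r * t) * y \<le> exp (r * t) * (y + d)" for t using assms by (intro mult_left_mono) auto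
  show ?thesis
  proof (intro set_eqI)
    show "t \<in> ruin_times y d \<omega> \<longleftrightarrow> t \<in> ruin_times y 0 \<omega>" for t
      using le[of t] a12 unfolding ruin_set_def mem_Collect_eq add_0_right by argo
  qed
qed

text \<open>Since exp(r t) d stays below a2 - a1, ruin of the first line always entails ruin of the
  second.\<close>

lemma ruin_times_left:
  assumes "d \<le> a2 - a1"
  shows "ruin_times y d \<omega> = {t. 0 \<le> t \<and> exp (r * t) * (y + d) < a2 + claims r E \<sigma> t \<omega>}"
proof -
  have le: "exp (r * t) * (y + d) \<le> exp (r * t) * y + (a2 - a1)" if "0 \<le> t" for t
  proof -
    have "exp (r * t) * d \<le> exp (r * t) * (a2 - a1)" using assms by (intro mult_left_mono) auto
    also have "\<dots> \<le> 1 * (a2 - a1)" using that r a12 by (intro mult_right_mono_neg) auto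
    finally show ?thesis by (simp add: distrib_left)
  qed
  show ?thesis
  proof (intro set_eqI)
    show "t \<in> ruin_times y d \<omega> \<longleftrightarrow> t \<in> {t. 0 \<le> t \<and> exp (r * t) * (y + d) < a2 + claims r E \<sigma> t \<omega>}" for t
      using le[of t] unfolding ruin_set_def mem_Collect_eq by argo
  qed
qed

lemma ruin_times_antimono:
  assumes "0 \<le> e" shows "ruin_times y 0 \<omega> \<subseteq> ruin_times y (- e) \<omega>"
proof
  fix t
  have "exp (r * t) * (y - e) \<le> exp (r * t) * y" using assms by (intro mult_left_mono) auto
  then show "t \<in> ruin_times y 0 \<omega> \<Longrightarrow> t \<in> ruin_times y (- e) \<omega>"
    using a12 unfolding ruin_set_def mem_Collect_eq add_0_right add_uminus_conv_diff by argo
qed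

lemma ruin_times_shift:
  assumes "0 \<le> e" shows "ruin_times y (- e) \<omega> \<subseteq> ruin_times (y - e) 0 \<omega>"
proof
  fix t
  have "exp (r * t) * (y - e) \<le> exp (r * t) * y" using assms by (intro mult_left_mono) auto
  then show "t \<in> ruin_times y (- e) \<omega> \<Longrightarrow> t \<in> ruin_times (y - e) 0 \<omega>"
    using a12 unfolding ruin_set_def mem_Collect_eq add_0_right add_uminus_conv_diff by argo
qed

text \<open>The two ruin times can differ only after the trajectory has had time to cross the diagonal;
  writing the discount factor as a square therefore gains a power of e.\<close>
lemma disc_gap:
  assumes s: "0 < s" and e: "0 < e"
  shows "disc s (ruin_times y (- e) \<omega>) - disc s (ruin_times y 0 \<omega>)
    \<le> 2 * (e / (a1 - a2)) powr (s / (2 * r)) * (disc (s / 2) (ruin_times y (- e) \<omega>) - disc (s / 2) (ruin_times y 0 \<omega>))"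
proof -
  have s2: "0 < s / 2" using s by simp
  \<comment> \<open>Time at which the flow takes -e to a2 - a1. Before it, a path from (y, -e) whose
    second line is ruined is also below the threshold of the first.\<close>
  define T where "T = ln ((a1 - a2) / e) / r"
  let ?u = "disc (s / 2) (ruin_times y (- e) \<omega>)" and ?v = "disc (s / 2) (ruin_times y 0 \<omega>)"
  define p where "p = (e / (a1 - a2)) powr (s / (2 * r))"
  have p: "exp (- (s / 2) * T) = p"
  proof -
    have "ln ((a1 - a2) / e) = - ln (e / (a1 - a2))" using e a12 by (simp add: ln_div)
    then show ?thesis using e a12 r by (simp add: p_def powr_def T_def)
  qed
  have sub: "ruin_times y 0 \<omega> \<subseteq> ruin_times y (- e) \<omega>" by (rule ruin_times_antimono) (use e in simp)
  have late: "t \<in> ruin_times y 0 \<omega>" if t: "t \<in> ruin_times y (- e) \<omega>" "t < T" for t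
  proof -
    have "r * t < ln ((a1 - a2) / e)" using t(2) r by (simp add: T_def field_simps)
    then have "exp (r * t) < (a1 - a2) / e" using e a12 by (metis exp_less_mono exp_ln divide_pos_pos diff_gt_0_iff_gt)
    then have "exp (r * t) * e < a1 - a2" using e by (simp add: field_simps)
    then have "exp (r * t) * y - (a1 - a2) < exp (r * t) * (y - e)" by (simp add: algebra_simps)
    then show ?thesis using t(1) unfolding ruin_set_def by auto
  qed
  have "?u = ?v \<or> ?u \<le> exp (- (s / 2) * T)"
    by (rule disc_split[OF s2 sub ruin_set_nonneg late])
  then have "?u = ?v \<or> ?u \<le> p" unfolding p .
  moreover have le: "?v \<le> ?u" by (rule disc_mono[OF s2 sub ruin_set_nonneg])
  \<comment> \<open>The factored difference of squares; unless the two factors coincide both are at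
    most p, which is the origin of the constant 2.\<close>
  ultimately have "(?u - ?v) * (?u + ?v) \<le> (?u - ?v) * (2 * p)"
  proof (elim disjE)
    assume "?u \<le> p"
    then show ?thesis using le by (intro mult_left_mono) auto
  qed auto
  then show ?thesis
    unfolding disc_double[OF s, of "ruin_times y (- e) \<omega>"] disc_double[OF s, of "ruin_times y 0 \<omega>"] p_def
    by (simp add: power2_eq_square algebra_simps)
qed

lemma V_mono:
  assumes s: "0 < s" and "\<And>\<omega>. ruin_times y d \<omega> \<subseteq> ruin_times y' d' \<omega>"
  shows "V s y d \<le> V s y' d'"
  unfolding V_def
  by (intro integral_mono disc_integrable[OF s] disc_mono[OF s] assms ruin_set_nonneg)

lemma renewal_V: "renewal f r lam a1 a2 V"
proof unfold_locales
  show "0 < r" "0 < lam" "0 < a2" "a2 < a1" by (fact r lam a2 a12)+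
  fix s :: real assume s: "0 < s"
  show "(\<lambda>p. V s (fst p) (snd p)) \<in> borel_measurable (borel \<Otimes>\<^sub>M borel)" by (rule V_measurable_pair[OF s])
  show "0 \<le> V s y d" "V s y d \<le> 1" for y d using V_bounds[OF s] by auto
  show "V s y d = 1" if "y < a1 \<or> y + d < a2" for y d by (rule V_eq_1[OF s that])
  show "V s y d = tint lam (lam + s) {0..} (\<lambda>t. avg (\<lambda>z. V s (exp (r * t) * y - z) (exp (r * t) * d)))"
    if "a1 \<le> y" "a2 \<le> y + d" for y d by (rule V_renewal_equation[OF s that])
  show "V s y d = V s y 0" if "0 \<le> d" for y d unfolding V_def ruin_times_right[OF that] ..
  show "V s y d = V s y' d'" if "d \<le> a2 - a1" "d' \<le> a2 - a1" "y + d = y' + d'" for y d y' d'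
    unfolding V_def ruin_times_left[OF that(1)] ruin_times_left[OF that(2)] that(3) ..
  show "V s y 0 \<le> V s y (- e)" if "0 \<le> e" for y e by (intro V_mono[OF s] ruin_times_antimono that)
  show "V s y (- e) \<le> V s (y - e) 0" if "0 \<le> e" for y e by (intro V_mono[OF s] ruin_times_shift that)
  show "V s y (- e) - V s y 0 \<le> 2 * (e / (a1 - a2)) powr (s / (2 * r)) * (V (s / 2) y (- e) - V (s / 2) y 0)"
    if e: "0 < e" for y e
  proof -
    have s2: "0 < s / 2" using s by simp
    have "V s y (- e) - V s y 0 = (\<integral>\<omega>. disc s (ruin_times y (- e) \<omega>) - disc s (ruin_times y 0 \<omega>) \<partial>M)"
      unfolding V_def by (intro Bochner_Integration.integral_diff[symmetric] disc_integrable[OF s])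
    also have "\<dots> \<le> (\<integral>\<omega>. 2 * (e / (a1 - a2)) powr (s / (2 * r)) *
        (disc (s / 2) (ruin_times y (- e) \<omega>) - disc (s / 2) (ruin_times y 0 \<omega>)) \<partial>M)"
      by (intro integral_mono disc_gap[OF s e] integrable_mult_right Bochner_Integration.integrable_diff
          disc_integrable[OF s] disc_integrable[OF s2])
    also have "\<dots> = 2 * (e / (a1 - a2)) powr (s / (2 * r)) * (V (s / 2) y (- e) - V (s / 2) y 0)"
      unfolding V_def by (subst Bochner_Integration.integral_diff[OF disc_integrable[OF s2] disc_integrable[OF s2], symmetric]) simp
    finally show ?thesis .
  qed
qed

end

section \<open>Uniqueness along the flow\<close>

locale ide = claim_density f for f +
  fixes r lam s c1 c2 \<delta>1 \<delta>2 :: real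
  assumes r: "0 < r" and lam: "0 < lam" and s: "0 < s" and c: "0 < c1" "0 < c2"
    and \<delta>: "0 < \<delta>1" "0 < \<delta>2" and drift: "c2 / \<delta>2 < c1 / \<delta>1"
begin

definition domain :: "(real \<times> real) set" where
  "domain = {(x, y). 0 \<le> x \<and> x / \<delta>1 \<le> y / \<delta>2}"

definition jump :: "(real \<Rightarrow> real \<Rightarrow> real) \<Rightarrow> real \<Rightarrow> real \<Rightarrow> real" where
  "jump g u1 u2 = (LINT z:{0..}|lborel. g (u1 - \<delta>1 * z) (u2 - \<delta>2 * z) * f z)"

definition solution_at :: "(real \<Rightarrow> real \<Rightarrow> real) \<Rightarrow> real \<Rightarrow> real \<Rightarrow> bool" where
  "solution_at g u1 u2 \<longleftrightarrow> (\<exists>a b. ((\<lambda>p. g (fst p) (snd p)) has_derivative (\<lambda>h. a * fst h + b * snd h)) (at (u1, u2) within domain)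
     \<and> (u1 + c1 / r) * a + (u2 + c2 / r) * b - (lam + s) / r * g u1 u2 + lam / r * jump g u1 u2 = 0)"

definition flow :: "real \<Rightarrow> real \<Rightarrow> real \<Rightarrow> real \<times> real" where
  "flow u1 u2 t = (exp (r * t) * (u1 + c1 / r) - c1 / r, exp (r * t) * (u2 + c2 / r) - c2 / r)"

definition admissible :: "(real \<Rightarrow> real \<Rightarrow> real) \<Rightarrow> bool" where
  "admissible g \<longleftrightarrow> (\<exists>C. \<forall>(u1, u2)\<in>domain. \<bar>g u1 u2\<bar> \<le> C) \<and> (\<forall>u1 u2. min u1 u2 < 0 \<longrightarrow> g u1 u2 = 1)
     \<and> (\<forall>(u1, u2)\<in>domain. solution_at g u1 u2)"

lemma jump_avg: "jump g u1 u2 = avg (\<lambda>z. g (u1 - \<delta>1 * z) (u2 - \<delta>2 * z))"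
  unfolding jump_def avg_def set_lebesgue_integral_def
  by (rule Bochner_Integration.integral_cong) (auto simp: indicator_def f_neg)

lemma claim_line_in_domain:
  assumes "(u1, u2) \<in> domain" "0 \<le> z" "z \<le> u1 / \<delta>1"
  shows "(u1 - \<delta>1 * z, u2 - \<delta>2 * z) \<in> domain"
  using assms \<delta> by (auto simp: domain_def field_simps)

text \<open>Agrees with the integrand of \<open>jump\<close> for z >= 0: a claim preserves u2 /
  \<delta>2 - u1 / \<delta>1, so its line leaves the domain only through u1 < 0, where an admissible
  g is 1. Writing that value out makes the integrand measurable from the continuity of g on the
  domain alone.\<close>

definition line_value :: "(real \<Rightarrow> real \<Rightarrow> real) \<Rightarrow> real \<Rightarrow> real \<Rightarrow> real \<Rightarrow> real" where
  "line_value g u1 u2 z = (if z \<in> {0..u1 / \<delta>1} then g (u1 - \<delta>1 * z) (u2 - \<delta>2 * z) else 1)"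

lemma jump_line_value:
  assumes g: "admissible g"
  shows "jump g u1 u2 = avg (line_value g u1 u2)"
  unfolding jump_avg
proof (rule avg_cong)
  fix z :: real assume z: "0 \<le> z"
  show "g (u1 - \<delta>1 * z) (u2 - \<delta>2 * z) = line_value g u1 u2 z"
  proof (cases "z \<le> u1 / \<delta>1")
    case False
    then have "u1 - \<delta>1 * z < 0" using \<delta> by (simp add: field_simps)
    then have "g (u1 - \<delta>1 * z) (u2 - \<delta>2 * z) = 1" using g unfolding admissible_def by simp
    then show ?thesis using False by (simp add: line_value_def)
  qed (use z in \<open>simp add: line_value_def\<close>)
qed

lemma line_value_measurable:
  assumes g: "admissible g" and u: "(u1, u2) \<in> domain"
  shows "line_value g u1 u2 \<in> borel_measurable borel"
proof -
  have "continuous_on domain (\<lambda>p. g (fst p) (snd p))"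
    unfolding continuous_on_eq_continuous_within
  proof
    fix p assume "p \<in> domain"
    then show "continuous (at p within domain) (\<lambda>p. g (fst p) (snd p))"
      using g has_derivative_continuous unfolding admissible_def solution_at_def by (cases p) blast
  qed
  then have "continuous_on {0..u1 / \<delta>1} (\<lambda>z. g (fst (u1 - \<delta>1 * z, u2 - \<delta>2 * z)) (snd (u1 - \<delta>1 * z, u2 - \<delta>2 * z)))"
    by (rule continuous_on_compose2) (use claim_line_in_domain[OF u] in \<open>auto intro!: continuous_intros\<close>)
  then show ?thesis unfolding line_value_def[abs_def]
    by (intro borel_measurable_continuous_on_if) auto
qed

lemma exp_deriv: "((\<lambda>t. exp (- b * t)) has_real_derivative - b * exp (- b * t)) (at t within S)" for b :: real
  by (auto intro!: derivative_eq_intros)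

text \<open>The coefficients of the equation are the velocity of the flow divided by r, so the
  first-order part is a derivative in time; the integrating factor absorbs the term with lam +
  s.\<close>

lemma solution_along_flow:
  assumes g: "admissible g" and D: "\<And>t. t \<in> {0..T} \<Longrightarrow> flow u1 u2 t \<in> domain" and t: "t \<in> {0..T}"
  shows "((\<lambda>t. exp (- (lam + s) * t) * g (fst (flow u1 u2 t)) (snd (flow u1 u2 t))) has_real_derivative
    - lam * exp (- (lam + s) * t) * jump g (fst (flow u1 u2 t)) (snd (flow u1 u2 t))) (at t within {0..T})"
proof -
  obtain v1 v2 where v: "flow u1 u2 t = (v1, v2)" by fastforce
  have vd: "(v1, v2) \<in> domain" using D[OF t] v by simp
  then obtain a b where ab: "((\<lambda>p. g (fst p) (snd p)) has_derivative (\<lambda>h. a * fst h + b * snd h)) (at (v1, v2) within domain)"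
    "(v1 + c1 / r) * a + (v2 + c2 / r) * b - (lam + s) / r * g v1 v2 + lam / r * jump g v1 v2 = 0"
    using g unfolding admissible_def solution_at_def by blast
  define p1 where "p1 = v1 + c1 / r"
  define p2 where "p2 = v2 + c2 / r"
  have v12: "p1 = exp (r * t) * (u1 + c1 / r)" "p2 = exp (r * t) * (u2 + c2 / r)"
    using v by (auto simp: flow_def p1_def p2_def)
  have fl: "(flow u1 u2 has_derivative (\<lambda>h. (h * (r * p1), h * (r * p2)))) (at t within {0..T})"
    unfolding flow_def[abs_def] v12
    by (intro has_derivative_Pair) (auto intro!: derivative_eq_intros simp: fun_eq_iff algebra_simps)
  have "((\<lambda>p. g (fst p) (snd p)) has_derivative (\<lambda>h. a * fst h + b * snd h)) (at (flow u1 u2 t) within flow u1 u2 ` {0..T})"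
    unfolding v by (rule has_derivative_subset[OF ab(1)]) (use D in auto)
  from has_derivative_in_compose[OF fl this]
  have "((\<lambda>t. g (fst (flow u1 u2 t)) (snd (flow u1 u2 t))) has_real_derivative (r * (p1 * a + p2 * b))) (at t within {0..T})"
    unfolding has_field_derivative_def by (rule has_derivative_eq_rhs) (simp add: fun_eq_iff algebra_simps)
  moreover have "r * (p1 * a + p2 * b) = (lam + s) * g v1 v2 - lam * jump g v1 v2"
  proof -
    have "p1 * a + p2 * b = (lam + s) / r * g v1 v2 - lam / r * jump g v1 v2"
      using ab(2) unfolding p1_def p2_def by linarith
    then have "r * (p1 * a + p2 * b) = r * ((lam + s) / r * g v1 v2 - lam / r * jump g v1 v2)" by (rule arg_cong)
    also have "\<dots> = (lam + s) * g v1 v2 - lam * jump g v1 v2" using r by (simp add: right_diff_distrib)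
    finally show ?thesis .
  qed
  ultimately have "((\<lambda>t. g (fst (flow u1 u2 t)) (snd (flow u1 u2 t))) has_real_derivative ((lam + s) * g v1 v2 - lam * jump g v1 v2)) (at t within {0..T})"
    by simp
  from DERIV_mult[OF exp_deriv this, of "lam + s"]
  show ?thesis unfolding v by (simp add: v algebra_simps)
qed

text \<open>A monotonicity argument replaces integration in time, so nothing about the regularity of
  \<open>jump\<close> along the flow enters.\<close>

lemma flow_comparison:
  assumes g: "admissible g" and h: "admissible h" and D: "\<And>t. t \<in> {0..T} \<Longrightarrow> flow u1 u2 t \<in> domain" and T: "0 \<le> T"
    and B: "\<And>u1 u2. (u1, u2) \<in> domain \<Longrightarrow> \<bar>g u1 u2 - h u1 u2\<bar> \<le> B"
  shows "g u1 u2 - h u1 u2 \<le> lam / (lam + s) * B +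
    exp (- (lam + s) * T) * (g (fst (flow u1 u2 T)) (snd (flow u1 u2 T)) - h (fst (flow u1 u2 T)) (snd (flow u1 u2 T)))"
proof -
  \<comment> \<open>The last term is the contribution of a jump difference constantly equal to B;
    its derivative dominates that of the actual jump difference, so Y cannot decrease.\<close>
  define Y where "Y t = exp (- (lam + s) * t) * g (fst (flow u1 u2 t)) (snd (flow u1 u2 t))
    - exp (- (lam + s) * t) * h (fst (flow u1 u2 t)) (snd (flow u1 u2 t)) - lam / (lam + s) * B * exp (- (lam + s) * t)" for t
  have pos: "0 < lam + s" using lam s by simp
  have deriv: "(Y has_real_derivative lam * exp (- (lam + s) * t) *
      (B - (jump g (fst (flow u1 u2 t)) (snd (flow u1 u2 t)) - jump h (fst (flow u1 u2 t)) (snd (flow u1 u2 t))))) (at t within {0..T})"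
    if t: "t \<in> {0..T}" for t
  proof -
    have "((\<lambda>t. lam / (lam + s) * B * exp (- (lam + s) * t)) has_real_derivative
        lam / (lam + s) * B * (- (lam + s) * exp (- (lam + s) * t))) (at t within {0..T})"
      by (intro DERIV_cmult exp_deriv)
    moreover have "lam / (lam + s) * B * (- (lam + s) * exp (- (lam + s) * t)) = - lam * B * exp (- (lam + s) * t)"
    proof -
      have "lam / (lam + s) * (lam + s) = lam" using pos by simp
      moreover have "lam / (lam + s) * B * (- (lam + s) * exp (- (lam + s) * t)) = - (lam / (lam + s) * (lam + s)) * B * exp (- (lam + s) * t)"
        by (simp only: mult_ac mult_minus_left mult_minus_right mult_1_right)
      ultimately show ?thesis by simp
    qed
    ultimately have "((\<lambda>t. lam / (lam + s) * B * exp (- (lam + s) * t)) has_real_derivative - lam * B * exp (- (lam + s) * t)) (at t within {0..T})"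
      by (simp only:)
    from DERIV_diff[OF DERIV_diff[OF solution_along_flow[OF g D t] solution_along_flow[OF h D t]] this]
    show ?thesis unfolding Y_def[abs_def] by (simp add: algebra_simps)
  qed
  have "Y 0 \<le> Y T"
  proof (rule DERIV_nonneg_imp_increasing_open[OF T])
    show "continuous_on {0..T} Y"
      unfolding continuous_on_eq_continuous_within using deriv DERIV_continuous by blast
    fix t assume t: "0 < t" "t < T"
    obtain v1 v2 where v: "flow u1 u2 t = (v1, v2)" by fastforce
    have vd: "(v1, v2) \<in> domain" using D[of t] t v by simp
    obtain C C' where C: "\<And>u1 u2. (u1, u2) \<in> domain \<Longrightarrow> \<bar>g u1 u2\<bar> \<le> C" "\<And>u1 u2. (u1, u2) \<in> domain \<Longrightarrow> \<bar>h u1 u2\<bar> \<le> C'"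
      using g h unfolding admissible_def by blast
    have "0 \<le> B" using B[OF vd] by simp
    have "jump g v1 v2 - jump h v1 v2 = avg (\<lambda>z. line_value g v1 v2 z - line_value h v1 v2 z)"
      unfolding jump_line_value[OF g] jump_line_value[OF h]
      by (rule avg_diff[OF line_value_measurable[OF g vd] _ line_value_measurable[OF h vd], where B = "max C 1" and B' = "max C' 1"])
        (use C claim_line_in_domain[OF vd] in \<open>auto simp: line_value_def le_max_iff_disj\<close>)
    also have "\<bar>\<dots>\<bar> \<le> B"
    proof (rule avg_abs_le)
      show "(\<lambda>z. line_value g v1 v2 z - line_value h v1 v2 z) \<in> borel_measurable borel"
        using line_value_measurable[OF g vd] line_value_measurable[OF h vd] by measurable
      show "\<bar>line_value g v1 v2 z - line_value h v1 v2 z\<bar> \<le> B" if "0 \<le> z" for z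
        using B claim_line_in_domain[OF vd] \<open>0 \<le> B\<close> by (auto simp: line_value_def)
    qed
    finally have "0 \<le> B - (jump g v1 v2 - jump h v1 v2)" by linarith
    then have "0 \<le> lam * exp (- (lam + s) * t) * (B - (jump g v1 v2 - jump h v1 v2))" using lam by simp
    then show "\<exists>y. (Y has_real_derivative y) (at t) \<and> 0 \<le> y"
      using deriv[of t] t v at_within_Icc_at[of 0 t T] by auto
  qed
  moreover have "Y 0 = g u1 u2 - h u1 u2 - lam / (lam + s) * B" by (simp add: Y_def flow_def)
  moreover have "0 \<le> lam / (lam + s) * B * exp (- (lam + s) * T)"
  proof -
    have "(u1, u2) \<in> domain" using D[of 0] T by (simp add: flow_def)
    then have "0 \<le> B" using B by force
    then show ?thesis using pos lam by simp
  qed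
  ultimately show ?thesis unfolding Y_def by (simp add: algebra_simps)
qed

lemma admissible_unique:
  assumes g: "admissible g" and h: "admissible h"
    and diag: "\<And>x. g x (\<delta>2 / \<delta>1 * x) = h x (\<delta>2 / \<delta>1 * x)"
    and u: "(u1, u2) \<in> domain"
  shows "g u1 u2 = h u1 u2"
proof -
  define q where "q = lam / (lam + s)"
  have q: "0 \<le> q" "q < 1" using lam s by (auto simp: q_def)
  define k where "k = c1 / (\<delta>1 * r) - c2 / (\<delta>2 * r)"
  have k: "0 < k"
  proof -
    have "k = (c1 / \<delta>1 - c2 / \<delta>2) / r" using r \<delta> by (simp add: k_def field_simps)
    then show ?thesis using drift r by simp
  qed
  \<comment> \<open>Stated for arbitrary g and h, so that exchanging them later yields a bound on
    the absolute value.\<close>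
  have one_sided: "g u1 u2 - h u1 u2 \<le> q * B"
    if g: "admissible g" and h: "admissible h"
      and diag: "\<And>x. g x (\<delta>2 / \<delta>1 * x) = h x (\<delta>2 / \<delta>1 * x)"
      and B: "\<And>u1 u2. (u1, u2) \<in> domain \<Longrightarrow> \<bar>g u1 u2 - h u1 u2\<bar> \<le> B"
      and u: "(u1, u2) \<in> domain" for g h B u1 u2
  proof -
    \<comment> \<open>k is a1 - a2, and d is the transversal coordinate of the scaled model: claims
      leave it unchanged, the flow multiplies it by exp(r t), and the diagonal is d = -k.\<close>
    define d where "d = u2 / \<delta>2 - u1 / \<delta>1 - k"
    have d: "- k \<le> d" using u by (auto simp: d_def domain_def)
    have fl: "snd (flow u1 u2 t) / \<delta>2 - fst (flow u1 u2 t) / \<delta>1 = k + exp (r * t) * d" for t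
    proof -
      have "snd (flow u1 u2 t) / \<delta>2 - fst (flow u1 u2 t) / \<delta>1
        = exp (r * t) * ((u2 + c2 / r) / \<delta>2 - (u1 + c1 / r) / \<delta>1) + (c1 / (\<delta>1 * r) - c2 / (\<delta>2 * r))"
        using r \<delta> by (simp add: flow_def field_simps)
      moreover have "(u2 + c2 / r) / \<delta>2 - (u1 + c1 / r) / \<delta>1 = d"
        using r \<delta> by (simp add: d_def k_def field_simps)
      ultimately show ?thesis by (simp add: k_def)
    qed
    have dom: "flow u1 u2 t \<in> domain" if t: "0 \<le> t" "- k \<le> exp (r * t) * d" for t
    proof -
      have "1 \<le> exp (r * t)" using t r by simp
      then have "1 * (u1 + c1 / r) \<le> exp (r * t) * (u1 + c1 / r)"
        using u r c by (intro mult_right_mono) (auto simp: domain_def)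
      then have "0 \<le> fst (flow u1 u2 t)" using u by (simp add: flow_def domain_def)
      then show ?thesis using fl[of t] t(2) by (cases "flow u1 u2 t") (simp add: domain_def)
    qed
    show ?thesis
    proof (cases "0 \<le> d")
      case True
      \<comment> \<open>The flow never meets the diagonal; the difference at time T is bounded by B
        and the discount removes it as T grows.\<close>
      have "g u1 u2 - h u1 u2 \<le> q * B + exp (- (lam + s) * T) * B" if T: "0 \<le> T" for T
      proof -
        have D: "flow u1 u2 t \<in> domain" if "t \<in> {0..T}" for t
        proof (rule dom)
          have "0 \<le> exp (r * t) * d" using True by simp
          then show "- k \<le> exp (r * t) * d" using k by linarith
        qed (use that in simp)
        have "(fst (flow u1 u2 T), snd (flow u1 u2 T)) \<in> domain" using D[of T] T by simp
        then have "\<bar>g (fst (flow u1 u2 T)) (snd (flow u1 u2 T)) - h (fst (flow u1 u2 T)) (snd (flow u1 u2 T))\<bar> \<le> B" by (rule B)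
        then have "exp (- (lam + s) * T) * (g (fst (flow u1 u2 T)) (snd (flow u1 u2 T)) - h (fst (flow u1 u2 T)) (snd (flow u1 u2 T)))
          \<le> exp (- (lam + s) * T) * B" by (intro mult_left_mono) auto
        then show ?thesis using flow_comparison[OF g h D T B] unfolding q_def by linarith
      qed
      then have ev: "\<forall>\<^sub>F T in at_top. g u1 u2 - h u1 u2 \<le> q * B + exp (- (lam + s) * T) * B"
        by (intro eventually_at_top_linorderI[of 0])
      have lim: "((\<lambda>T. q * B + exp (- (lam + s) * T) * B) \<longlongrightarrow> q * B + 0 * B) at_top"
      proof (intro tendsto_intros)
        have "filterlim (\<lambda>T. (lam + s) * T) at_top at_top"
          using lam s by (intro filterlim_tendsto_pos_mult_at_top[OF tendsto_const] filterlim_ident) auto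
        then have "filterlim (\<lambda>T. - ((lam + s) * T)) at_bot at_top" by (simp add: filterlim_uminus_at_bot)
        then have "filterlim (\<lambda>T. - (lam + s) * T) at_bot at_top" by (simp only: mult_minus_left)
        then show "((\<lambda>T. exp (- (lam + s) * T)) \<longlongrightarrow> 0) at_top" by (rule filterlim_compose[OF exp_at_bot])
      qed
      have "g u1 u2 - h u1 u2 \<le> q * B + 0 * B"
        by (rule tendsto_lowerbound[OF lim ev]) simp
      then show ?thesis by simp
    next
      case False
      \<comment> \<open>Time at which exp(r t) d reaches -k, so that the trajectory ends on the
        diagonal, where g and h agree.\<close>
      define T where "T = ln (k / - d) / r"
      have "1 \<le> k / - d" by (subst le_divide_eq_1_pos) (use d False in auto)
      then have T: "0 \<le> T" using r by (simp add: T_def)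
      have eT: "exp (r * T) = k / - d" using k False r by (simp add: T_def divide_pos_neg)
      have D: "flow u1 u2 t \<in> domain" if "t \<in> {0..T}" for t
      proof (rule dom)
        have "exp (r * t) \<le> exp (r * T)" using that r by simp
        then have "exp (r * T) * d \<le> exp (r * t) * d" using False by (intro mult_right_mono_neg) auto
        then show "- k \<le> exp (r * t) * d" using eT False by simp
      qed (use that in simp)
      have "snd (flow u1 u2 T) / \<delta>2 - fst (flow u1 u2 T) / \<delta>1 = 0" using fl[of T] eT False by simp
      then have "snd (flow u1 u2 T) = \<delta>2 / \<delta>1 * fst (flow u1 u2 T)" using \<delta> by (simp add: field_simps)
      then have "g (fst (flow u1 u2 T)) (snd (flow u1 u2 T)) = h (fst (flow u1 u2 T)) (snd (flow u1 u2 T))" using diag by simp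
      then show ?thesis using flow_comparison[OF g h D T B] unfolding q_def by simp
    qed
  qed
  obtain C C' where C: "\<And>u1 u2. (u1, u2) \<in> domain \<Longrightarrow> \<bar>g u1 u2\<bar> \<le> C" "\<And>u1 u2. (u1, u2) \<in> domain \<Longrightarrow> \<bar>h u1 u2\<bar> \<le> C'"
    using g h unfolding admissible_def by blast
  have bd: "(u1, u2) \<in> domain \<Longrightarrow> \<bar>g u1 u2 - h u1 u2\<bar> \<le> q ^ n * (C + C')" for n u1 u2
  proof (induction n arbitrary: u1 u2)
    case 0
    then show ?case using C(1)[of u1 u2] C(2)[of u1 u2] by simp
  next
    case (Suc n)
    have "g u1 u2 - h u1 u2 \<le> q * (q ^ n * (C + C'))" by (rule one_sided[OF g h diag Suc.IH Suc.prems])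
    moreover have "h u1 u2 - g u1 u2 \<le> q * (q ^ n * (C + C'))"
    proof (rule one_sided[OF h g diag[symmetric] _ Suc.prems])
      show "\<bar>h v1 v2 - g v1 v2\<bar> \<le> q ^ n * (C + C')" if "(v1, v2) \<in> domain" for v1 v2
        using Suc.IH[OF that] by (simp add: abs_minus_commute)
    qed
    ultimately show ?case by (simp add: abs_le_iff mult.assoc)
  qed
  have "(\<lambda>n. q ^ n * (C + C')) \<longlonglongrightarrow> 0" using q by (intro tendsto_mult_left_zero LIMSEQ_power_zero) auto
  then have "\<bar>g u1 u2 - h u1 u2\<bar> \<le> 0" by (rule LIMSEQ_le_const) (use bd[OF u] in auto)
  then show ?thesis by simp
qed

end

section \<open>Transfer to the original coordinates\<close>

lemma claim_density_of_distributed: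
  assumes M: "prob_space M" and f: "\<forall>x. 0 \<le> f x" "\<forall>x<0. f x = 0"
    and X: "distributed M lborel X (\<lambda>x. ennreal (f x))"
  shows "claim_density f"
proof
  interpret prob_space M by (rule M)
  show m: "f \<in> borel_measurable borel"
    using distributed_real_measurable[OF _ X] f by simp
  have nn: "(\<integral>\<^sup>+x. ennreal (f x) \<partial>lborel) = 1"
    using distributed_nn_integral[OF X, of "\<lambda>_. 1"] by (simp add: emeasure_space_1)
  show int: "integrable lborel f"
    by (rule integrableI_nonneg) (use m f nn in auto)
  show "(\<integral>x. f x \<partial>lborel) = 1"
    by (subst integral_eq_nn_integral) (use m f nn in auto)
qed (use f in auto)

theorem theorem2p1:
  fixes M :: "'a measure" and E \<sigma> :: "nat \<Rightarrow> 'a \<Rightarrow> real" and f :: "real \<Rightarrow> real"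
    and r lam c1 c2 \<delta>1 \<delta>2 s :: real
  assumes "prob_space M"
    and "r > 0" and "lam > 0" and "c1 > 0" and "c2 > 0"
    and "0 < \<delta>1" and "\<delta>1 < 1" and "0 < \<delta>2" and "\<delta>2 < 1" and "\<delta>1 + \<delta>2 = 1"
    and "prob_space.indep_vars M (\<lambda>_. borel) (\<lambda>i. case i of Inl k \<Rightarrow> E k | Inr k \<Rightarrow> \<sigma> k) UNIV"
    and "\<forall>k. distributed M lborel (E k) (\<lambda>x. ennreal (exponential_density lam x))"
    and "\<forall>x. 0 \<le> f x" and "\<forall>x<0. f x = 0"
    and "\<forall>k. distributed M lborel (\<sigma> k) (\<lambda>x. ennreal (f x))"
    and "c1 / \<delta>1 > c2 / \<delta>2"
    and "s > 0"
  defines "\<Psi> \<equiv> Psi_min M r c1 c2 \<delta>1 \<delta>2 E \<sigma> s"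
    and "D \<equiv> {(u1, u2). 0 \<le> u1 \<and> u1 / \<delta>1 \<le> u2 / \<delta>2}"
    and "IDE \<equiv> \<lambda>(g :: real \<Rightarrow> real \<Rightarrow> real) u1 u2. \<exists>a b.
           ((\<lambda>p. g (fst p) (snd p)) has_derivative (\<lambda>h. a * fst h + b * snd h)) (at (u1, u2) within {(x, y). 0 \<le> x \<and> x / \<delta>1 \<le> y / \<delta>2})
         \<and> (u1 + c1 / r) * a + (u2 + c2 / r) * b - (lam + s) / r * g u1 u2
           + lam / r * (LINT z:{0..}|lborel. g (u1 - \<delta>1 * z) (u2 - \<delta>2 * z) * f z) = 0"
    and "BC \<equiv> \<lambda>(g :: real \<Rightarrow> real \<Rightarrow> real). \<forall>u1.
           g u1 (\<delta>2 / \<delta>1 * u1) = laplace_ruin M s (ruin_time_1d r c2 \<delta>2 E \<sigma> (\<delta>2 / \<delta>1 * u1))"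
  shows "(\<forall>(u1, u2) \<in> D. IDE \<Psi> u1 u2) \<and> BC \<Psi> \<and>
         (\<forall>g :: real \<Rightarrow> real \<Rightarrow> real.
             bounded ((\<lambda>(u1, u2). g u1 u2) ` D)
           \<and> (\<forall>u1 u2. min u1 u2 < 0 \<longrightarrow> g u1 u2 = 1)
           \<and> (\<forall>(u1, u2) \<in> D. IDE g u1 u2)
           \<and> BC g
           \<longrightarrow> (\<forall>(u1, u2) \<in> D. g u1 u2 = \<Psi> u1 u2))"
proof -
  define a1 where "a1 = c1 / (\<delta>1 * r)"
  define a2 where "a2 = c2 / (\<delta>2 * r)"
  note r = \<open>r > 0\<close> and s = \<open>s > 0\<close> and \<delta>1 = \<open>0 < \<delta>1\<close> and \<delta>2 = \<open>0 < \<delta>2\<close>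
  have f: "claim_density f"
    by (rule claim_density_of_distributed[where X = "\<sigma> 0"]) (use assms(1,13-15) in auto)
  have a: "0 < a2" "a2 < a1"
  proof -
    show "0 < a2" using assms by (simp add: a2_def)
    have "c2 / \<delta>2 / r < c1 / \<delta>1 / r" using assms by (intro divide_strict_right_mono) auto
    then show "a2 < a1" by (simp add: a1_def a2_def)
  qed
  interpret risk M f r lam a1 a2 E \<sigma>
    by (intro risk.intro risk_axioms.intro f) (use assms a in auto)
  interpret R: renewal f r lam a1 a2 V by (rule renewal_V)
  interpret ide f r lam s c1 c2 \<delta>1 \<delta>2
    by (intro ide.intro ide_axioms.intro f) (use assms in auto)
  have D: "D = domain" by (simp add: D_def domain_def)
  have IDE: "IDE = solution_at"
    by (simp add: IDE_def solution_at_def jump_def domain_def fun_eq_iff)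
  define L where "L u = (fst u / \<delta>1 + a1, (snd u / \<delta>2 + a2) - (fst u / \<delta>1 + a1))" for u
  have L_upper: "(u1, u2) \<in> domain \<longleftrightarrow> L (u1, u2) \<in> R.upper" for u1 u2
    using \<delta>1 by (simp add: domain_def L_def R.upper_def zero_le_divide_iff)
  have surplus1: "surplus r c1 \<delta>1 u E \<sigma> t \<omega> < 0 \<longleftrightarrow> exp (r * t) * (u / \<delta>1 + a1) < a1 + claims r E \<sigma> t \<omega>"
    and surplus2: "surplus r c2 \<delta>2 u E \<sigma> t \<omega> < 0 \<longleftrightarrow> exp (r * t) * (u / \<delta>2 + a2) < a2 + claims r E \<sigma> t \<omega>" for u t \<omega>
    unfolding a1_def a2_def by (rule surplus_neg_iff[OF r \<delta>1], rule surplus_neg_iff[OF r \<delta>2])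
  have \<Psi>: "\<Psi> u1 u2 = V s (fst (L (u1, u2))) (snd (L (u1, u2)))" for u1 u2
    unfolding \<Psi>_def Psi_min_def
  proof (rule laplace_ruin_V[OF s])
    fix \<omega>
    have "{ereal t | t. 0 \<le> t \<and> min (surplus r c1 \<delta>1 u1 E \<sigma> t \<omega>) (surplus r c2 \<delta>2 u2 E \<sigma> t \<omega>) < 0}
      = ereal ` ruin_times (fst (L (u1, u2))) (snd (L (u1, u2))) \<omega>"
      unfolding min_less_iff_disj surplus1 surplus2 ruin_set_def L_def by auto
    then show "ruin_time_min r c1 c2 \<delta>1 \<delta>2 E \<sigma> u1 u2 \<omega> = Inf (ereal ` ruin_times (fst (L (u1, u2))) (snd (L (u1, u2))) \<omega>)"
      unfolding ruin_time_min_def by simp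
  qed
  have BC: "BC \<Psi>"
    unfolding BC_def
  proof
    fix u1
    have "\<delta>2 / \<delta>1 * u1 / \<delta>2 = u1 / \<delta>1" using \<delta>2 by simp
    \<comment> \<open>The whole diagonal line, negative reserves included, goes to d = a2 - a1,
      where \<open>ruin_times_left\<close> identifies joint ruin with ruin of the second line path
      by path.\<close>
    then have L1: "L (u1, \<delta>2 / \<delta>1 * u1) = (u1 / \<delta>1 + a1, a2 - a1)" by (simp add: L_def)
    have "laplace_ruin M s (ruin_time_1d r c2 \<delta>2 E \<sigma> (\<delta>2 / \<delta>1 * u1)) = V s (u1 / \<delta>1 + a1) (a2 - a1)"
    proof (rule laplace_ruin_V[OF s])
      fix \<omega>
      have "{ereal t | t. 0 \<le> t \<and> surplus r c2 \<delta>2 (\<delta>2 / \<delta>1 * u1) E \<sigma> t \<omega> < 0}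
        = ereal ` ruin_times (u1 / \<delta>1 + a1) (a2 - a1) \<omega>"
        unfolding surplus2 ruin_times_left[OF order_refl] using \<delta>2 by auto
      then show "ruin_time_1d r c2 \<delta>2 E \<sigma> (\<delta>2 / \<delta>1 * u1) \<omega> = Inf (ereal ` ruin_times (u1 / \<delta>1 + a1) (a2 - a1) \<omega>)"
        unfolding ruin_time_1d_def by simp
    qed
    then show "\<Psi> u1 (\<delta>2 / \<delta>1 * u1) = laplace_ruin M s (ruin_time_1d r c2 \<delta>2 E \<sigma> (\<delta>2 / \<delta>1 * u1))"
      unfolding \<Psi> L1 by simp
  qed
  have sol: "solution_at \<Psi> u1 u2" if u: "(u1, u2) \<in> domain" for u1 u2
  proof -
    obtain y d where yd: "L (u1, u2) = (y, d)" by fastforce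
    have up: "(y, d) \<in> R.upper" using u L_upper yd by simp
    obtain a b where ab: "((\<lambda>p. V s (fst p) (snd p)) has_derivative (\<lambda>h. a * fst h + b * snd h)) (at (y, d) within R.upper)"
      "r * (y * a + d * b) = (lam + s) * V s y d - lam * R.G s y d"
      using R.V_frechet[OF s up] by blast
    have L': "(L has_derivative (\<lambda>h. (fst h / \<delta>1, snd h / \<delta>2 - fst h / \<delta>1))) (at (u1, u2) within domain)"
      unfolding L_def[abs_def] using \<delta>1 \<delta>2 by (auto intro!: derivative_eq_intros)
    have "((\<lambda>p. V s (fst p) (snd p)) has_derivative (\<lambda>h. a * fst h + b * snd h)) (at (L (u1, u2)) within L ` domain)"
      unfolding yd by (rule has_derivative_subset[OF ab(1)]) (use L_upper in auto)
    from has_derivative_in_compose[OF L' this]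
    \<comment> \<open>Coefficients from the chain rule: u1 enters y and, with the opposite sign, d;
      u2 enters d only.\<close>
    have "((\<lambda>p. \<Psi> (fst p) (snd p)) has_derivative (\<lambda>h. (a - b) / \<delta>1 * fst h + b / \<delta>2 * snd h)) (at (u1, u2) within domain)"
      unfolding \<Psi> prod.collapse by (rule has_derivative_eq_rhs) (use \<delta>1 \<delta>2 in \<open>simp add: fun_eq_iff field_simps\<close>)
    moreover have "(u1 + c1 / r) * ((a - b) / \<delta>1) + (u2 + c2 / r) * (b / \<delta>2) - (lam + s) / r * \<Psi> u1 u2 + lam / r * jump \<Psi> u1 u2 = 0"
    proof -
      have "jump \<Psi> u1 u2 = R.G s y d"
        unfolding jump_avg R.G_def
      proof (rule avg_cong)
        fix z
        have "L (u1 - \<delta>1 * z, u2 - \<delta>2 * z) = (y - z, d)"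
          using yd \<delta>1 \<delta>2 by (auto simp: L_def diff_divide_distrib)
        then show "\<Psi> (u1 - \<delta>1 * z) (u2 - \<delta>2 * z) = V s (y - z) d" unfolding \<Psi> by simp
      qed
      moreover have "\<Psi> u1 u2 = V s y d" unfolding \<Psi> yd by simp
      moreover have "(u1 + c1 / r) * ((a - b) / \<delta>1) + (u2 + c2 / r) * (b / \<delta>2) = y * a + d * b"
      proof -
        have "y = u1 / \<delta>1 + a1" "y + d = u2 / \<delta>2 + a2" using yd by (auto simp: L_def)
        then have "u1 + c1 / r = \<delta>1 * y" "u2 + c2 / r = \<delta>2 * (y + d)"
          using \<delta>1 \<delta>2 by (simp_all add: a1_def a2_def distrib_left)
        then have "(u1 + c1 / r) * ((a - b) / \<delta>1) = y * (a - b)" "(u2 + c2 / r) * (b / \<delta>2) = (y + d) * b"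
          using \<delta>1 \<delta>2 by simp_all
        then show ?thesis by (simp add: algebra_simps)
      qed
      moreover have "y * a + d * b = (lam + s) / r * V s y d - lam / r * R.G s y d"
      proof -
        have "y * a + d * b = r * (y * a + d * b) / r" using r by simp
        then show ?thesis unfolding ab(2) by (simp add: diff_divide_distrib)
      qed
      ultimately show ?thesis by simp
    qed
    ultimately show ?thesis unfolding solution_at_def by blast
  qed
  have "admissible \<Psi>"
    unfolding admissible_def
  proof (intro conjI)
    show "\<exists>C. \<forall>(u1, u2)\<in>domain. \<bar>\<Psi> u1 u2\<bar> \<le> C" unfolding \<Psi> using R.V_abs[OF s] by blast
    show "\<forall>(u1, u2)\<in>domain. solution_at \<Psi> u1 u2" using sol by blast
    show "\<forall>u1 u2. min u1 u2 < 0 \<longrightarrow> \<Psi> u1 u2 = 1"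
    proof (intro allI impI)
      fix u1 u2 :: real assume "min u1 u2 < 0"
      then have "u1 / \<delta>1 < 0 \<or> u2 / \<delta>2 < 0" using \<delta>1 \<delta>2 by (auto simp: divide_less_0_iff)
      then show "\<Psi> u1 u2 = 1" unfolding \<Psi> L_def by (intro R.V_ruin[OF s]) auto
    qed
  qed
  have "g u1 u2 = \<Psi> u1 u2"
    if g: "bounded ((\<lambda>(u1, u2). g u1 u2) ` D)" "\<forall>u1 u2. min u1 u2 < 0 \<longrightarrow> g u1 u2 = 1"
      "\<forall>(u1, u2)\<in>D. IDE g u1 u2" "BC g" and u: "(u1, u2) \<in> D" for g :: "real \<Rightarrow> real \<Rightarrow> real" and u1 u2
  proof (rule admissible_unique[where g = g and h = \<Psi> and ?u1.0 = u1 and ?u2.0 = u2])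
    obtain C where "\<And>p. p \<in> D \<Longrightarrow> norm ((\<lambda>(u1, u2). g u1 u2) p) \<le> C"
      using g(1) unfolding bounded_iff by blast
    then have "\<forall>(u1, u2)\<in>domain. \<bar>g u1 u2\<bar> \<le> C" unfolding D[symmetric] by fastforce
    then show "admissible g" using g(2,3) unfolding admissible_def D IDE by blast
    show "g x (\<delta>2 / \<delta>1 * x) = \<Psi> x (\<delta>2 / \<delta>1 * x)" for x
      using g(4) BC unfolding BC_def by simp
  qed (use u D \<open>admissible \<Psi>\<close> in auto)
  then show ?thesis using sol BC unfolding D IDE by blast
qed

end
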